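(* Let $d\in\{2,3\}$, $N_d=d(d+1)/2$, and let $\rho$, $\bm C$, the mesh $\Omega_h$ of affine elements, the space $V_h(\Omega_h)$, the matrices $\bm A_i,\bm A_n$, the jumps and averages, the boundary conventions, and the operators $T^{-1}_{1/\rho},T^{-1}_{\bm C}$ be as defined in the context. Let $\tau_{\bm v},\tau_{\bm\sigma}\ge0$ be constant on each face (single-valued on shared faces). Suppose $(\bm v,\bm\sigma)(t)\in V_h(\Omega_h)^d\times V_h(\Omega_h)^{N_d}$ is differentiable in $t$ and satisfies the weight-adjusted DG formulation with zero body force: on every element $D^k$, for all $\bm w\in V_h(D^k)^d$ and $\bm q\in V_h(D^k)^{N_d}$, $$\Big(T^{-1}_{1/\rho}\frac{\partial\bm v}{\partial t},\bm w\Big)_{L^2(D^k)}=\Big(\sum_{i=1}^d\bm A_i^T\frac{\partial\bm\sigma}{\partial\bm x_i},\bm w\Big)_{L^2(D^k)}+\Big\langle\tfrac12\bm A_n^T[\![\bm\sigma]\!]+\tfrac{\tau_{\bm v}}2\bm A_n^T\bm A_n[\![\bm v]\!],\bm w\Big\rangle_{L^2(\partial D^k)},$$ $$\Big(T^{-1}_{\bm C}\frac{\partial\bm\sigma}{\partial t},\bm q\Big)_{L^2(D^k)}=\Big(\sum_{i=1}^d\bm A_i\frac{\partial\bm v}{\partial\bm x_i},\bm q\Big)_{L^2(D^k)}+\Big\langle\tfrac12\bm A_n[\![\bm v]\!]+\tfrac{\tau_{\bm\sigma}}2\bm A_n\bm A_n^T[\![\bm\sigma]\!],\bm q\Big\rangle_{L^2(\partial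 D^k)}.$$ Then $$\begin{aligned}\sum_{D^k}\frac12\frac{\partial}{\partial t}\Big((T^{-1}_{1/\rho}\bm v,\bm v)_{L^2(D^k)}+(T^{-1}_{\bm C}\bm\sigma,\bm\sigma)_{L^2(D^k)}\Big)\le&-\sum_{f\in\Gamma_h\setminus\partial\Omega}\int_f\Big(\tfrac{\tau_{\bm v}}2\big|\bm A_n[\![\bm v]\!]\big|^2+\tfrac{\tau_{\bm\sigma}}2\big|\bm A_n^T[\![\bm\sigma]\!]\big|^2\Big)d\bm x\\&-\sum_{f\in\Gamma_v}\int_f\tau_{\bm v}\big|\bm A_n\bm v^-\big|^2d\bm x-\sum_{f\in\Gamma_\sigma}\int_f\tau_{\bm\sigma}\big|\bm A_n^T\bm\sigma^-\big|^2d\bm x\\&-\sum_{f\in\Gamma_{\rm abc}}\int_f\Big(\tfrac{\tau_{\bm v}}2\big|\bm A_n\bm v^-\big|^2+\tfrac{\tau_{\bm\sigma}}2\big|\bm A_n^T\bm\sigma^-\big|^2\Big)d\bm x\;\le\;0.\end{aligned}$$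
   Context: Coefficients. $\rho(\bm x)$ is scalar and $\bm C(\bm x)\in\mathbb R^{N_d\times N_d}$ is symmetric, both independent of time, with $0<\rho_{\min}\le\rho\le\rho_{\max}<\infty$ and $0<c_{\min}\le\bm u^T\bm C(\bm x)\bm u\le c_{\max}<\infty$, $0<\tilde c_{\min}\le\bm u^T\bm C^{-1}(\bm x)\bm u\le\tilde c_{\max}<\infty$ for all $\bm x$ and all unit vectors $\bm u\in\mathbb R^{N_d}$. Matrices. The $\bm A_i\in\mathbb R^{N_d\times d}$ are constant. For a unit normal $\bm n$, $\bm A_n=\sum_{i=1}^d\bm n_i\bm A_i$ (this determines the $\bm A_i$), where for $d=2$: $\bm A_n=\begin{pmatrix} n_x & 0 \\ 0 & n_y \\ n_y & n_x \end{pmatrix}$, and for $d=3$: $\bm A_n=\begin{pmatrix} n_x & 0 & 0 \\ 0 & n_y & 0 \\ 0 & 0 & n_z \\ 0 & n_z & n_y \\ n_z & 0 & n_x \\ n_y & n_x & 0 \end{pmatrix}$. Mesh and space. $\Omega\subset\mathbb R^d$ is a Lipschitz domain exactly triangulated by a (conforming) mesh $\Omega_h$ of affine simplices $D^k$. $V_h(D^k)=P^N(D^k)$ (polynomials of total degree at most $N$) and $V_h(\Omega_h)=\bigoplus_kV_h(D^k)$. $(\cdot,\cdot)_{L^2(D^k)}$ and $\langle\cdot,\cdot\rangle_{L^2(\partial D^k)}$ are the vector $L^2$ inner products on $D^k$ and $\partial D^k$; all integrals are exact. In $\partial D^k$ terms $\bm n$ is the outward unit normal of $D^k$. $\Gamma_h$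 is the set of unique faces of the mesh. Weight-adjusted operators. For a scalar or symmetric positive-definite matrix weight $\bm W$ (bounded with bounded inverse), $T^{-1}_{\bm W}$ maps $L^2(D^k)$ vector functions to $P^N(D^k)$ vector functions and is defined by $(\bm WT^{-1}_{\bm W}\bm u,\bm{\delta u})_{L^2(D^k)}=(\bm u,\bm{\delta u})_{L^2(D^k)}$ for all $\bm{\delta u}$ with components in $P^N(D^k)$; $T^{-1}_{1/\rho}$ is applied componentwise. Jumps. On a face $f$ of $D^k$, $u^-$ is the trace from $D^k$ and $u^+$ the trace from the neighbor; $[\![u]\!]=u^+-u^-$, and the average of $u$ is $\tfrac12(u^++u^-)$, componentwise for vectors. The boundary faces are partitioned into $\Gamma_v$ (velocity), $\Gamma_\sigma$ (traction) and $\Gamma_{\rm abc}$ (absorbing), and on them the jumps are defined by: on $\Gamma_v$, $[\![\bm v]\!]=-2\bm v^-$ and $\bm A_n^T[\![\bm\sigma]\!]=0$; on $\Gamma_\sigma$, $\bm A_n^T[\![\bm\sigma]\!]=-2\bm A_n^T\bm\sigma^-$ and $[\![\bm v]\!]=0$; on $\Gamma_{\rm abc}$, $\bm A_n^T[\![\bm\sigma]\!]=-\bm A_n^T\bm\sigma^-$ and $[\![\bm v]\!]=-\bm v^-$. *)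

theory Defs
  imports "HOL-Analysis.Analysis"
begin

subsection \<open>Domain and mesh\<close>

text \<open>Near each boundary point the domain is, in suitable orthonormal coordinates with last axis
  \<open>n\<close>, the strict epigraph of a Lipschitz function.\<close>

definition lipschitz_domain :: "'a::euclidean_space set \<Rightarrow> bool" where
  "lipschitz_domain \<Omega> \<longleftrightarrow>
     open \<Omega> \<and> connected \<Omega> \<and> bounded \<Omega> \<and> \<Omega> \<noteq> {} \<and>
     (\<forall>x\<in>frontier \<Omega>. \<exists>U n \<phi> L.
        open U \<and> x \<in> U \<and> norm n = 1 \<and> L-lipschitz_on {z. z \<bullet> n = 0} \<phi> \<and>
        \<Omega> \<inter> U = {y \<in> U. \<phi> (y - (y \<bullet> n) *\<^sub>R n) < y \<bullet> n})"

text \<open>The library's \<^const>\<open>triangulation\<close> is finite and conforming (two members meet in a common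
  face) but allows simplices of any dimension.\<close>

definition simplicial_mesh :: "'a::euclidean_space set \<Rightarrow> 'a set set \<Rightarrow> bool" where
  "simplicial_mesh \<Omega> M \<longleftrightarrow>
     triangulation M \<and> (\<forall>K\<in>M. int DIM('a) simplex K) \<and> \<Union>M = closure \<Omega>"

definition mesh_faces :: "'a::euclidean_space set set \<Rightarrow> 'a set set" where
  "mesh_faces M = {F. \<exists>K\<in>M. F facet_of K}"

definition boundary_faces :: "'a::euclidean_space set \<Rightarrow> 'a set set \<Rightarrow> 'a set set" where
  "boundary_faces \<Omega> M = {F \<in> mesh_faces M. F \<subseteq> frontier \<Omega>}"

definition interior_faces :: "'a::euclidean_space set \<Rightarrow> 'a set set \<Rightarrow> 'a set set" where
  "interior_faces \<Omega> M = mesh_faces M - boundary_faces \<Omega> M"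

definition outward_normal :: "'a::euclidean_space set \<Rightarrow> 'a set \<Rightarrow> 'a" where
  "outward_normal K F =
     (THE n. norm n = 1 \<and> (\<exists>c. F \<subseteq> {x. n \<bullet> x = c} \<and> K \<subseteq> {x. n \<bullet> x \<le> c}))"

text \<open>The element on the other side of an interior face \<open>F\<close> of \<open>K\<close>.\<close>

definition neighbor :: "'a::euclidean_space set set \<Rightarrow> 'a set \<Rightarrow> 'a set \<Rightarrow> 'a set" where
  "neighbor M K F = (THE K'. K' \<in> M \<and> K' \<noteq> K \<and> F facet_of K')"

text \<open>The side from which the minus trace and the normal are taken in integrals over a face. It is
  the only adjacent element of a boundary face; on an interior face switching sides changes the
  sign of the normal and of all jumps, so quadratic expressions do not depend on the choice.\<close>

definition minus_side :: "'a::euclidean_space set set \<Rightarrow> 'a set \<Rightarrow> 'a set" where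
  "minus_side M F = (SOME K. K \<in> M \<and> F facet_of K)"

definition face_normal :: "'a::euclidean_space set set \<Rightarrow> 'a set \<Rightarrow> 'a" where
  "face_normal M F = outward_normal (minus_side M F) F"


subsection \<open>Integrals\<close>

definition L2_inner :: "'a::euclidean_space set \<Rightarrow> ('a \<Rightarrow> 'b::euclidean_space) \<Rightarrow> ('a \<Rightarrow> 'b) \<Rightarrow> real" where
  "L2_inner K f g = (LINT x:K|lebesgue. f x \<bullet> g x)"

text \<open>For a unit vector \<open>n\<close>, the codimension-one Lebesgue measure on the hyperplane
  \<open>{x. n \<bullet> x = c}\<close>. By Fubini in orthonormal coordinates with last axis \<open>n\<close>, Lebesgue measure on the
  slab of thickness one over the hyperplane is the product of that measure with the Lebesgue
  measure on a unit interval, so its image under the orthogonal projection onto the hyperplane is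
  the surface measure.\<close>

definition hyperplane_measure :: "'a::euclidean_space \<Rightarrow> real \<Rightarrow> 'a measure" where
  "hyperplane_measure n c =
     distr (restrict_space lborel {x. c \<le> n \<bullet> x \<and> n \<bullet> x \<le> c + 1}) borel
       (\<lambda>x. x - (n \<bullet> x - c) *\<^sub>R n)"

text \<open>Normalization: a coordinate box has its usual codimension-one volume.\<close>

lemma hyperplane_measure_box:
  fixes b l u :: "'a::euclidean_space"
  assumes b: "b \<in> Basis" and le: "\<And>i. i \<in> Basis \<Longrightarrow> l \<bullet> i \<le> u \<bullet> i"
    and c: "l \<bullet> b = c" "u \<bullet> b = c"
  shows "emeasure (hyperplane_measure b c) (cbox l u) =
           ennreal (\<Prod>i\<in>Basis - {b}. (u - l) \<bullet> i)"
proof -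
  let ?S = "{x::'a. c \<le> b \<bullet> x \<and> b \<bullet> x \<le> c + 1}"
  let ?P = "\<lambda>x::'a. x - (b \<bullet> x - c) *\<^sub>R b"
  have S: "?S \<in> sets lborel"
    by (auto intro!: borel_closed closed_Collect_conj closed_Collect_le continuous_intros)
  have P: "?P \<in> measurable (restrict_space lborel ?S) borel"
    by (intro measurable_restrict_space1) (auto intro!: borel_measurable_continuous_onI continuous_intros)
  have inner_P: "?P x \<bullet> i = (if i = b then c else x \<bullet> i)" if "i \<in> Basis" for x i
    using that b by (auto simp: inner_diff_left inner_Basis inner_commute[of b x])
  have *: "?P -` cbox l u \<inter> ?S = cbox l (u + b)"
  proof (intro set_eqI iffI)
    fix x assume x: "x \<in> ?P -` cbox l u \<inter> ?S"
    show "x \<in> cbox l (u + b)"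
      unfolding mem_box
    proof
      fix i :: 'a assume i: "i \<in> Basis"
      show "l \<bullet> i \<le> x \<bullet> i \<and> x \<bullet> i \<le> (u + b) \<bullet> i"
        using x i b c inner_P[OF i, of x]
        by (cases "i = b") (auto simp: mem_box inner_add_left inner_Basis inner_commute[of b x])
    qed
  next
    fix x assume x: "x \<in> cbox l (u + b)"
    then have "x \<in> ?S"
      using b c by (auto simp: mem_box inner_add_left inner_commute[of b x] dest!: bspec[of _ _ b])
    moreover have "?P x \<in> cbox l u"
      unfolding mem_box
    proof
      fix i :: 'a assume i: "i \<in> Basis"
      show "l \<bullet> i \<le> ?P x \<bullet> i \<and> ?P x \<bullet> i \<le> u \<bullet> i"
        unfolding inner_P[OF i] using x i b c
        by (cases "i = b") (auto simp: mem_box inner_add_left inner_Basis inner_commute[of b x] dest!: bspec[of _ _ i])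
    qed
    ultimately show "x \<in> ?P -` cbox l u \<inter> ?S" by auto
  qed
  have "emeasure (hyperplane_measure b c) (cbox l u) = emeasure lborel (cbox l (u + b))"
  proof -
    have "emeasure (hyperplane_measure b c) (cbox l u) =
            emeasure (restrict_space lborel ?S) (cbox l (u + b))"
      unfolding hyperplane_measure_def
      by (subst emeasure_distr[OF P]) (simp_all add: * space_restrict_space)
    also have "\<dots> = emeasure lborel (cbox l (u + b))"
      using S * by (intro emeasure_restrict_space) auto
    finally show ?thesis .
  qed
  also have "\<dots> = ennreal (\<Prod>i\<in>Basis. (u + b - l) \<bullet> i)"
    using le b by (intro emeasure_lborel_cbox) (auto simp: inner_add_left inner_Basis add_increasing2)
  also have "(\<Prod>i\<in>Basis. (u + b - l) \<bullet> i) = (\<Prod>i\<in>Basis - {b}. (u - l) \<bullet> i)"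
    using b c by (subst prod.remove[OF _ b])
      (auto simp: inner_diff_left inner_add_left inner_Basis intro!: prod.cong split: if_splits)
  finally show ?thesis .
qed

definition facet_integral :: "'a::euclidean_space set \<Rightarrow> ('a \<Rightarrow> real) \<Rightarrow> real" where
  "facet_integral F g =
     (let (n, c) = (SOME (n, c). norm n = 1 \<and> affine hull F = {x. n \<bullet> x = c})
      in LINT x:F|hyperplane_measure n c. g x)"

text \<open>The first argument function also depends on the face, since normals, jumps and penalty
  parameters do.\<close>

definition boundary_inner ::
  "'a::euclidean_space set \<Rightarrow> ('a set \<Rightarrow> 'a \<Rightarrow> 'b::euclidean_space) \<Rightarrow> ('a \<Rightarrow> 'b) \<Rightarrow> real" where
  "boundary_inner K f w = (\<Sum>F | F facet_of K. facet_integral F (\<lambda>x. f F x \<bullet> w x))"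


subsection \<open>Polynomials, derivatives and weight-adjusted operators\<close>

text \<open>Polynomials of total degree at most \<open>N\<close>. Vector-valued coefficients give the vector fields all
  of whose components are such polynomials. Polynomials on an element are represented by the unique
  polynomial functions on the whole space that extend them; an element of the broken space is a
  family of such functions indexed by the elements of the mesh.\<close>

definition poly_space :: "nat \<Rightarrow> (real^'d \<Rightarrow> 'b::euclidean_space) set" where
  "poly_space N =
     {p. \<exists>c. \<forall>x. p x =
        (\<Sum>\<alpha> | sum \<alpha> UNIV \<le> N. (\<Prod>i\<in>UNIV. (x $ i) ^ (\<alpha> i :: nat)) *\<^sub>R c \<alpha>)}"

definition partial :: "'d \<Rightarrow> (real^'d \<Rightarrow> 'b::euclidean_space) \<Rightarrow> real^'d \<Rightarrow> 'b" where
  "partial i f x = frechet_derivative f (at x) (axis i 1)"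

definition time_deriv ::
  "real set \<Rightarrow> (real \<Rightarrow> 'k \<Rightarrow> 'a \<Rightarrow> 'b::real_normed_vector) \<Rightarrow> real \<Rightarrow> 'k \<Rightarrow> 'a \<Rightarrow> 'b" where
  "time_deriv I u t K x = vector_derivative (\<lambda>s. u s K x) (at t within I)"

text \<open>The operator \<open>T\<^sub>W\<^sup>-\<^sup>1\<close> on the element \<open>K\<close>. The weight enters through its pointwise action
  \<open>W x\<close>: multiplication by a scalar or by a matrix.\<close>

definition wadg_inv ::
  "nat \<Rightarrow> (real^'d) set \<Rightarrow> (real^'d \<Rightarrow> 'b \<Rightarrow> 'b) \<Rightarrow> (real^'d \<Rightarrow> 'b::euclidean_space) \<Rightarrow> real^'d \<Rightarrow> 'b" where
  "wadg_inv N K W u =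
     (THE p. p \<in> poly_space N \<and>
        (\<forall>q\<in>poly_space N. L2_inner K (\<lambda>x. W x (p x)) q = L2_inner K u q))"

definition wadg_inv_matrix ::
  "nat \<Rightarrow> (real^'d) set \<Rightarrow> (real^'d \<Rightarrow> real^'m^'m) \<Rightarrow> (real^'d \<Rightarrow> real^'m) \<Rightarrow> real^'d \<Rightarrow> real^'m" where
  "wadg_inv_matrix N K W u = wadg_inv N K (\<lambda>x y. W x *v y) u"

definition wadg_inv_scalar ::
  "nat \<Rightarrow> (real^'d) set \<Rightarrow> (real^'d \<Rightarrow> real) \<Rightarrow> (real^'d \<Rightarrow> real^'m) \<Rightarrow> real^'d \<Rightarrow> real^'m" where
  "wadg_inv_scalar N K w u x = (\<chi> i. wadg_inv N K (\<lambda>y r. w y * r) (\<lambda>y. u y $ i) x)"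


subsection \<open>The matrices of the elastic wave equation\<close>

definition voigt_rows :: "nat \<Rightarrow> (nat \<Rightarrow> real) \<Rightarrow> real list list" where
  "voigt_rows d n =
     (if d = 2 then
        [[n 0, 0  ],
         [0,   n 1],
         [n 1, n 0]]
      else
        [[n 0, 0,   0  ],
         [0,   n 1, 0  ],
         [0,   0,   n 2],
         [0,   n 2, n 1],
         [n 2, 0,   n 0],
         [n 1, n 0, 0  ]])"

text \<open>The matrix \<open>A\<^sub>n\<close>, where \<open>\<iota>\<close> and \<open>\<kappa>\<close> number, from zero, the space coordinates and the
  independent stress components. It is linear in \<open>n\<close>, so \<open>A\<^sub>i\<close> is its value at the
  \<open>i\<close>-th unit vector.\<close>

definition voigt_matrix :: "('d \<Rightarrow> nat) \<Rightarrow> ('m \<Rightarrow> nat) \<Rightarrow> real^'d \<Rightarrow> real^'d^'m" where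
  "voigt_matrix \<iota> \<kappa> n = (\<chi> a i. voigt_rows CARD('d) (\<lambda>k. n $ inv \<iota> k) ! \<kappa> a ! \<iota> i)"


subsection \<open>Jumps\<close>

definition jump ::
  "'a::euclidean_space set set \<Rightarrow> ('a set \<Rightarrow> 'a \<Rightarrow> 'b::real_vector) \<Rightarrow> 'a set \<Rightarrow> 'a set \<Rightarrow> 'a \<Rightarrow> 'b" where
  "jump M u K F x = u (neighbor M K F) x - u K x"

definition velocity_jump ::
  "(real^'d) set set \<Rightarrow> (real^'d) set set \<Rightarrow> (real^'d) set set \<Rightarrow> (real^'d) set set \<Rightarrow>
   ((real^'d) set \<Rightarrow> real^'d \<Rightarrow> real^'d) \<Rightarrow> (real^'d) set \<Rightarrow> (real^'d) set \<Rightarrow> real^'d \<Rightarrow> real^'d" where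
  "velocity_jump M \<Gamma>v \<Gamma>\<sigma> \<Gamma>abc v K F x =
     (if F \<in> \<Gamma>v then (- 2) *\<^sub>R v K x
      else if F \<in> \<Gamma>\<sigma> then 0
      else if F \<in> \<Gamma>abc then - v K x
      else jump M v K F x)"

text \<open>The quantity \<open>A\<^sub>n\<^sup>T [[\<sigma>]]\<close>; on boundary faces it is prescribed as a whole, \<open>[[\<sigma>]]\<close> itself is not.\<close>

definition traction_jump ::
  "(real^'d \<Rightarrow> real^'d^'m) \<Rightarrow>
   (real^'d) set set \<Rightarrow> (real^'d) set set \<Rightarrow> (real^'d) set set \<Rightarrow> (real^'d) set set \<Rightarrow>
   ((real^'d) set \<Rightarrow> real^'d \<Rightarrow> real^'m) \<Rightarrow> (real^'d) set \<Rightarrow> (real^'d) set \<Rightarrow> real^'d \<Rightarrow> real^'d" where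
  "traction_jump A M \<Gamma>v \<Gamma>\<sigma> \<Gamma>abc \<sigma> K F x =
     (let At = transpose (A (outward_normal K F)) in
      if F \<in> \<Gamma>v then 0
      else if F \<in> \<Gamma>\<sigma> then (- 2) *\<^sub>R (At *v \<sigma> K x)
      else if F \<in> \<Gamma>abc then - (At *v \<sigma> K x)
      else At *v jump M \<sigma> K F x)"

end

theory Submission
  imports Defs
begin

text \<open>Testing the velocity equation with \<open>v\<close> and the stress equation with \<open>\<sigma>\<close> gives half the time
  derivative of the energy on the left, since the weight-adjusted operators are symmetric. On the
  right, integration by parts turns the volume terms into face integrals of \<open>(A\<^sub>n v) \<bullet> \<sigma>\<close>. On an
  interior face the contributions of the two neighbours have opposite normals, so the central flux
  cancels them and only the penalty terms survive; on a boundary face the prescribed jumps have the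
  same effect. The estimate is in fact an equality.

  The divergence theorem on a polytope \<open>K\<close> comes from differentiating the integral of \<open>f\<close> over \<open>K + h e\<close>
  at \<open>h = 0\<close>: the indicator of \<open>K\<close> is the product of the indicators of its facet half-spaces, and the
  telescoped difference localizes on slabs of thickness \<open>h (n \<bullet> e)\<close> over the facets. That an
  interior face has exactly two neighbours and a boundary face only one uses the Lipschitz property in
  the form that \<open>\<Omega>\<close> is the interior of its closure.\<close>


subsection \<open>Lebesgue measure under orthogonal and stretching maps\<close>

text \<open>Facets have arbitrary normals, while \<open>hyperplane_measure\<close> is a projected
  slab of Lebesgue measure, so integrals over a facet are reached by stretching a slab along its
  normal; this is what rotation invariance of Lebesgue measure is for. Stretching a slab of
  thickness h (n \<bullet> e) to thickness one produces a Jacobian, which becomes the factor n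
  \<bullet> e of the divergence theorem. Two further obstacles shape the proof. The operator
  \<open>wadg_inv\<close> is a definite description, so existence, linearity and symmetry must be
  derived from a positive definite Gram matrix of polynomials. The coefficients are controlled only
  on the open domain, whereas elements are closed and may touch its boundary; pointwise properties
  of the weights are therefore available only almost everywhere on an element.\<close>

lemma distr_lborel_reflect:
  fixes x :: "'a::euclidean_space"
  shows "distr lborel borel (\<lambda>y. x - y) = lborel"
  using lborel_affine[of "-1" x] by (simp add: density_1)

text \<open>Uniqueness of Haar measure. Both sides are the double integral of 1_E(x) 1_F(x + y), by
  Fubini: integrating over y at once gives the left side; shifting x by the invariance of
  \<open>\<mu>\<close> and then integrating over y with a reflection gives the right side. The
  cross-multiplied form covers sets of zero or infinite measure as well.\<close>

lemma translation_invariant_measure_proportional: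
  fixes \<mu> :: "'a::euclidean_space measure"
  assumes sets: "sets \<mu> = sets borel" and sf: "sigma_finite_measure \<mu>"
    and inv: "\<And>c. distr \<mu> borel ((+) c) = \<mu>"
    and E[measurable]: "E \<in> sets borel" and F[measurable]: "F \<in> sets borel"
  shows "emeasure \<mu> E * emeasure lborel F = emeasure \<mu> F * emeasure lborel E"
proof -
  have [measurable_cong]: "sets \<mu> = sets borel" by (fact sets)
  interpret sf: sigma_finite_measure \<mu> by (fact sf)
  interpret pair_sigma_finite \<mu> lborel ..
  have ind: "(\<integral>\<^sup>+y. indicator F (x + y) \<partial>lborel) = emeasure lborel F" for x :: 'a
  proof -
    have "emeasure lborel F = (\<integral>\<^sup>+y. indicator F y \<partial>distr lborel borel ((+) x))"
      by (simp add: lborel_distr_plus)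
    also have "\<dots> = (\<integral>\<^sup>+y. indicator F (x + y) \<partial>lborel)"
      by (subst nn_integral_distr) auto
    finally show ?thesis by simp
  qed
  have refl: "(\<integral>\<^sup>+y. indicator E (x - y) \<partial>lborel) = emeasure lborel E" for x :: 'a
  proof -
    have "emeasure lborel E = (\<integral>\<^sup>+y. indicator E y \<partial>distr lborel borel (\<lambda>y. x - y))"
      by (simp add: distr_lborel_reflect)
    also have "\<dots> = (\<integral>\<^sup>+y. indicator E (x - y) \<partial>lborel)"
      by (subst nn_integral_distr) auto
    finally show ?thesis by simp
  qed
  have shift: "(\<integral>\<^sup>+x. indicator E x * indicator F (x + y) \<partial>\<mu>) = (\<integral>\<^sup>+x. indicator E (x - y) * indicator F x \<partial>\<mu>)" for y
  proof -
    have "(\<integral>\<^sup>+x. indicator E (x - y) * indicator F x \<partial>\<mu>) = (\<integral>\<^sup>+x. indicator E (x - y) * indicator F x \<partial>distr \<mu> borel ((+) y))"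
      by (simp add: inv)
    also have "\<dots> = (\<integral>\<^sup>+x. indicator E x * indicator F (x + y) \<partial>\<mu>)"
      by (subst nn_integral_distr) (auto simp: add.commute)
    finally show ?thesis by simp
  qed
  have "emeasure \<mu> E * emeasure lborel F = (\<integral>\<^sup>+x. indicator E x * emeasure lborel F \<partial>\<mu>)"
    by (subst nn_integral_multc) (simp_all add: sets)
  also have "\<dots> = (\<integral>\<^sup>+x. (\<integral>\<^sup>+y. indicator E x * indicator F (x + y) \<partial>lborel) \<partial>\<mu>)"
    by (subst nn_integral_cmult) (simp_all add: ind)
  also have "\<dots> = (\<integral>\<^sup>+y. (\<integral>\<^sup>+x. indicator E x * indicator F (x + y) \<partial>\<mu>) \<partial>lborel)"
    by (subst Fubini') simp_all
  also have "\<dots> = (\<integral>\<^sup>+y. (\<integral>\<^sup>+x. indicator F x * indicator E (x - y) \<partial>\<mu>) \<partial>lborel)"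
    by (simp add: shift mult.commute)
  also have "\<dots> = (\<integral>\<^sup>+x. (\<integral>\<^sup>+y. indicator F x * indicator E (x - y) \<partial>lborel) \<partial>\<mu>)"
    by (subst Fubini') simp_all
  also have "\<dots> = (\<integral>\<^sup>+x. indicator F x * emeasure lborel E \<partial>\<mu>)"
    by (subst nn_integral_cmult) (simp_all add: refl)
  also have "\<dots> = emeasure \<mu> F * emeasure lborel E"
    by (subst nn_integral_multc) (simp_all add: sets)
  finally show ?thesis .
qed

text \<open>Since f is linear and onto, a translation after f is a translation by a preimage before
  f, so the image measure is translation invariant and hence proportional to Lebesgue measure. The
  unit ball is its own preimage, which makes the factor 1.\<close>

lemma distr_lborel_orthogonal:
  fixes f :: "'a::euclidean_space \<Rightarrow> 'a"
  assumes f: "orthogonal_transformation f"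
  shows "distr lborel borel f = lborel"
proof (rule measure_eqI)
  have lin: "linear f" using f by (rule orthogonal_transformation_linear)
  then have cont: "continuous_on UNIV f"
    by (simp add: linear_continuous_on linear_conv_bounded_linear)
  then have [measurable]: "f \<in> borel \<rightarrow>\<^sub>M borel" by (rule borel_measurable_continuous_onI)
  fix E :: "'a set" assume "E \<in> sets (distr lborel borel f)"
  then have E[measurable]: "E \<in> sets borel" by simp
  let ?B = "ball (0::'a) 1"
  have vimB: "f -` ?B = ?B"
    using orthogonal_transformation_norm[OF f] by auto
  have bij: "bij f" using f by (rule orthogonal_transformation_bij)
  \<comment> \<open>Balls centred at 0 are their own preimages under f and exhaust the space with
    finite measure.\<close>
  have "sigma_finite_measure (distr lborel borel f)"
  proof
    show "\<exists>A. countable A \<and> A \<subseteq> sets (distr lborel borel f) \<and> \<Union> A = space (distr lborel borel f) \<and> (\<forall>a\<in>A. emeasure (distr lborel borel f) a \<noteq> \<infinity>)"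
    proof (intro exI[of _ "range (\<lambda>n::nat. ball (0::'a) (real n))"] conjI ballI)
      show "\<Union> (range (\<lambda>n. ball 0 (real n))) = space (distr lborel borel f)"
        using reals_Archimedean2 by auto
      fix a assume "a \<in> range (\<lambda>n::nat. ball (0::'a) (real n))"
      then obtain n where a: "a = ball 0 (real n)" by blast
      have "f -` a = a" unfolding a using orthogonal_transformation_norm[OF f] by auto
      moreover have "emeasure lborel (f -` a) = emeasure (distr lborel borel f) a"
        by (subst emeasure_distr) (auto simp: a)
      moreover have "emeasure lborel a < \<infinity>"
        unfolding a by (intro emeasure_bounded_finite) auto
      ultimately show "emeasure (distr lborel borel f) a \<noteq> \<infinity>" by auto
    qed auto
  qed
  moreover have "distr (distr lborel borel f) borel ((+) c) = distr lborel borel f" for c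
  proof -
    obtain d where d: "f d = c" using bij by (metis bij_pointE)
    have "distr (distr lborel borel f) borel ((+) c) = distr (distr lborel borel ((+) d)) borel f"
      by (subst (1 2) distr_distr) (auto simp: o_def linear_add[OF lin] d)
    then show ?thesis by (simp add: lborel_distr_plus)
  qed
  ultimately have "emeasure (distr lborel borel f) E * emeasure lborel ?B
      = emeasure (distr lborel borel f) ?B * emeasure lborel E"
    by (intro translation_invariant_measure_proportional) auto
  also have "emeasure (distr lborel borel f) ?B = emeasure lborel ?B"
    by (subst emeasure_distr) (simp_all add: vimB)
  finally have "emeasure lborel ?B * emeasure (distr lborel borel f) E = emeasure lborel ?B * emeasure lborel E"
    by (simp add: mult.commute)
  moreover have "emeasure lborel ?B < \<infinity>" by (intro emeasure_bounded_finite) auto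
  moreover have "emeasure lborel ?B \<noteq> 0"
    using open_not_negligible[of ?B]
    by (auto simp: negligible_iff_emeasure0 )
  ultimately show "emeasure (distr lborel borel f) E = emeasure lborel E"
    by (auto simp: ennreal_mult_cancel_left)
qed simp

text \<open>The map scales by s along n and fixes the hyperplane n \<bullet> y = c. An orthogonal
  map taking a coordinate axis to n conjugates it to a diagonal affine map, whose Jacobian is
  s.\<close>

lemma lborel_integral_stretch:
  fixes n :: "real^'d" and g :: "real^'d \<Rightarrow> real"
  assumes n: "norm n = 1" and s: "s \<noteq> 0" and g[measurable]: "g \<in> borel_measurable borel"
  shows "(LINT x|lborel. g x) = \<bar>s\<bar> * (LINT y|lborel. g (y - (n \<bullet> y - c) *\<^sub>R n + (s * (n \<bullet> y - c)) *\<^sub>R n))"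
proof -
  obtain k :: 'd where True by blast
  define b where "b = (axis k 1 :: real^'d)"
  have b: "b \<in> Basis" "norm b = 1" by (auto simp: b_def axis_in_Basis_iff)
  obtain f where f: "orthogonal_transformation f" "f b = n"
    using orthogonal_transformation_exists_1[of b n] b n by metis
  have lin: "linear f" using f(1) by (rule orthogonal_transformation_linear)
  then have [measurable]: "f \<in> borel \<rightarrow>\<^sub>M borel"
    by (intro borel_measurable_continuous_onI) (simp add: linear_continuous_on linear_conv_bounded_linear)
  define a where "a = (\<lambda>j. if j = b then s else (1::real))"
  \<comment> \<open>This shift makes the hyperplane b \<bullet> x = c, instead of the one through 0,
    fixed under scaling by s.\<close>
  define t where "t = ((1 - s) * c) *\<^sub>R b"
  define T where "T x = t + (\<Sum>j\<in>Basis. (a j * (x \<bullet> j)) *\<^sub>R j)" for x :: "real^'d"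
  have T: "T x = x - (b \<bullet> x - c) *\<^sub>R b + (s * (b \<bullet> x - c)) *\<^sub>R b" for x
  proof -
    have "(\<Sum>j\<in>Basis. (a j * (x \<bullet> j)) *\<^sub>R j) = (s * (x \<bullet> b)) *\<^sub>R b + (\<Sum>j\<in>Basis - {b}. (x \<bullet> j) *\<^sub>R j)"
      by (subst sum.remove[OF _ b(1)]) (auto simp: a_def intro!: sum.cong)
    also have "(\<Sum>j\<in>Basis - {b}. (x \<bullet> j) *\<^sub>R j) = x - (x \<bullet> b) *\<^sub>R b"
      using euclidean_representation[of x] by (subst (asm) sum.remove[OF _ b(1)]) (auto simp: algebra_simps)
    finally show ?thesis by (simp add: T_def t_def algebra_simps inner_commute)
  qed
  have [measurable]: "T \<in> borel \<rightarrow>\<^sub>M borel" by (simp add: T_def[abs_def])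
  have prod_a: "(\<Prod>j\<in>Basis. \<bar>a j\<bar>) = \<bar>s\<bar>"
    by (subst prod.remove[OF _ b(1)]) (auto simp: a_def)
  have L: "lborel = density (distr lborel borel T) (\<lambda>_. ennreal \<bar>s\<bar>)"
    using lborel_affine_euclidean[of a t] s prod_a by (simp add: T_def[abs_def] a_def)
  have fT: "f (T y) = f y - (n \<bullet> f y - c) *\<^sub>R n + (s * (n \<bullet> f y - c)) *\<^sub>R n" for y
  proof -
    have "n \<bullet> f y = b \<bullet> y" using f by (metis orthogonal_transformation_def)
    then show ?thesis by (simp add: T linear_add[OF lin] linear_diff[OF lin] linear_cmul[OF lin] f(2))
  qed
  have "(LINT x|lborel. g x) = (LINT x|distr lborel borel f. g x)"
    by (simp add: distr_lborel_orthogonal[OF f(1)])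
  also have "\<dots> = (LINT x|lborel. g (f x))"
    by (subst integral_distr) auto
  also have "\<dots> = (LINT x|density (distr lborel borel T) (\<lambda>_. ennreal \<bar>s\<bar>). g (f x))"
    using L by simp
  also have "\<dots> = \<bar>s\<bar> * (LINT x|lborel. g (f (T x)))"
    by (subst integral_density) (auto simp: integral_distr)
  also have "(LINT x|lborel. g (f (T x))) =
      (LINT x|lborel. g (f x - (n \<bullet> f x - c) *\<^sub>R n + (s * (n \<bullet> f x - c)) *\<^sub>R n))"
    by (simp add: fT)
  also have "\<dots> = (LINT y|distr lborel borel f. g (y - (n \<bullet> y - c) *\<^sub>R n + (s * (n \<bullet> y - c)) *\<^sub>R n))"
    by (subst integral_distr) auto
  also have "\<dots> = (LINT y|lborel. g (y - (n \<bullet> y - c) *\<^sub>R n + (s * (n \<bullet> y - c)) *\<^sub>R n))"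
    by (simp add: distr_lborel_orthogonal[OF f(1)])
  finally show ?thesis .
qed


subsection \<open>Integrals over hyperplanes\<close>

text \<open>The case n = 0, c \<noteq> 0, where the set is empty, is included because parallel
  facets lead to it when the equation of one is pulled back to the hyperplane of the other.\<close>

lemma AE_lborel_not_in_hyperplane:
  fixes n :: "'a::euclidean_space"
  assumes "n \<noteq> 0 \<or> c \<noteq> 0"
  shows "AE y in lborel. n \<bullet> y \<noteq> c"
proof -
  have "{y. n \<bullet> y = c} \<in> sets borel" by (intro borel_closed closed_hyperplane)
  moreover have "negligible {y. n \<bullet> y = c}" by (rule negligible_hyperplane[OF assms])
  ultimately have "{y. n \<bullet> y = c} \<in> null_sets lborel"
    by (simp add: negligible_iff_null_sets null_sets_completion_iff)
  then have "AE y in lborel. y \<notin> {y. n \<bullet> y = c}" by (rule AE_not_in)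
  then show ?thesis by simp
qed

lemma sets_hyperplane_measure[measurable_cong, simp]: "sets (hyperplane_measure n c) = sets borel"
  by (simp add: hyperplane_measure_def)

lemma space_hyperplane_measure[simp]: "space (hyperplane_measure n c) = UNIV"
  by (simp add: hyperplane_measure_def)

lemma hyperplane_projection_measurable:
  "(\<lambda>x. x - (n \<bullet> x - c) *\<^sub>R n) \<in> restrict_space lborel {x. c \<le> n \<bullet> x \<and> n \<bullet> x \<le> c + 1} \<rightarrow>\<^sub>M borel"
  by (intro measurable_restrict_space1) simp

lemma integral_hyperplane_measure:
  fixes g :: "'a::euclidean_space \<Rightarrow> real"
  assumes [measurable]: "g \<in> borel_measurable borel"
  shows "(LINT x|hyperplane_measure n c. g x) =
    (LINT x|lborel. indicator {x. c \<le> n \<bullet> x \<and> n \<bullet> x \<le> c + 1} x * g (x - (n \<bullet> x - c) *\<^sub>R n))"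
  unfolding hyperplane_measure_def
  by (subst integral_distr[OF hyperplane_projection_measurable])
     (auto simp: integral_restrict_space)

lemma integrable_hyperplane_measure:
  fixes g :: "'a::euclidean_space \<Rightarrow> real"
  assumes [measurable]: "g \<in> borel_measurable borel"
  shows "integrable (hyperplane_measure n c) g \<longleftrightarrow>
    integrable lborel (\<lambda>x. indicator {x. c \<le> n \<bullet> x \<and> n \<bullet> x \<le> c + 1} x * g (x - (n \<bullet> x - c) *\<^sub>R n))"
  unfolding hyperplane_measure_def
  by (subst integrable_distr_eq[OF hyperplane_projection_measurable])
     (auto simp: integrable_restrict_space)

lemma AE_hyperplane_measure:
  assumes "{x. P x} \<in> sets borel"
    and "AE x in lborel. P (x - (n \<bullet> x - c) *\<^sub>R n)"
  shows "AE x in hyperplane_measure n c. P x"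
  unfolding hyperplane_measure_def using assms
  by (subst AE_distr_iff[OF hyperplane_projection_measurable])
     (auto simp: AE_restrict_space_iff)

text \<open>Negating n and c keeps the hyperplane but takes the unit slab on its other side.
  Translation by n carries one slab onto the other without changing the projection. Surface
  integrals thus do not depend on the orientation of the normal.\<close>

lemma hyperplane_measure_uminus:
  fixes n :: "'a::euclidean_space"
  assumes n: "norm n = 1"
  shows "hyperplane_measure (- n) (- c) = hyperplane_measure n c"
proof (rule measure_eqI)
  fix E assume "E \<in> sets (hyperplane_measure (- n) (- c))"
  then have [measurable]: "E \<in> sets borel" by simp
  have nn: "n \<bullet> n = 1" using n by (simp add: norm_eq_1)
  have em: "emeasure (hyperplane_measure m b) E =
      (\<integral>\<^sup>+x. indicator {x. b \<le> m \<bullet> x \<and> m \<bullet> x \<le> b + 1} x * indicator E (x - (m \<bullet> x - b) *\<^sub>R m) \<partial>lborel)" for m :: 'a and b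
  proof -
    have "emeasure (hyperplane_measure m b) E = (\<integral>\<^sup>+x. indicator E x \<partial>hyperplane_measure m b)"
      by simp
    also have "\<dots> = (\<integral>\<^sup>+x. indicator {x. b \<le> m \<bullet> x \<and> m \<bullet> x \<le> b + 1} x * indicator E (x - (m \<bullet> x - b) *\<^sub>R m) \<partial>lborel)"
      unfolding hyperplane_measure_def
      by (subst nn_integral_distr[OF hyperplane_projection_measurable])
         (auto simp: nn_integral_restrict_space mult.commute)
    finally show ?thesis .
  qed
  have "emeasure (hyperplane_measure n c) E = (\<integral>\<^sup>+x. indicator {x. c \<le> n \<bullet> x \<and> n \<bullet> x \<le> c + 1} x * indicator E (x - (n \<bullet> x - c) *\<^sub>R n) \<partial>distr lborel borel ((+) n))"
    unfolding em by (simp add: lborel_distr_plus)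
  also have "\<dots> = (\<integral>\<^sup>+x. indicator {x. c \<le> n \<bullet> x \<and> n \<bullet> x \<le> c + 1} (n + x) * indicator E ((n + x) - (n \<bullet> (n + x) - c) *\<^sub>R n) \<partial>lborel)"
    by (subst nn_integral_distr) auto
  also have "\<dots> = emeasure (hyperplane_measure (- n) (- c)) E"
    unfolding em
    by (intro nn_integral_cong) (auto simp: nn inner_add_right algebra_simps indicator_def)
  finally show "emeasure (hyperplane_measure (- n) (- c)) E = emeasure (hyperplane_measure n c) E" by simp
qed simp

text \<open>The difference of indicators lives on the slab between a hyperplane and its translate,
  of signed thickness \<open>h k * (n \<bullet> e)\<close>. Stretching by that number maps the unit
  slab of \<open>hyperplane_measure\<close> onto it; the Jacobian divided by \<open>h k\<close>,
  with the sign of the difference, leaves n \<bullet> e, and dominated convergence does the rest.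
  The integrand may vary with k because the telescoped products contain translated factors.\<close>

lemma slab_limit:
  fixes n e :: "real^'d" and h :: "nat \<Rightarrow> real" and u :: "nat \<Rightarrow> real^'d \<Rightarrow> real" and g :: "real^'d \<Rightarrow> real"
  assumes n: "norm n = 1" and h: "\<And>k. 0 < h k" "\<And>k. h k \<le> 1"
    and u[measurable]: "\<And>k. u k \<in> borel_measurable borel" and g[measurable]: "g \<in> borel_measurable borel"
    and bd: "\<And>k x. \<bar>u k x\<bar> \<le> B" and supp: "\<And>k x. R \<le> norm x \<Longrightarrow> u k x = 0"
    and lim: "AE y in lborel. (\<lambda>k. u k (y - (n \<bullet> y - c) *\<^sub>R n + (h k * (n \<bullet> e) * (n \<bullet> y - c)) *\<^sub>R n))
      \<longlonglongrightarrow> g (y - (n \<bullet> y - c) *\<^sub>R n)"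
  shows "(\<lambda>k. (1 / h k) * (LINT x|lborel. u k x *
       (indicator {x. n \<bullet> (x - h k *\<^sub>R e) \<le> c} x - indicator {x. n \<bullet> x \<le> c} x)))
    \<longlonglongrightarrow> (n \<bullet> e) * (LINT x|hyperplane_measure n c. g x)"
proof (cases "n \<bullet> e = 0")
  case True
  then show ?thesis by (simp add: inner_diff_right indicator_def)
next
  case False
  define a where "a = n \<bullet> e"
  have nn: "n \<bullet> n = 1" using n by (simp add: norm_eq_1)
  have n0: "n \<noteq> 0" using n by auto
  let ?S = "{x. c \<le> n \<bullet> x \<and> n \<bullet> x \<le> c + 1}"
  define T where "T k y = y - (n \<bullet> y - c) *\<^sub>R n + (h k * a * (n \<bullet> y - c)) *\<^sub>R n" for k y
  have [measurable]: "T k \<in> borel \<rightarrow>\<^sub>M borel" for k unfolding T_def[abs_def] by simp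
  define D where "D k x = (indicator {x. n \<bullet> (x - h k *\<^sub>R e) \<le> c} x - indicator {x. n \<bullet> x \<le> c} x :: real)" for k x
  have [measurable]: "D k \<in> borel_measurable borel" for k unfolding D_def[abs_def] by measurable
  have a0: "a \<noteq> 0" using False by (simp add: a_def)
  have eq: "(1 / h k) * (LINT x|lborel. u k x * D k x) = a * (LINT y|lborel. indicator ?S y * u k (T k y))" for k
  proof -
    have s0: "h k * a \<noteq> 0" using h(1)[of k] a0 by auto
    have nT: "n \<bullet> T k y = c + h k * a * (n \<bullet> y - c)" for y
      unfolding T_def by (simp add: inner_add_right inner_diff_right nn)
    have "(LINT x|lborel. u k x * D k x) = \<bar>h k * a\<bar> * (LINT y|lborel. u k (T k y) * D k (T k y))"
      using lborel_integral_stretch[OF n s0, of "\<lambda>x. u k x * D k x" c] unfolding T_def by simp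
    also have "(LINT y|lborel. u k (T k y) * D k (T k y)) = (LINT y|lborel. sgn a * (indicator ?S y * u k (T k y)))"
    proof (rule integral_cong_AE)
      \<comment> \<open>The half-spaces are closed: for a > 0 their difference misses the face n
        \<bullet> y = c of the closed slab, for a < 0 the face n \<bullet> y = c + 1.\<close>
      have "AE y in lborel. n \<bullet> y \<noteq> c" "AE y in lborel. n \<bullet> y \<noteq> c + 1"
        using n0 by (auto intro!: AE_lborel_not_in_hyperplane)
      then show "AE y in lborel. u k (T k y) * D k (T k y) = sgn a * (indicator ?S y * u k (T k y))"
      proof eventually_elim
        case (elim y)
        let ?t = "n \<bullet> y - c"
        have D: "D k (T k y) = of_bool (h k * a * ?t \<le> h k * a) - of_bool (h k * a * ?t \<le> 0)"
          unfolding D_def indicator_def mem_Collect_eq inner_diff_right nT inner_scaleR_right a_def[symmetric]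
          by (auto simp: of_bool_def)
        have "D k (T k y) = sgn a * indicator ?S y"
        proof (cases "a > 0")
          case True
          then have "h k * a > 0" using h(1)[of k] by simp
          then have "h k * a * ?t \<le> h k * a \<longleftrightarrow> ?t \<le> 1" "h k * a * ?t \<le> 0 \<longleftrightarrow> ?t \<le> 0"
            using mult_le_cancel_left_pos[of "h k * a" ?t 1] mult_le_cancel_left_pos[of "h k * a" ?t 0] by auto
          then show ?thesis using elim True unfolding D by (auto simp: indicator_def)
        next
          case False
          then have a: "a < 0" using a0 by simp
          then have "h k * a < 0" using h(1)[of k] by (simp add: mult_pos_neg)
          then have "h k * a * ?t \<le> h k * a \<longleftrightarrow> ?t \<ge> 1" "h k * a * ?t \<le> 0 \<longleftrightarrow> ?t \<ge> 0"
            using mult_le_cancel_left_neg[of "h k * a" ?t 1] mult_le_cancel_left_neg[of "h k * a" ?t 0] by auto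
          then show ?thesis using elim a unfolding D by (auto simp: indicator_def)
        qed
        then show ?case by simp
      qed
    qed simp_all
    also have "\<dots> = sgn a * (LINT y|lborel. indicator ?S y * u k (T k y))"
      by simp
    finally have "(LINT x|lborel. u k x * D k x) = (\<bar>h k * a\<bar> * sgn a) * (LINT y|lborel. indicator ?S y * u k (T k y))"
      by (simp only: mult.assoc)
    also have "\<bar>h k * a\<bar> * sgn a = h k * a"
      using h(1)[of k] by (cases "a > 0") (auto simp: abs_mult sgn_if)
    finally show ?thesis using h(1)[of k] by simp
  qed
  have "(\<lambda>k. LINT y|lborel. indicator ?S y * u k (T k y)) \<longlonglongrightarrow>
      (LINT y|lborel. indicator ?S y * g (y - (n \<bullet> y - c) *\<^sub>R n))"
  proof (rule integral_dominated_convergence[where w = "\<lambda>y. B * indicator (cball 0 (R + 1 + \<bar>a\<bar>)) y"])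
    show "integrable lborel (\<lambda>y. B * indicator (cball 0 (R + 1 + \<bar>a\<bar>)) y)"
      by (intro integrable_mult_right integrable_real_indicator emeasure_bounded_finite) auto
    show "AE y in lborel. (\<lambda>k. indicator ?S y * u k (T k y)) \<longlonglongrightarrow> indicator ?S y * g (y - (n \<bullet> y - c) *\<^sub>R n)"
      using lim unfolding T_def a_def by eventually_elim (intro tendsto_mult tendsto_const)
    fix k
    \<comment> \<open>On the unit slab, y and \<open>T k y\<close> differ by (n \<bullet> y - c) (1
      - h k a) along n, at most 1 + \<bar>a\<bar> since h k \<le> 1; hence the radius R + 1 +
      \<bar>a\<bar> of the dominating ball.\<close>
    have "\<bar>indicator ?S y * u k (T k y)\<bar> \<le> B * indicator (cball 0 (R + 1 + \<bar>a\<bar>)) y" for y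
    proof (cases "y \<in> ?S \<and> norm (T k y) < R")
      case True
      have "y = T k y + ((n \<bullet> y - c) * (1 - h k * a)) *\<^sub>R n"
        by (simp add: T_def algebra_simps)
      then have "norm y - norm (T k y) \<le> \<bar>(n \<bullet> y - c) * (1 - h k * a)\<bar>"
        using norm_triangle_ineq[of "T k y" "((n \<bullet> y - c) * (1 - h k * a)) *\<^sub>R n"] n by simp
      also have "\<bar>(n \<bullet> y - c) * (1 - h k * a)\<bar> \<le> 1 * (1 + \<bar>a\<bar>)"
        unfolding abs_mult
      proof (rule mult_mono)
        have "\<bar>h k * a\<bar> \<le> 1 * \<bar>a\<bar>" unfolding abs_mult using h[of k] by (intro mult_right_mono) auto
        then show "\<bar>1 - h k * a\<bar> \<le> 1 + \<bar>a\<bar>" by linarith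
      qed (use True in auto)
      finally have "norm y - norm (T k y) \<le> 1 + \<bar>a\<bar>" by simp
      then have "norm y \<le> R + 1 + \<bar>a\<bar>" using conjunct2[OF True] by argo
      then show ?thesis using bd[of k "T k y"] by (auto simp: indicator_def)
    next
      case False
      moreover have "0 \<le> B" using bd[of 0 0] by linarith
      ultimately show ?thesis using supp[of "T k y" k] by (auto simp: indicator_def not_less)
    qed
    then show "AE y in lborel. norm (indicator ?S y * u k (T k y)) \<le> B * indicator (cball 0 (R + 1 + \<bar>a\<bar>)) y"
      by simp
  qed simp_all
  then have "(\<lambda>k. a * (LINT y|lborel. indicator ?S y * u k (T k y))) \<longlonglongrightarrow>
      a * (LINT y|lborel. indicator ?S y * g (y - (n \<bullet> y - c) *\<^sub>R n))"
    by (intro tendsto_intros)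
  then have "(\<lambda>k. (1 / h k) * (LINT x|lborel. u k x * D k x)) \<longlonglongrightarrow>
      a * (LINT x|hyperplane_measure n c. g x)"
    unfolding eq integral_hyperplane_measure[OF g] .
  then show ?thesis unfolding D_def a_def .
qed


subsection \<open>Facets and the divergence theorem\<close>

text \<open>With w the part of n' orthogonal to n, both c n and c n + w lie on the smaller plane, so
  n' \<bullet> w = 0. This says (n' \<bullet> n)^2 = 1, the equality case of Cauchy-Schwarz.\<close>

lemma unit_normal_unique:
  fixes n n' :: "'a::euclidean_space"
  assumes n: "norm n = 1" "norm n' = 1" and sub: "{x. n \<bullet> x = c} \<subseteq> {x. n' \<bullet> x = c'}"
  shows "n' = n \<and> c' = c \<or> n' = - n \<and> c' = - c"
proof -
  have nn: "n \<bullet> n = 1" "n' \<bullet> n' = 1" using n by (simp_all add: norm_eq_1)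
  define r where "r = n' \<bullet> n"
  define w where "w = n' - r *\<^sub>R n"
  have "c *\<^sub>R n \<in> {x. n \<bullet> x = c}" by (simp add: nn)
  then have p: "n' \<bullet> (c *\<^sub>R n) = c'" using sub by blast
  have "n \<bullet> (c *\<^sub>R n + w) = c" by (simp add: w_def r_def inner_add_right inner_diff_right nn inner_commute)
  then have "n' \<bullet> (c *\<^sub>R n + w) = c'" using sub by blast
  then have "n' \<bullet> w = 0" using p by (simp add: inner_add_right)
  then have r2: "r * r = 1" by (simp add: w_def inner_diff_right nn r_def)
  have "w \<bullet> w = 1 - r * r" unfolding w_def
    by (simp add: inner_diff_right inner_diff_left nn r_def inner_commute)
  then have "n' = r *\<^sub>R n" using r2 by (simp add: w_def)
  moreover have "r = 1 \<or> r = -1" using r2 by (simp add: square_eq_1_iff)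
  moreover have "c' = c * r" using p by (simp add: r_def)
  ultimately show ?thesis by auto
qed

lemma hyperplane_empty_interior_subset:
  fixes n :: "'a::euclidean_space"
  assumes "n \<noteq> 0" "interior K \<noteq> {}" shows "\<not> K \<subseteq> {x. n \<bullet> x = c}"
  using assms interior_mono[of K "{x. n \<bullet> x = c}"] by auto

text \<open>Shows that the description in \<open>outward_normal\<close> is well defined. A facet of
  a full-dimensional polyhedron spans a hyperplane, so a competing normal is n or -n; with -n the
  polyhedron would lie inside the hyperplane and have no interior.\<close>

lemma facet_outward_normal_obtain:
  fixes K :: "'a::euclidean_space set"
  assumes K: "polyhedron K" "interior K \<noteq> {}" and F: "F facet_of K"
  obtains c where "norm (outward_normal K F) = 1" "F = K \<inter> {x. outward_normal K F \<bullet> x = c}"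
    "K \<subseteq> {x. outward_normal K F \<bullet> x \<le> c}" "affine hull F = {x. outward_normal K F \<bullet> x = c}"
    "\<And>n' c'. norm n' = 1 \<Longrightarrow> F \<subseteq> {x. n' \<bullet> x = c'} \<Longrightarrow> K \<subseteq> {x. n' \<bullet> x \<le> c'} \<Longrightarrow> n' = outward_normal K F \<and> c' = c"
proof -
  obtain a b where a: "a \<noteq> 0" "K \<subseteq> {x. a \<bullet> x \<le> b}" "F = K \<inter> {x. a \<bullet> x = b}"
    using facet_of_polyhedron[OF K(1) F] by metis
  define n where "n = a /\<^sub>R norm a"
  define c where "c = b / norm a"
  have n: "norm n = 1" using a(1) by (simp add: n_def)
  have iff: "n \<bullet> x = c \<longleftrightarrow> a \<bullet> x = b" "n \<bullet> x \<le> c \<longleftrightarrow> a \<bullet> x \<le> b" for x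
    using a(1) by (auto simp: n_def c_def divide_simps)
  have Kle: "K \<subseteq> {x. n \<bullet> x \<le> c}" and Feq: "F = K \<inter> {x. n \<bullet> x = c}" using a iff by auto
  have n0: "n \<noteq> 0" using n by auto
  have dK: "aff_dim K = DIM('a)" using K(2) by (rule aff_dim_nonempty_interior)
  have aff: "affine hull F = {x. n \<bullet> x = c}"
  proof (rule affine_dim_equal)
    show "affine hull F \<subseteq> {x. n \<bullet> x = c}" by (rule hull_minimal) (auto simp: Feq affine_hyperplane)
    show "affine hull F \<noteq> {}" using F by (auto simp: facet_of_def)
    show "aff_dim (affine hull F) = aff_dim {x. n \<bullet> x = c}"
      using F dK n0 by (simp add: facet_of_def)
  qed (auto simp: affine_hyperplane)
  have uniq: "n' = n \<and> c' = c" if "norm n' = 1" "F \<subseteq> {x. n' \<bullet> x = c'}" "K \<subseteq> {x. n' \<bullet> x \<le> c'}" for n' c'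
  proof -
    have "affine hull F \<subseteq> {x. n' \<bullet> x = c'}" using that(2) by (intro hull_minimal) (auto simp: affine_hyperplane)
    then have "n' = n \<and> c' = c \<or> n' = - n \<and> c' = - c"
      unfolding aff by (rule unit_normal_unique[OF n that(1)])
    moreover have False if "n' = - n" "c' = - c"
    proof -
      have "K \<subseteq> {x. n \<bullet> x = c}" using Kle \<open>K \<subseteq> {x. n' \<bullet> x \<le> c'}\<close> that by fastforce
      then show False using hyperplane_empty_interior_subset[OF n0 K(2)] by blast
    qed
    ultimately show ?thesis by blast
  qed
  have on: "outward_normal K F = n"
    unfolding outward_normal_def
  proof (rule the_equality)
    show "norm n = 1 \<and> (\<exists>c. F \<subseteq> {x. n \<bullet> x = c} \<and> K \<subseteq> {x. n \<bullet> x \<le> c})"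
      using n Feq Kle by blast
  qed (use uniq in blast)
  show ?thesis by (rule that[of c]; unfold on; fact n Feq Kle aff uniq)
qed

text \<open>In an irredundant half-space representation every half-space cuts out a facet, and by
  uniqueness its normalized data are the outward normal and offset of that facet. So the facet
  inequalities alone already describe K.\<close>

lemma full_dim_polytope_halfspaces:
  fixes K :: "'a::euclidean_space set"
  assumes K: "polyhedron K" "interior K \<noteq> {}"
  obtains c where "\<And>F. F facet_of K \<Longrightarrow> norm (outward_normal K F) = 1"
    "\<And>F. F facet_of K \<Longrightarrow> F = K \<inter> {x. outward_normal K F \<bullet> x = c F}"
    "\<And>F. F facet_of K \<Longrightarrow> affine hull F = {x. outward_normal K F \<bullet> x = c F}"
    "\<And>x. x \<in> K \<longleftrightarrow> (\<forall>F. F facet_of K \<longrightarrow> outward_normal K F \<bullet> x \<le> c F)"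
proof -
  let ?n = "outward_normal K"
  have "\<exists>c. \<forall>F. F facet_of K \<longrightarrow> norm (?n F) = 1 \<and> F = K \<inter> {x. ?n F \<bullet> x = c F} \<and>
     K \<subseteq> {x. ?n F \<bullet> x \<le> c F} \<and> affine hull F = {x. ?n F \<bullet> x = c F} \<and>
     (\<forall>n' c'. norm n' = 1 \<longrightarrow> F \<subseteq> {x. n' \<bullet> x = c'} \<longrightarrow> K \<subseteq> {x. n' \<bullet> x \<le> c'} \<longrightarrow> n' = ?n F \<and> c' = c F)"
  proof (rule choice, rule allI)
    fix F
    show "\<exists>c. F facet_of K \<longrightarrow> norm (?n F) = 1 \<and> F = K \<inter> {x. ?n F \<bullet> x = c} \<and>
     K \<subseteq> {x. ?n F \<bullet> x \<le> c} \<and> affine hull F = {x. ?n F \<bullet> x = c} \<and>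
     (\<forall>n' c'. norm n' = 1 \<longrightarrow> F \<subseteq> {x. n' \<bullet> x = c'} \<longrightarrow> K \<subseteq> {x. n' \<bullet> x \<le> c'} \<longrightarrow> n' = ?n F \<and> c' = c)"
    proof (cases "F facet_of K")
      case True
      show ?thesis
      proof (rule facet_outward_normal_obtain[OF K True])
        fix c assume *: "norm (?n F) = 1" "F = K \<inter> {x. ?n F \<bullet> x = c}"
          "K \<subseteq> {x. ?n F \<bullet> x \<le> c}" "affine hull F = {x. ?n F \<bullet> x = c}"
          "\<And>n' c'. norm n' = 1 \<Longrightarrow> F \<subseteq> {x. n' \<bullet> x = c'} \<Longrightarrow> K \<subseteq> {x. n' \<bullet> x \<le> c'} \<Longrightarrow> n' = ?n F \<and> c' = c"
        show ?thesis 
          by (rule exI[of _ c], rule impI, rule conjI[OF *(1) conjI[OF *(2) conjI[OF *(3) conjI[OF *(4)]]]])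
             (intro allI impI, rule *(5))
      qed
    qed simp
  qed
  then obtain c where c0: "\<forall>F. F facet_of K \<longrightarrow> norm (?n F) = 1 \<and> F = K \<inter> {x. ?n F \<bullet> x = c F} \<and>
     K \<subseteq> {x. ?n F \<bullet> x \<le> c F} \<and> affine hull F = {x. ?n F \<bullet> x = c F} \<and>
     (\<forall>n' c'. norm n' = 1 \<longrightarrow> F \<subseteq> {x. n' \<bullet> x = c'} \<longrightarrow> K \<subseteq> {x. n' \<bullet> x \<le> c'} \<longrightarrow> n' = ?n F \<and> c' = c F)"
    by (rule exE)
  have c: "norm (?n F) = 1" "F = K \<inter> {x. ?n F \<bullet> x = c F}" "K \<subseteq> {x. ?n F \<bullet> x \<le> c F}"
     "affine hull F = {x. ?n F \<bullet> x = c F}"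
     "norm n' = 1 \<Longrightarrow> F \<subseteq> {x. n' \<bullet> x = c'} \<Longrightarrow> K \<subseteq> {x. n' \<bullet> x \<le> c'} \<Longrightarrow> n' = ?n F \<and> c' = c F"
    if "F facet_of K" for F n' c'
  proof -
    note * = c0[rule_format, OF that]
    show "norm (?n F) = 1" by (rule conjunct1[OF *])
    show "F = K \<inter> {x. ?n F \<bullet> x = c F}" by (rule conjunct1[OF conjunct2[OF *]])
    show "K \<subseteq> {x. ?n F \<bullet> x \<le> c F}" by (rule conjunct1[OF conjunct2[OF conjunct2[OF *]]])
    show "affine hull F = {x. ?n F \<bullet> x = c F}" by (rule conjunct1[OF conjunct2[OF conjunct2[OF conjunct2[OF *]]]])
    show "norm n' = 1 \<Longrightarrow> F \<subseteq> {x. n' \<bullet> x = c'} \<Longrightarrow> K \<subseteq> {x. n' \<bullet> x \<le> c'} \<Longrightarrow> n' = ?n F \<and> c' = c F"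
      by (rule conjunct2[OF conjunct2[OF conjunct2[OF conjunct2[OF *]]], rule_format])
  qed
  \<comment> \<open>No proper subfamily of H describes K; this irredundance is what makes each
    half-space in H touch K in a facet.\<close>
  obtain H where H: "finite H" "K = affine hull K \<inter> \<Inter>H"
    "\<forall>h \<in> H. \<exists>a b. a \<noteq> 0 \<and> h = {x. a \<bullet> x \<le> b}"
    "\<And>H'. H' \<subset> H \<Longrightarrow> K \<subset> affine hull K \<inter> \<Inter>H'"
    using K(1) unfolding polyhedron_Int_affine_minimal by metis
  then obtain a b where ab: "\<And>h. h \<in> H \<Longrightarrow> a h \<noteq> 0 \<and> h = {x. a h \<bullet> x \<le> b h}" by metis
  have facet: "C facet_of K \<longleftrightarrow> (\<exists>h. h \<in> H \<and> C = K \<inter> {x. a h \<bullet> x = b h})" for C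
    by (rule facet_of_polyhedron_explicit[OF H(1,2) ab H(4)])
  have hull: "affine hull K = UNIV" using K(2) by (rule affine_hull_nonempty_interior)
  have "x \<in> K" if x: "\<And>F. F facet_of K \<Longrightarrow> ?n F \<bullet> x \<le> c F" for x
  proof -
    have "x \<in> h" if h: "h \<in> H" for h
    proof -
      define F where "F = K \<inter> {x. a h \<bullet> x = b h}"
      have F: "F facet_of K" using facet h F_def by blast
      have sub: "K \<subseteq> {x. a h \<bullet> x \<le> b h}" using H(2) h ab by blast
      have nz: "a h \<noteq> 0" using ab h by blast
      have "a h /\<^sub>R norm (a h) = ?n F \<and> b h / norm (a h) = c F"
        using sub nz by (intro c(5)[OF F]) (auto simp: F_def divide_simps)
      then have "(a h /\<^sub>R norm (a h)) \<bullet> x \<le> b h / norm (a h)" using x[OF F] by simp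
      then have "a h \<bullet> x \<le> b h" using nz by (simp add: divide_simps)
      then show ?thesis using ab h by blast
    qed
    then show ?thesis using H(2) hull by blast
  qed
  then have K_iff: "x \<in> K \<longleftrightarrow> (\<forall>F. F facet_of K \<longrightarrow> ?n F \<bullet> x \<le> c F)" for x
    using c(3) by blast
  show ?thesis using c(1) c(2) c(4) K_iff by (rule that)
qed

text \<open>The pair picked by \<open>SOME\<close> can differ from (n, c) only by a common sign,
  which does not change the measure.\<close>

lemma facet_integral_eq:
  fixes n :: "'a::euclidean_space"
  assumes n: "norm n = 1" and aff: "affine hull F = {x. n \<bullet> x = c}"
  shows "facet_integral F g = (LINT x:F|hyperplane_measure n c. g x)"
proof -
  let ?P = "\<lambda>(n, c). norm n = 1 \<and> affine hull F = {x. n \<bullet> x = c}"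
  obtain n' c' where s: "(SOME p. ?P p) = (n', c')" by (rule prod.exhaust)
  have "?P (n', c')" using someI[of ?P "(n, c)"] n aff unfolding s by simp
  then have n': "norm n' = 1" and sub: "{x. n \<bullet> x = c} = {x. n' \<bullet> x = c'}" using aff by auto
  have "n' = n \<and> c' = c \<or> n' = - n \<and> c' = - c" using n n' sub by (intro unit_normal_unique) auto
  then have "hyperplane_measure n' c' = hyperplane_measure n c"
    using hyperplane_measure_uminus[OF n, of c] by auto
  then show ?thesis unfolding facet_integral_def s by simp
qed

section \<open>Difference quotients and the divergence theorem on a polytope\<close>

text \<open>Factors before i come from q and factors after i from p, so each summand changes a
  single factor. With half-space indicators as factors, each summand is supported in the slab of one
  facet.\<close>

lemma prod_diff_telescope:
  fixes p q :: "nat \<Rightarrow> real"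
  shows "prod p {..<m} - prod q {..<m} =
    (\<Sum>i<m. (prod q {..<i} * prod p {i<..<m}) * (p i - q i))"
proof (induction m)
  case (Suc m)
  have *: "prod p {i<..<Suc m} = prod p {i<..<m} * p m" if "i < m" for i
  proof -
    have "{i<..<Suc m} = insert m {i<..<m}" using that by auto
    then show ?thesis by simp
  qed
  have "{m<..<Suc m} = {}" by auto
  then have "(\<Sum>i<Suc m. (prod q {..<i} * prod p {i<..<Suc m}) * (p i - q i)) =
      (\<Sum>i<m. (prod q {..<i} * (prod p {i<..<m} * p m)) * (p i - q i)) + prod q {..<m} * (p m - q m)"
    by (simp add: * del: prod.lessThan_Suc)
  also have "(\<Sum>i<m. (prod q {..<i} * (prod p {i<..<m} * p m)) * (p i - q i)) =
      (\<Sum>i<m. (prod q {..<i} * prod p {i<..<m}) * (p i - q i)) * p m"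
    unfolding sum_distrib_right by (intro sum.cong refl) (simp add: ac_simps)
  also have "\<dots> + prod q {..<m} * (p m - q m) = prod p {..<Suc m} - prod q {..<Suc m}"
    unfolding Suc.IH[symmetric] by (simp add: algebra_simps)
  finally show ?case by simp
qed simp

lemma integrable_lborel_bounded_support:
  fixes g :: "'a::euclidean_space \<Rightarrow> real"
  assumes [measurable]: "g \<in> borel_measurable borel"
    and "\<And>x. \<bar>g x\<bar> \<le> B" "\<And>x. R < norm x \<Longrightarrow> g x = 0"
  shows "integrable lborel g"
proof (rule Bochner_Integration.integrable_bound[where f = "\<lambda>x. B * indicator (cball 0 R) x"])
  show "integrable lborel (\<lambda>x::'a. B * indicator (cball 0 R) x)"
    by (intro integrable_mult_right integrable_real_indicator emeasure_bounded_finite) auto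
  have "\<bar>g x\<bar> \<le> \<bar>B * indicator (cball 0 R) x\<bar>" for x
    using assms(2)[of x] assms(3)[of x] by (cases "norm x \<le> R") (auto simp: indicator_def)
  then show "AE x in lborel. norm (g x) \<le> norm (B * indicator (cball 0 R) x)" by simp
qed simp

lemma tendsto_halfspace_indicator:
  fixes n :: "'a::euclidean_space"
  assumes "(x \<longlongrightarrow> z) G" "n \<bullet> z \<noteq> c"
  shows "((\<lambda>k. indicator {y. n \<bullet> y \<le> c} (x k) :: real) \<longlongrightarrow> indicator {y. n \<bullet> y \<le> c} z) G"
proof (rule tendsto_eventually)
  have lim: "((\<lambda>k. n \<bullet> x k) \<longlongrightarrow> n \<bullet> z) G" using assms(1) by (intro tendsto_intros)
  show "\<forall>\<^sub>F k in G. indicator {y. n \<bullet> y \<le> c} (x k) = (indicator {y. n \<bullet> y \<le> c} z :: real)"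
  proof (cases "n \<bullet> z < c")
    case True
    show ?thesis using order_tendstoD(2)[OF lim True] by eventually_elim (use True in auto)
  next
    case False
    then have "c < n \<bullet> z" using assms(2) by simp
    from order_tendstoD(1)[OF lim this] show ?thesis
      by eventually_elim (use \<open>c < n \<bullet> z\<close> in auto)
  qed
qed

lemma continuous_bounded_on_cball:
  fixes g :: "'a::euclidean_space \<Rightarrow> real"
  assumes "continuous_on UNIV g"
  obtains B where "\<And>x. norm x \<le> R \<Longrightarrow> \<bar>g x\<bar> \<le> B"
proof -
  have "compact (g ` cball 0 R)"
    by (intro compact_continuous_image continuous_on_subset[OF assms]) auto
  then have "bounded (g ` cball 0 R)" by (rule compact_imp_bounded)
  then obtain B where B: "\<And>x. x \<in> cball 0 R \<Longrightarrow> norm (g x) \<le> B" unfolding bounded_iff by blast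
  show ?thesis by (rule that[of B]) (use B in auto)
qed

text \<open>Dominated convergence. The mean value theorem bounds the quotient by a value of the
  derivative at an intermediate point, which stays within \<open>norm e\<close> of K because h k
  \<le> 1; hence the radius \<open>R0 + norm e\<close>.\<close>

lemma directional_difference_quotient_limit:
  fixes f :: "'a::euclidean_space \<Rightarrow> real" and h :: "nat \<Rightarrow> real"
  assumes K: "compact K" and der: "\<And>x. (f has_derivative f' x) (at x)"
    and cont: "continuous_on UNIV (\<lambda>x. f' x e)"
    and h: "\<And>k. 0 < h k" "\<And>k. h k \<le> 1" "h \<longlonglongrightarrow> 0"
  shows "(\<lambda>k. LINT x|lborel. indicator K x * ((f (x + h k *\<^sub>R e) - f x) / h k))
    \<longlonglongrightarrow> (LINT x|lborel. indicator K x * f' x e)"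
proof -
  have fcont: "continuous_on UNIV f"
    using der by (meson has_derivative_continuous continuous_at_imp_continuous_on)
  have [measurable]: "f \<in> borel_measurable borel" "(\<lambda>x. f' x e) \<in> borel_measurable borel" "K \<in> sets borel"
    using fcont cont K by (auto intro: borel_measurable_continuous_onI borel_compact)
  obtain R0 where R0: "\<And>x. x \<in> K \<Longrightarrow> norm x \<le> R0"
    using compact_imp_bounded[OF K] by (auto simp: bounded_iff)
  obtain B where B: "\<And>x. norm x \<le> R0 + norm e \<Longrightarrow> \<bar>f' x e\<bar> \<le> B"
    using continuous_bounded_on_cball[OF cont] by blast
  have line: "((\<lambda>t. f (x + t *\<^sub>R e)) has_real_derivative f' (x + t *\<^sub>R e) e) (at t)" for x t
  proof -
    have lin: "f' y (d *\<^sub>R e) = d * f' y e" for y d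
      using linear_cmul[OF has_derivative_linear[OF der[of y]]] by simp
    have "((\<lambda>t. x + t *\<^sub>R e) has_derivative (\<lambda>d. d *\<^sub>R e)) (at t)"
      by (auto intro!: derivative_eq_intros)
    moreover have "(*) (f' (x + t *\<^sub>R e) e) = (\<lambda>d. d * f' (x + t *\<^sub>R e) e)" by (simp add: fun_eq_iff)
    ultimately show ?thesis
      using has_derivative_compose[OF _ der] by (fastforce simp: lin has_field_derivative_def)
  qed
  show ?thesis
  proof (rule integral_dominated_convergence[where w = "\<lambda>x. B * indicator K x"])
    show "integrable lborel (\<lambda>x. B * indicator K x)"
      using compact_imp_bounded[OF K]
      by (intro integrable_mult_right integrable_real_indicator emeasure_bounded_finite) auto
    have "(\<lambda>k. (f (x + h k *\<^sub>R e) - f x) / h k) \<longlonglongrightarrow> f' x e" for x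
    proof -
      have "((\<lambda>d. (f (x + d *\<^sub>R e) - f x) / d) \<longlongrightarrow> f' x e) (at 0)"
        using line[of x 0] by (simp add: has_field_derivative_iff)
      moreover have "filterlim h (at 0) sequentially"
        using h(1,3) by (auto simp: filterlim_at less_imp_neq[symmetric])
      ultimately show ?thesis by (rule filterlim_compose)
    qed
    then show "AE x in lborel. (\<lambda>k. indicator K x * ((f (x + h k *\<^sub>R e) - f x) / h k)) \<longlonglongrightarrow> indicator K x * f' x e"
      by (intro AE_I2 tendsto_mult tendsto_const)
    fix k
    have "\<bar>(f (x + h k *\<^sub>R e) - f x) / h k\<bar> \<le> B" if "x \<in> K" for x
    proof -
      have "\<exists>z>0. z < h k \<and> f (x + h k *\<^sub>R e) - f (x + 0 *\<^sub>R e) = (h k - 0) * f' (x + z *\<^sub>R e) e"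
        by (rule MVT2[OF h(1)]) (rule line)
      then obtain z where z: "0 < z" "z < h k" "f (x + h k *\<^sub>R e) - f x = h k * f' (x + z *\<^sub>R e) e" by auto
      have "norm (x + z *\<^sub>R e) \<le> norm x + \<bar>z\<bar> * norm e" using norm_triangle_ineq[of x "z *\<^sub>R e"] by simp
      also have "\<bar>z\<bar> * norm e \<le> 1 * norm e" using z h(2)[of k] by (intro mult_right_mono) auto
      finally have "norm (x + z *\<^sub>R e) \<le> R0 + norm e" using R0[OF that] by simp
      then show ?thesis using B h(1)[of k] unfolding z(3) by simp
    qed
    then show "AE x in lborel. norm (indicator K x * ((f (x + h k *\<^sub>R e) - f x) / h k)) \<le> B * indicator K x"
      by (intro AE_I2) (auto simp: indicator_def)
  qed simp_all
qed

text \<open>One difference quotient is computed in two ways, with the shift on f and with the shift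
  on the indicator of K. In the second, the remaining half-space indicators converge off their own
  hyperplanes, and distinct facets span distinct hyperplanes, so the exceptional points are
  negligible on each facet.\<close>

theorem divergence_theorem_polytope:
  fixes K :: "(real^'d) set" and f :: "real^'d \<Rightarrow> real"
  assumes K: "polytope K" "interior K \<noteq> {}"
    and der: "\<And>x. (f has_derivative f' x) (at x)" and cont: "continuous_on UNIV (\<lambda>x. f' x e)"
  shows "(LINT x|lborel. indicator K x * f' x e) =
    (\<Sum>F | F facet_of K. (outward_normal K F \<bullet> e) * facet_integral F f)"
proof -
  define h where "h k = 1 / real (Suc k)" for k
  have h: "\<And>k. 0 < h k" "\<And>k. h k \<le> 1" "h \<longlonglongrightarrow> 0"
    using LIMSEQ_Suc[OF lim_1_over_n[where 'a = real]] by (simp_all add: h_def[abs_def])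
  have poly: "polyhedron K" using K(1) by (rule polytope_imp_polyhedron)
  have comp: "compact K" using K(1) by (rule polytope_imp_compact)
  obtain c where c: "\<And>F. F facet_of K \<Longrightarrow> norm (outward_normal K F) = 1"
    "\<And>F. F facet_of K \<Longrightarrow> F = K \<inter> {x. outward_normal K F \<bullet> x = c F}"
    "\<And>F. F facet_of K \<Longrightarrow> affine hull F = {x. outward_normal K F \<bullet> x = c F}"
    "\<And>x. x \<in> K \<longleftrightarrow> (\<forall>F. F facet_of K \<longrightarrow> outward_normal K F \<bullet> x \<le> c F)"
    using full_dim_polytope_halfspaces[OF poly K(2)] by metis
  obtain fs where fs: "set fs = {F. F facet_of K}" "distinct fs"
    using finite_distinct_list[OF finite_polytope_facets[OF K(1)]] by blast
  define m where "m = length fs"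
  define n where "n i = outward_normal K (fs ! i)" for i
  define b where "b i = c (fs ! i)" for i
  have facet: "fs ! i facet_of K" if "i < m" for i
    using fs(1) that by (metis m_def mem_Collect_eq nth_mem)
  have n1: "norm (n i) = 1" if "i < m" for i using c(1)[OF facet[OF that]] by (simp add: n_def)
  have K_iff: "x \<in> K \<longleftrightarrow> (\<forall>i<m. n i \<bullet> x \<le> b i)" for x
  proof -
    have "x \<in> K \<longleftrightarrow> (\<forall>F\<in>set fs. outward_normal K F \<bullet> x \<le> c F)" using c(4) fs(1) by auto
    then show ?thesis by (simp add: all_set_conv_all_nth m_def n_def b_def)
  qed
  define q where "q i = (indicator {y. n i \<bullet> y \<le> b i} :: real^'d \<Rightarrow> real)" for i
  have [measurable]: "q i \<in> borel_measurable borel" for i unfolding q_def by measurable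
  have q01: "0 \<le> q i x" "q i x \<le> 1" for i x by (auto simp: q_def)
  have indK: "indicator K x = (\<Prod>i<m. q i x)" for x
    by (auto simp: q_def K_iff indicator_def prod_zero_iff)
  have fcont: "continuous_on UNIV f"
    using der by (meson has_derivative_continuous continuous_at_imp_continuous_on)
  have [measurable]: "f \<in> borel_measurable borel" "K \<in> sets borel"
    using fcont comp by (auto intro: borel_measurable_continuous_onI borel_compact)
  obtain R0 where R0: "\<And>x. x \<in> K \<Longrightarrow> norm x \<le> R0"
    using compact_imp_bounded[OF comp] by (auto simp: bounded_iff)
  define R where "R = R0 + norm e"
  \<comment> \<open>The telescoped products are indicators of possibly unbounded sets. The cutoff
    makes every integrand bounded with bounded support and agrees with f on K and on its translates,
    which lie in the ball of radius R.\<close>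
  define \<phi> where "\<phi> x = f x * max 0 (min 1 (R + 1 - norm x))" for x
  have \<phi>cont: "continuous_on UNIV \<phi>" unfolding \<phi>_def[abs_def] by (intro continuous_intros fcont)
  have [measurable]: "\<phi> \<in> borel_measurable borel" using \<phi>cont by (rule borel_measurable_continuous_onI)
  have \<phi>0: "\<phi> x = 0" if "R + 1 \<le> norm x" for x using that by (simp add: \<phi>_def)
  have \<phi>f: "\<phi> x = f x" if "norm x \<le> R" for x using that by (simp add: \<phi>_def)
  obtain B0 where B0: "\<And>x. norm x \<le> R + 1 \<Longrightarrow> \<bar>\<phi> x\<bar> \<le> B0"
    using continuous_bounded_on_cball[OF \<phi>cont] by blast
  define B where "B = max B0 0"
  have B: "\<bar>\<phi> x\<bar> \<le> B" for x
    using B0[of x] \<phi>0[of x] by (cases "norm x \<le> R + 1") (auto simp: B_def)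
  have B00: "B \<ge> 0" by (simp add: B_def)
  define u where "u i k x = \<phi> x * ((\<Prod>j<i. q j x) * (\<Prod>j\<in>{i<..<m}. q j (x - h k *\<^sub>R e)))" for i k x
  define g where "g i x = \<phi> x * ((\<Prod>j<i. q j x) * (\<Prod>j\<in>{i<..<m}. q j x))" for i x
  have [measurable]: "u i k \<in> borel_measurable borel" "g i \<in> borel_measurable borel" for i k
    unfolding u_def[abs_def] g_def[abs_def] by measurable
  have ubd: "\<bar>u i k x\<bar> \<le> B" for i k x
  proof -
    have "\<bar>(\<Prod>j<i. q j x) * (\<Prod>j\<in>{i<..<m}. q j (x - h k *\<^sub>R e))\<bar> \<le> 1"
      unfolding abs_mult abs_prod using q01
      by (intro mult_le_one prod_le_1 prod_nonneg conjI) (auto simp: abs_le_iff intro: order_trans[of _ 0])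
    then show ?thesis unfolding u_def abs_mult[of "\<phi> x"] using B[of x] B00
      by (metis abs_ge_zero mult.right_neutral mult_mono)
  qed
  have u0: "u i k x = 0" if "R + 1 \<le> norm x" for i k x using \<phi>0[OF that] by (simp add: u_def)
  have quot: "(LINT x|lborel. indicator K x * ((f (x + h k *\<^sub>R e) - f x) / h k)) =
     (\<Sum>i<m. 1 / h k * (LINT x|lborel. u i k x * (indicator {x. n i \<bullet> (x - h k *\<^sub>R e) \<le> b i} x - indicator {x. n i \<bullet> x \<le> b i} x)))" for k
  proof -
    have K_bd: "x - h k *\<^sub>R e \<in> K \<Longrightarrow> norm x \<le> R" "x \<in> K \<Longrightarrow> norm x \<le> R" for x
    proof -
      have hk: "norm (h k *\<^sub>R e) \<le> norm e" using h(1,2)[of k] by (simp add: mult_left_le_one_le)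
      assume "x - h k *\<^sub>R e \<in> K"
      then have "norm (x - h k *\<^sub>R e) \<le> R0" by (rule R0)
      then show "norm x \<le> R" using hk norm_triangle_ineq[of "x - h k *\<^sub>R e" "h k *\<^sub>R e"] by (simp add: R_def)
    next
      assume "x \<in> K" then show "norm x \<le> R" using R0[of x] norm_ge_zero[of e] unfolding R_def by linarith
    qed
    have int1: "integrable lborel (\<lambda>x. indicator K (x - h k *\<^sub>R e) * f x)"
    proof (rule integrable_lborel_bounded_support[where B = B and R = R])
      show "\<bar>indicator K (x - h k *\<^sub>R e) * f x\<bar> \<le> B" for x
        using K_bd(1)[of x] \<phi>f[of x] B[of x] B00 by (cases "x - h k *\<^sub>R e \<in> K") auto
      show "R < norm x \<Longrightarrow> indicator K (x - h k *\<^sub>R e) * f x = 0" for x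
        using K_bd(1)[of x] by (auto simp: indicator_def)
    qed measurable
    have int2: "integrable lborel (\<lambda>x. indicator K x * f x)"
    proof (rule integrable_lborel_bounded_support[where B = B and R = R])
      show "\<bar>indicator K x * f x\<bar> \<le> B" for x
        using K_bd(2)[of x] \<phi>f[of x] B[of x] B00 by (cases "x \<in> K") auto
      show "R < norm x \<Longrightarrow> indicator K x * f x = 0" for x
        using K_bd(2)[of x] by (auto simp: indicator_def)
    qed measurable
    have tr: "distr lborel borel ((+) (h k *\<^sub>R e)) = lborel" by (rule lborel_distr_plus)
    have int3: "integrable lborel (\<lambda>x. indicator K x * f (x + h k *\<^sub>R e))"
      using int1
      by (subst (asm) tr[symmetric], subst (asm) integrable_distr_eq) (auto simp: add.commute)
    \<comment> \<open>Translation invariance moves the shift from f to the indicator.\<close>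
    have int3': "(LINT x|lborel. indicator K x * f (x + h k *\<^sub>R e)) = (LINT x|lborel. indicator K (x - h k *\<^sub>R e) * f x)"
      by (subst (2) tr[symmetric], subst integral_distr) (auto simp: add.commute)
    have "(LINT x|lborel. indicator K x * ((f (x + h k *\<^sub>R e) - f x) / h k)) =
        (LINT x|lborel. (indicator K x * f (x + h k *\<^sub>R e) - indicator K x * f x) / h k)"
      by (intro Bochner_Integration.integral_cong refl) (simp add: algebra_simps diff_divide_distrib)
    also have "\<dots> = 1 / h k * ((LINT x|lborel. indicator K x * f (x + h k *\<^sub>R e)) - (LINT x|lborel. indicator K x * f x))"
      using int2 int3 by simp
    also have "\<dots> = 1 / h k * (LINT x|lborel. indicator K (x - h k *\<^sub>R e) * f x - indicator K x * f x)"
      unfolding int3' using int1 int2 by simp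
    also have "(LINT x|lborel. indicator K (x - h k *\<^sub>R e) * f x - indicator K x * f x) =
       (LINT x|lborel. (\<Sum>i<m. u i k x * (q i (x - h k *\<^sub>R e) - q i x)))"
    proof (rule Bochner_Integration.integral_cong[OF refl])
      fix x
      have "indicator K (x - h k *\<^sub>R e) * f x - indicator K x * f x =
          \<phi> x * (indicator K (x - h k *\<^sub>R e) - indicator K x)"
        using K_bd[of x] \<phi>f[of x] by (auto simp: indicator_def)
      also have "\<dots> = \<phi> x * (\<Sum>i<m. ((\<Prod>j<i. q j x) * (\<Prod>j\<in>{i<..<m}. q j (x - h k *\<^sub>R e))) * (q i (x - h k *\<^sub>R e) - q i x))"
        unfolding indK by (subst prod_diff_telescope) simp
      also have "\<dots> = (\<Sum>i<m. u i k x * (q i (x - h k *\<^sub>R e) - q i x))"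
        by (simp add: u_def sum_distrib_left mult.assoc)
      finally show "indicator K (x - h k *\<^sub>R e) * f x - indicator K x * f x = (\<Sum>i<m. u i k x * (q i (x - h k *\<^sub>R e) - q i x))" .
    qed
    also have "\<dots> = (\<Sum>i<m. LINT x|lborel. u i k x * (q i (x - h k *\<^sub>R e) - q i x))"
    proof (rule Bochner_Integration.integral_sum)
      fix i
      show "integrable lborel (\<lambda>x. u i k x * (q i (x - h k *\<^sub>R e) - q i x))"
      proof (rule integrable_lborel_bounded_support[where B = B and R = "R + 1"])
        show "\<bar>u i k x * (q i (x - h k *\<^sub>R e) - q i x)\<bar> \<le> B" for x
        proof -
          have "\<bar>q i (x - h k *\<^sub>R e) - q i x\<bar> \<le> 1" using q01[of i x] q01[of i "x - h k *\<^sub>R e"] by linarith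
          then show ?thesis unfolding abs_mult using ubd[of i k x] B00
            by (metis abs_ge_zero mult.right_neutral mult_mono)
        qed
      qed (use u0 in auto)
    qed
    finally show ?thesis by (simp add: sum_distrib_left q_def indicator_def)
  qed
  have lim: "(\<lambda>k. 1 / h k * (LINT x|lborel. u i k x * (indicator {x. n i \<bullet> (x - h k *\<^sub>R e) \<le> b i} x - indicator {x. n i \<bullet> x \<le> b i} x)))
     \<longlonglongrightarrow> (n i \<bullet> e) * facet_integral (fs ! i) f" if i: "i < m" for i
  proof -
    have nn: "n i \<bullet> n i = 1" using n1[OF i] by (simp add: norm_eq_1)
    \<comment> \<open>Projected to hyperplane i, the equation of facet j becomes one with normal n j
      - r n i. It can hold identically only if both hyperplanes coincide, and then so do the facets,
      as their intersections with K.\<close>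
    have "AE y in lborel. n j \<bullet> (y - (n i \<bullet> y - b i) *\<^sub>R n i) \<noteq> b j" if j: "j < m" "j \<noteq> i" for j
    proof -
      define r where "r = n j \<bullet> n i"
      have "n j - r *\<^sub>R n i \<noteq> 0 \<or> b j - r * b i \<noteq> 0"
      proof (rule ccontr)
        assume "\<not> ?thesis"
        then have 1: "n j = r *\<^sub>R n i" "b j = r * b i" by auto
        then have "{x. n i \<bullet> x = b i} \<subseteq> {x. n j \<bullet> x = b j}" by auto
        then have "n j = n i \<and> b j = b i \<or> n j = - n i \<and> b j = - b i"
          by (intro unit_normal_unique n1 i j)
        then have "{x. n j \<bullet> x = b j} = {x. n i \<bullet> x = b i}" by auto
        then have "fs ! j = fs ! i"
          using c(2)[OF facet[OF i]] c(2)[OF facet[OF j(1)]] unfolding n_def b_def by metis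
        then show False using fs(2) i j by (simp add: nth_eq_iff_index_eq m_def)
      qed
      then have "AE y in lborel. (n j - r *\<^sub>R n i) \<bullet> y \<noteq> b j - r * b i"
        by (rule AE_lborel_not_in_hyperplane)
      then show ?thesis
        by eventually_elim (auto simp: r_def inner_diff_right inner_diff_left algebra_simps)
    qed
    then have "AE y in lborel. \<forall>j\<in>{..<m} - {i}. n j \<bullet> (y - (n i \<bullet> y - b i) *\<^sub>R n i) \<noteq> b j"
      by (intro AE_finite_allI) auto
    then have "AE y in lborel. (\<lambda>k. u i k (y - (n i \<bullet> y - b i) *\<^sub>R n i + (h k * (n i \<bullet> e) * (n i \<bullet> y - b i)) *\<^sub>R n i))
      \<longlonglongrightarrow> g i (y - (n i \<bullet> y - b i) *\<^sub>R n i)"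
    proof eventually_elim
      case (elim y)
      define z where "z = y - (n i \<bullet> y - b i) *\<^sub>R n i"
      define x where "x k = z + (h k * (n i \<bullet> e) * (n i \<bullet> y - b i)) *\<^sub>R n i" for k
      have "x \<longlonglongrightarrow> z + (0 * (n i \<bullet> e) * (n i \<bullet> y - b i)) *\<^sub>R n i"
        unfolding x_def[abs_def] by (intro tendsto_intros h(3))
      then have x: "x \<longlonglongrightarrow> z" by simp
      have "(\<lambda>k. x k - h k *\<^sub>R e) \<longlonglongrightarrow> z - 0 *\<^sub>R e" by (intro tendsto_intros x h(3))
      then have x': "(\<lambda>k. x k - h k *\<^sub>R e) \<longlonglongrightarrow> z" by simp
      have \<phi>x: "(\<lambda>k. \<phi> (x k)) \<longlonglongrightarrow> \<phi> z" using continuous_on_tendsto_compose[OF \<phi>cont x] by simp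
      have "n j \<bullet> z \<noteq> b j" if "j < m" "j \<noteq> i" for j using elim that by (simp add: z_def)
      then have "(\<lambda>k. u i k (x k)) \<longlonglongrightarrow> g i z"
        unfolding u_def g_def q_def using i
        by (intro tendsto_mult \<phi>x tendsto_prod tendsto_halfspace_indicator x x') auto
      then show ?case by (simp add: x_def[abs_def] z_def)
    qed
    then have "(\<lambda>k. 1 / h k * (LINT x|lborel. u i k x * (indicator {x. n i \<bullet> (x - h k *\<^sub>R e) \<le> b i} x - indicator {x. n i \<bullet> x \<le> b i} x)))
     \<longlonglongrightarrow> (n i \<bullet> e) * (LINT x|hyperplane_measure (n i) (b i). g i x)"
      by (intro slab_limit[where B = B and R = "R + 1"] n1 i h(1,2) ubd u0) auto
    also have "(LINT x|hyperplane_measure (n i) (b i). g i x) = facet_integral (fs ! i) f"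
    proof -
      have F: "fs ! i = K \<inter> {x. n i \<bullet> x = b i}" using c(2)[OF facet[OF i]] by (simp add: n_def b_def)
      have Fm[measurable]: "fs ! i \<in> sets borel" unfolding F by measurable
      have "facet_integral (fs ! i) f = (LINT x:fs ! i|hyperplane_measure (n i) (b i). f x)"
        using facet_integral_eq[OF n1[OF i]] c(3)[OF facet[OF i]] by (simp add: n_def b_def)
      also have "\<dots> = (LINT x|hyperplane_measure (n i) (b i). g i x)"
        unfolding set_lebesgue_integral_def
      proof (rule integral_cong_AE)
        have "AE x in hyperplane_measure (n i) (b i). n i \<bullet> x = b i"
          by (rule AE_hyperplane_measure) (auto simp: inner_diff_right nn)
        then show "AE x in hyperplane_measure (n i) (b i). indicator (fs ! i) x *\<^sub>R f x = g i x"
        proof eventually_elim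
          case (elim x)
          have split: "{..<m} = {..<i} \<union> {i<..<m} \<union> {i}" using i by auto
          \<comment> \<open>The factor i missing from g equals 1 on its own hyperplane, so the
            product there is the full indicator of K.\<close>
          have qi: "q i x = 1" using elim by (simp add: q_def)
          have "indicator K x = (\<Prod>j<i. q j x) * (\<Prod>j\<in>{i<..<m}. q j x)"
            unfolding indK split by (subst prod.union_disjoint, auto)+ (auto simp: qi)
          then have "g i x = \<phi> x * indicator K x" by (simp add: g_def)
          moreover have "indicator (fs ! i) x = indicator K x" using elim by (auto simp: F indicator_def)
          moreover have "\<phi> x = f x" if "x \<in> K"
            using add_mono[OF R0[OF that] norm_ge_zero[of e]] by (intro \<phi>f) (simp add: R_def)
          ultimately show ?case by (auto simp: indicator_def)
        qed
      qed simp_all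
      finally show ?thesis by simp
    qed
    finally show ?thesis .
  qed
  have "(\<lambda>k. LINT x|lborel. indicator K x * ((f (x + h k *\<^sub>R e) - f x) / h k)) \<longlonglongrightarrow> (\<Sum>i<m. (n i \<bullet> e) * facet_integral (fs ! i) f)"
    unfolding quot by (intro tendsto_sum lim) simp
  moreover have "(\<lambda>k. LINT x|lborel. indicator K x * ((f (x + h k *\<^sub>R e) - f x) / h k)) \<longlonglongrightarrow> (LINT x|lborel. indicator K x * f' x e)"
    by (rule directional_difference_quotient_limit[OF comp der cont h])
  ultimately have "(LINT x|lborel. indicator K x * f' x e) = (\<Sum>i<m. (n i \<bullet> e) * facet_integral (fs ! i) f)"
    using LIMSEQ_unique by blast
  also have "\<dots> = (\<Sum>F\<in>set fs. (outward_normal K F \<bullet> e) * facet_integral F f)"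
    unfolding n_def m_def by (rule sum.reindex_bij_betw[OF bij_betw_nth[OF fs(2) refl refl], of "\<lambda>F. (outward_normal K F \<bullet> e) * facet_integral F f"])
  finally show ?thesis by (simp add: fs(1))
qed


subsection \<open>Mesh geometry\<close>

text \<open>Excludes slits, whose faces would lie in the frontier and yet have elements on both
  sides. Near a frontier point the set strictly below the graph is open and disjoint from
  \<open>\<Omega>\<close>, hence from its closure, so a point on or below the graph is not interior
  to the closure.\<close>

lemma lipschitz_domain_interior_closure:
  fixes \<Omega> :: "'a::euclidean_space set"
  assumes "lipschitz_domain \<Omega>"
  shows "interior (closure \<Omega>) = \<Omega>"
proof
  have op: "open \<Omega>" using assms by (simp add: lipschitz_domain_def)
  show "\<Omega> \<subseteq> interior (closure \<Omega>)"
    using op closure_subset by (rule interior_maximal[rotated])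
  show "interior (closure \<Omega>) \<subseteq> \<Omega>"
  proof
    fix x assume x: "x \<in> interior (closure \<Omega>)"
    show "x \<in> \<Omega>"
    proof (rule ccontr)
      assume nx: "x \<notin> \<Omega>"
      then have "x \<in> frontier \<Omega>" using x op interior_subset by (auto simp: frontier_def interior_open)
      then have "\<exists>U n \<phi> L. open U \<and> x \<in> U \<and> norm n = 1 \<and> L-lipschitz_on {z. z \<bullet> n = 0} \<phi> \<and>
        \<Omega> \<inter> U = {y \<in> U. \<phi> (y - (y \<bullet> n) *\<^sub>R n) < y \<bullet> n}"
        using assms by (simp add: lipschitz_domain_def)
      then obtain U n \<phi> L where U: "open U" "x \<in> U" "norm n = 1" "L-lipschitz_on {z. z \<bullet> n = 0} \<phi>"
        "\<Omega> \<inter> U = {y \<in> U. \<phi> (y - (y \<bullet> n) *\<^sub>R n) < y \<bullet> n}"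
        by (elim exE conjE)
      have U6: "y \<in> \<Omega> \<longleftrightarrow> \<phi> (y - (y \<bullet> n) *\<^sub>R n) < y \<bullet> n" if "y \<in> U" for y
        using U(5) that by blast
      have nn: "n \<bullet> n = 1" using U(3) by (simp add: norm_eq_1)
      have \<phi>: "continuous_on UNIV (\<lambda>y. \<phi> (y - (y \<bullet> n) *\<^sub>R n))"
      proof (rule continuous_on_compose2[OF lipschitz_on_continuous_on[OF U(4)]])
        show "continuous_on UNIV (\<lambda>y. y - (y \<bullet> n) *\<^sub>R n)" by (intro continuous_intros)
      qed (auto simp: inner_diff_left nn)
      define W where "W = U \<inter> {y. y \<bullet> n < \<phi> (y - (y \<bullet> n) *\<^sub>R n)}"
      have W: "open W" unfolding W_def
        by (intro open_Int U(1) open_Collect_less continuous_intros \<phi>)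
      have "W \<inter> \<Omega> = {}" using U6 by (fastforce simp: W_def)
      then have Wc: "W \<inter> closure \<Omega> = {}" using open_Int_closure_eq_empty[OF W] by blast
      have "open (U \<inter> interior (closure \<Omega>))" using U(1) by auto
      then obtain d where d: "d > 0" "ball x d \<subseteq> U \<inter> interior (closure \<Omega>)"
        using x U(2) open_contains_ball by blast
      \<comment> \<open>Moving against n keeps the projection along n and lowers the height, so y
        lies strictly below the graph.\<close>
      define y where "y = x - (d/2) *\<^sub>R n"
      have "y \<in> ball x d" using d(1) U(3) by (simp add: y_def dist_norm)
      then have yU: "y \<in> U" "y \<in> closure \<Omega>" using d(2) interior_subset by blast+
      have y1: "y \<bullet> n = x \<bullet> n - d/2" by (simp add: y_def inner_diff_left nn)
      have y2: "y - (y \<bullet> n) *\<^sub>R n = x - (x \<bullet> n) *\<^sub>R n" unfolding y1 by (simp add: y_def algebra_simps)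
      have "x \<bullet> n \<le> \<phi> (x - (x \<bullet> n) *\<^sub>R n)" using nx U6[OF U(2)] by simp
      then have "y \<in> W" using yU y2 y1 d(1) by (simp add: W_def)
      then show False using Wc yU by blast
    qed
  qed
qed

lemma full_dim_simplex:
  fixes K :: "'a::euclidean_space set"
  assumes "int DIM('a) simplex K"
  shows "polytope K" "interior K \<noteq> {}" "convex K" "closed K" "aff_dim K = DIM('a)"
proof -
  obtain C where C: "finite C" "\<not> affine_dependent C" "int (card C) = int DIM('a) + 1" "K = convex hull C"
    using assms unfolding simplex by blast
  show p: "polytope K" using C by (simp add: polytope_convex_hull)
  show "convex K" "closed K" using p by (auto simp: polytope_imp_convex polytope_imp_closed)
  show d: "aff_dim K = DIM('a)" using aff_dim_simplex[OF assms] by simp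
  have "affine hull K = UNIV" using d by (simp add: aff_dim_eq_full)
  then have "interior K = rel_interior K" by (simp add: rel_interior_interior)
  moreover have "K \<noteq> {}" using d by auto
  ultimately show "interior K \<noteq> {}" using rel_interior_eq_empty[OF \<open>convex K\<close>] by simp
qed

text \<open>At a relative interior point of F all other facet inequalities are strict: an equality
  for G would put F inside G as a face of equal dimension, so F = G. Finitely many strict
  inequalities persist on a ball.\<close>

lemma facet_local_halfspace:
  fixes K :: "'a::euclidean_space set"
  assumes K: "polytope K" "interior K \<noteq> {}" and F: "F facet_of K" and x: "x \<in> rel_interior F"
  obtains d where "d > 0" "\<And>y. y \<in> ball x d \<Longrightarrow> y \<in> K \<longleftrightarrow> outward_normal K F \<bullet> y \<le> outward_normal K F \<bullet> x"
proof -
  have poly: "polyhedron K" using K(1) by (rule polytope_imp_polyhedron)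
  obtain c where c: "\<And>F. F facet_of K \<Longrightarrow> norm (outward_normal K F) = 1"
    "\<And>F. F facet_of K \<Longrightarrow> F = K \<inter> {x. outward_normal K F \<bullet> x = c F}"
    "\<And>F. F facet_of K \<Longrightarrow> affine hull F = {x. outward_normal K F \<bullet> x = c F}"
    "\<And>x. x \<in> K \<longleftrightarrow> (\<forall>F. F facet_of K \<longrightarrow> outward_normal K F \<bullet> x \<le> c F)"
    using full_dim_polytope_halfspaces[OF poly K(2)] by metis
  have fin: "finite {G. G facet_of K}" using K(1) by (rule finite_polytope_facets)
  have xF: "x \<in> F" using x rel_interior_subset by blast
  then have cF: "outward_normal K F \<bullet> x = c F" using c(2)[OF F] by blast
  have xK: "x \<in> K" using xF facet_of_imp_subset[OF F] by blast
  have strict: "outward_normal K G \<bullet> x < c G" if G: "G facet_of K" "G \<noteq> F" for G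
  proof (rule ccontr)
    assume "\<not> ?thesis"
    then have "outward_normal K G \<bullet> x = c G" using xK G(1) c(4) by force
    then have "x \<in> G" using c(2)[OF G(1)] xK by blast
    then have FG: "F \<subseteq> G"
      using x by (intro subset_of_face_of[OF facet_of_imp_face_of[OF G(1)] facet_of_imp_subset[OF F]]) blast
    have ad: "aff_dim F = aff_dim G" using F G(1) by (simp add: facet_of_def)
    have "F face_of G" using facet_of_imp_face_of[OF F] FG facet_of_imp_subset[OF G(1)] by (rule face_of_subset)
    moreover have "convex G" using facet_of_imp_face_of[OF G(1)] face_of_imp_convex by blast
    ultimately show False using face_of_aff_dim_lt[of G F] G(2) ad by auto
  qed
  define W where "W = (\<Inter>G\<in>{G. G facet_of K} - {F}. {y. outward_normal K G \<bullet> y < c G})"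
  have "open W" unfolding W_def using fin by (intro open_INT) (auto simp: open_halfspace_lt)
  moreover have "x \<in> W" using strict by (auto simp: W_def)
  ultimately obtain d where d: "d > 0" "ball x d \<subseteq> W" using open_contains_ball by blast
  have "y \<in> K \<longleftrightarrow> outward_normal K F \<bullet> y \<le> c F" if "y \<in> ball x d" for y
  proof
    show "y \<in> K \<Longrightarrow> outward_normal K F \<bullet> y \<le> c F" using c(4) F by blast
    assume y: "outward_normal K F \<bullet> y \<le> c F"
    have "outward_normal K G \<bullet> y \<le> c G" if "G facet_of K" for G
    proof (cases "G = F")
      case False
      then have "outward_normal K G \<bullet> y < c G" using d(2) \<open>y \<in> ball x d\<close> that by (auto simp: W_def)
      then show ?thesis by simp
    qed (use y in simp)
    then show "y \<in> K" using c(4) by blast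
  qed
  then show ?thesis using d(1) cF by (intro that[of d]) simp_all
qed

lemma facet_normals:
  fixes K :: "'a::euclidean_space set"
  assumes "polytope K" "interior K \<noteq> {}" "F facet_of K" "polytope K'" "interior K' \<noteq> {}" "F facet_of K'"
  shows "outward_normal K' F = outward_normal K F \<or> outward_normal K' F = - outward_normal K F"
proof -
  obtain c where c: "norm (outward_normal K F) = 1" "affine hull F = {x. outward_normal K F \<bullet> x = c}"
    using facet_outward_normal_obtain[OF polytope_imp_polyhedron[OF assms(1)] assms(2,3)] by metis
  obtain c' where c': "norm (outward_normal K' F) = 1" "affine hull F = {x. outward_normal K' F \<bullet> x = c'}"
    using facet_outward_normal_obtain[OF polytope_imp_polyhedron[OF assms(4)] assms(5,6)] by metis
  show ?thesis using unit_normal_unique[OF c(1) c'(1), of c c'] c(2) c'(2) by auto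
qed

section \<open>Adjacency of mesh elements across a face\<close>

context
  fixes \<Omega> :: "'a::euclidean_space set" and M
  assumes dom: "lipschitz_domain \<Omega>" and mesh: "simplicial_mesh \<Omega> M"
begin

lemma mesh_element:
  assumes "K \<in> M"
  shows "polytope K" "interior K \<noteq> {}" "convex K" "closed K" "aff_dim K = DIM('a)" "K \<subseteq> closure \<Omega>"
    "interior K \<subseteq> \<Omega>"
proof -
  have s: "int DIM('a) simplex K" using mesh assms by (auto simp: simplicial_mesh_def)
  show "polytope K" "interior K \<noteq> {}" "convex K" "closed K" "aff_dim K = DIM('a)"
    using full_dim_simplex[OF s] by auto
  show *: "K \<subseteq> closure \<Omega>" using mesh assms by (auto simp: simplicial_mesh_def)
  show "interior K \<subseteq> \<Omega>" using interior_mono[OF *] lipschitz_domain_interior_closure[OF dom] by simp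
qed

lemma mesh_finite: "finite M"
  using mesh by (simp add: simplicial_mesh_def triangulation_def)

lemma mesh_Int_face: "K \<in> M \<Longrightarrow> K' \<in> M \<Longrightarrow> (K \<inter> K') face_of K"
  using mesh by (simp add: simplicial_mesh_def triangulation_def)

lemma mesh_finite_facets: "K \<in> M \<Longrightarrow> finite {F. F facet_of K}"
  using mesh_element(1) by (rule finite_polytope_facets)

lemma mesh_faces_finite: "finite (mesh_faces M)"
proof -
  have "mesh_faces M = (\<Union>K\<in>M. {F. F facet_of K})" by (auto simp: mesh_faces_def)
  then show ?thesis using mesh_finite mesh_finite_facets by auto
qed

lemma mesh_facet_rel_interior:
  assumes "K \<in> M" "F facet_of K"
  shows "convex F" "rel_interior F \<noteq> {}"
proof -
  show "convex F" using facet_of_imp_face_of[OF assms(2)] by (rule face_of_imp_convex)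
  then show "rel_interior F \<noteq> {}" using assms(2) by (auto simp: rel_interior_eq_empty facet_of_def)
qed

lemma mesh_subset_imp_eq:
  assumes K: "K \<in> M" "K' \<in> M" and "K \<inter> K' = K" shows "K = K'"
proof (rule ccontr)
  assume "K \<noteq> K'"
  have "K face_of K'" using mesh_Int_face[OF K(2,1)] assms(3) by (simp add: Int_commute)
  then have "aff_dim K < aff_dim K'" using \<open>K \<noteq> K'\<close> mesh_element(3)[OF K(2)] by (intro face_of_aff_dim_lt)
  then show False using mesh_element(5) K by simp
qed

text \<open>Both elements contain the same half-ball at a relative interior point of F, so their
  interiors meet. Their intersection is a face of K by conformity, and a face meeting the interior
  is all of K.\<close>

lemma mesh_same_side_eq:
  assumes K: "K \<in> M" "F facet_of K" and K': "K' \<in> M" "F facet_of K'"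
    and n: "outward_normal K' F = outward_normal K F"
  shows "K' = K"
proof -
  let ?n = "outward_normal K F"
  obtain x where x: "x \<in> rel_interior F" using mesh_facet_rel_interior[OF K] by blast
  have n1: "norm ?n = 1"
    using facet_outward_normal_obtain[OF polytope_imp_polyhedron[OF mesh_element(1)[OF K(1)]] mesh_element(2)[OF K(1)] K(2)] by metis
  then have nn: "?n \<bullet> ?n = 1" by (simp add: norm_eq_1)
  obtain d where d: "d > 0" "\<And>y. y \<in> ball x d \<Longrightarrow> y \<in> K \<longleftrightarrow> ?n \<bullet> y \<le> ?n \<bullet> x"
    using facet_local_halfspace[OF mesh_element(1,2)[OF K(1)] K(2) x] by metis
  obtain d' where d': "d' > 0" "\<And>y. y \<in> ball x d' \<Longrightarrow> y \<in> K' \<longleftrightarrow> ?n \<bullet> y \<le> ?n \<bullet> x"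
    using facet_local_halfspace[OF mesh_element(1,2)[OF K'(1)] K'(2) x] n by metis
  define r where "r = min d d'"
  have r: "r > 0" using d(1) d'(1) by (simp add: r_def)
  define W where "W = ball x r \<inter> {y. ?n \<bullet> y < ?n \<bullet> x}"
  have "open W" unfolding W_def by (intro open_Int open_ball open_halfspace_lt)
  moreover have "W \<subseteq> K" "W \<subseteq> K'" using d(2) d'(2) by (auto simp: W_def r_def)
  moreover have "x - (r/2) *\<^sub>R ?n \<in> W"
    using r n1 by (simp add: W_def dist_norm inner_diff_right nn)
  ultimately obtain y where y: "y \<in> interior K" "y \<in> interior K'" using interior_maximal by (metis subsetD)
  have "K \<subseteq> K \<inter> K'"
  proof (rule subset_of_face_of[OF mesh_Int_face[OF K(1) K'(1)] order_refl])
    show "(K \<inter> K') \<inter> rel_interior K \<noteq> {}"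
      using y interior_subset interior_subset_rel_interior by blast
  qed
  then show ?thesis using mesh_subset_imp_eq[OF K(1) K'(1)] by blast
qed

lemma mesh_opposite_normal:
  assumes "K \<in> M" "F facet_of K" "K' \<in> M" "F facet_of K'" "K' \<noteq> K"
  shows "outward_normal K' F = - outward_normal K F"
  using facet_normals[OF mesh_element(1,2)[OF assms(1)] assms(2) mesh_element(1,2)[OF assms(3)] assms(4)]
    mesh_same_side_eq[OF assms(1-4)] assms(5) by blast

lemma mesh_other_side_unique:
  assumes "K \<in> M" "F facet_of K" "K' \<in> M" "F facet_of K'" "K' \<noteq> K" "K'' \<in> M" "F facet_of K''" "K'' \<noteq> K"
  shows "K'' = K'"
  using mesh_same_side_eq[OF assms(3,4,6,7)] mesh_opposite_normal[OF assms(1-5)]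
    mesh_opposite_normal[OF assms(1,2,6-8)] by simp

text \<open>Two elements on opposite sides would fill a ball about a relative interior point of F.
  That point would be interior to the closure, hence in \<open>\<Omega>\<close>, although it lies on
  the frontier.\<close>

lemma boundary_face_element_unique:
  assumes F: "F \<in> boundary_faces \<Omega> M" and K: "K \<in> M" "F facet_of K" and K': "K' \<in> M" "F facet_of K'"
  shows "K' = K"
proof (rule ccontr)
  assume ne: "K' \<noteq> K"
  let ?n = "outward_normal K F"
  obtain x where x: "x \<in> rel_interior F" using mesh_facet_rel_interior[OF K] by blast
  obtain d where d: "d > 0" "\<And>y. y \<in> ball x d \<Longrightarrow> y \<in> K \<longleftrightarrow> ?n \<bullet> y \<le> ?n \<bullet> x"
    using facet_local_halfspace[OF mesh_element(1,2)[OF K(1)] K(2) x] by metis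
  obtain d' where d': "d' > 0" "\<And>y. y \<in> ball x d' \<Longrightarrow> y \<in> K' \<longleftrightarrow> - ?n \<bullet> y \<le> - ?n \<bullet> x"
    using facet_local_halfspace[OF mesh_element(1,2)[OF K'(1)] K'(2) x] mesh_opposite_normal[OF K K' ne] by metis
  have "ball x (min d d') \<subseteq> K \<union> K'" using d(2) d'(2) by auto
  also have "\<dots> \<subseteq> closure \<Omega>" using mesh_element(6) K(1) K'(1) by blast
  finally have "x \<in> interior (closure \<Omega>)" using d(1) d'(1) unfolding mem_interior by (intro exI[of _ "min d d'"]) auto
  then have "x \<in> \<Omega>" using lipschitz_domain_interior_closure[OF dom] by simp
  moreover have "x \<in> frontier \<Omega>" using x F rel_interior_subset by (auto simp: boundary_faces_def)
  moreover have "open \<Omega>" using dom by (simp add: lipschitz_domain_def)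
  ultimately show False by (simp add: frontier_def interior_open)
qed

text \<open>Some relative interior point x of F lies in \<open>\<Omega>\<close>. Points just beyond
  F are covered by elements other than K, and their finite union is closed, so some such K' contains
  x. By conformity the intersection of K and K' is a proper face of K containing F, and the
  dimensions force it to equal F.\<close>

lemma interior_face_other_side:
  assumes F: "F \<in> interior_faces \<Omega> M" and K: "K \<in> M" "F facet_of K"
  obtains K' where "K' \<in> M" "K' \<noteq> K" "F facet_of K'"
proof -
  let ?n = "outward_normal K F"
  have op: "open \<Omega>" using dom by (simp add: lipschitz_domain_def)
  have "F \<in> mesh_faces M" "\<not> F \<subseteq> frontier \<Omega>" using F by (auto simp: interior_faces_def boundary_faces_def)
  then obtain x0 where "x0 \<in> F" "x0 \<notin> frontier \<Omega>" by blast
  moreover have "F \<subseteq> closure \<Omega>" using facet_of_imp_subset[OF K(2)] mesh_element(6)[OF K(1)] by blast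
  ultimately have x0: "x0 \<in> F" "x0 \<in> \<Omega>" using op by (auto simp: frontier_def interior_open)
  have "x0 \<in> closure (rel_interior F)"
    using x0(1) closure_subset convex_closure_rel_interior[OF mesh_facet_rel_interior(1)[OF K]] by blast
  then have "\<Omega> \<inter> rel_interior F \<noteq> {}" using open_Int_closure_eq_empty[OF op] x0(2) by blast
  then obtain x where x: "x \<in> \<Omega>" "x \<in> rel_interior F" by blast
  have n1: "norm ?n = 1"
    using facet_outward_normal_obtain[OF polytope_imp_polyhedron[OF mesh_element(1)[OF K(1)]] mesh_element(2)[OF K(1)] K(2)] by metis
  then have nn: "?n \<bullet> ?n = 1" by (simp add: norm_eq_1)
  obtain d where d: "d > 0" "\<And>y. y \<in> ball x d \<Longrightarrow> y \<in> K \<longleftrightarrow> ?n \<bullet> y \<le> ?n \<bullet> x"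
    using facet_local_halfspace[OF mesh_element(1,2)[OF K(1)] K(2) x(2)] by metis
  obtain d' where d': "d' > 0" "ball x d' \<subseteq> \<Omega>" using op x(1) open_contains_ball by blast
  let ?U = "\<Union>(M - {K})"
  have cl: "closed ?U" using mesh_finite mesh_element(4) by (intro closed_Union) auto
  have "x \<in> closure ?U"
    unfolding closure_approachable
  proof (intro allI impI)
    fix \<epsilon> :: real assume \<epsilon>: "\<epsilon> > 0"
    define r where "r = min \<epsilon> (min d d') / 2"
    have r: "r > 0" "r < \<epsilon>" "r < d" "r < d'" using \<epsilon> d(1) d'(1) by (auto simp: r_def)
    define y where "y = x + r *\<^sub>R ?n"
    have dy: "dist x y = r" using r n1 by (simp add: y_def dist_norm)
    have "y \<in> \<Omega>" using d'(2) r dy by auto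
    then have "y \<in> \<Union>M" using mesh closure_subset by (auto simp: simplicial_mesh_def)
    moreover have "y \<notin> K" using d(2)[of y] r dy by (simp add: y_def inner_add_right nn)
    ultimately have "y \<in> ?U" by blast
    then show "\<exists>y\<in>?U. dist y x < \<epsilon>" using dy r by (auto simp: dist_commute intro!: bexI[of _ y])
  qed
  then have "x \<in> ?U" using cl by simp
  then obtain K' where K': "K' \<in> M" "K' \<noteq> K" "x \<in> K'" by blast
  have xK: "x \<in> K" using x(2) rel_interior_subset facet_of_imp_subset[OF K(2)] by blast
  have face: "(K \<inter> K') face_of K" by (rule mesh_Int_face[OF K(1) K'(1)])
  have FK: "F \<subseteq> K \<inter> K'"
    using x xK K'(3) by (intro subset_of_face_of[OF face facet_of_imp_subset[OF K(2)]]) blast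
  have ne: "K \<inter> K' \<noteq> K" using mesh_subset_imp_eq[OF K(1) K'(1)] K'(2) by blast
  have "aff_dim (K \<inter> K') < aff_dim K" by (rule face_of_aff_dim_lt[OF mesh_element(3)[OF K(1)] face ne])
  moreover have Ff: "F face_of K \<inter> K'" using facet_of_imp_face_of[OF K(2)] FK by (rule face_of_subset) blast
  moreover have "aff_dim F = aff_dim K - 1" using K(2) by (simp add: facet_of_def)
  ultimately have "F = K \<inter> K'"
    using face_of_aff_dim_lt[OF face_of_imp_convex[OF face] Ff] by linarith
  then have "F face_of K'" using mesh_Int_face[OF K'(1) K(1)] by (simp add: Int_commute)
  moreover have "aff_dim K = aff_dim K'" using mesh_element(5) K(1) K'(1) by simp
  ultimately have "F facet_of K'" using K(2) by (simp add: facet_of_def)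
  then show ?thesis using that K' by blast
qed

lemma interior_face_neighbor:
  assumes F: "F \<in> interior_faces \<Omega> M" and K: "K \<in> M" "F facet_of K"
  shows "neighbor M K F \<in> M" "neighbor M K F \<noteq> K" "F facet_of neighbor M K F"
    "outward_normal (neighbor M K F) F = - outward_normal K F"
    "{K' \<in> M. F facet_of K'} = {K, neighbor M K F}" "neighbor M (neighbor M K F) F = K"
proof -
  obtain K' where K': "K' \<in> M" "K' \<noteq> K" "F facet_of K'" by (rule interior_face_other_side[OF assms])
  have "neighbor M K F = K'"
    unfolding neighbor_def
    by (rule the_equality) (use K' mesh_other_side_unique[OF K K'(1,3,2)] in blast)+
  moreover have "neighbor M K' F = K"
    unfolding neighbor_def
    by (rule the_equality) (use K K'(2) mesh_other_side_unique[OF K'(1,3) K] in blast)+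
  moreover have "{K' \<in> M. F facet_of K'} = {K, K'}" using K K' mesh_other_side_unique[OF K K'(1,3,2)] by blast
  moreover have "outward_normal K' F = - outward_normal K F" by (rule mesh_opposite_normal[OF K K'(1,3,2)])
  ultimately show "neighbor M K F \<in> M" "neighbor M K F \<noteq> K" "F facet_of neighbor M K F"
    "outward_normal (neighbor M K F) F = - outward_normal K F"
    "{K' \<in> M. F facet_of K'} = {K, neighbor M K F}" "neighbor M (neighbor M K F) F = K"
    using K' by simp_all
qed

lemma boundary_face_elements:
  assumes F: "F \<in> boundary_faces \<Omega> M" and K: "K \<in> M" "F facet_of K"
  shows "{K' \<in> M. F facet_of K'} = {K}"
  using boundary_face_element_unique[OF assms] K by blast

lemma minus_side_element:
  assumes "F \<in> mesh_faces M"
  shows "minus_side M F \<in> M" "F facet_of minus_side M F"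
  using someI_ex[of "\<lambda>K. K \<in> M \<and> F facet_of K"] assms
  by (auto simp: mesh_faces_def minus_side_def)

end


subsection \<open>Polynomial spaces\<close>

lemma finite_multi_indices: "finite {\<alpha> :: 'd::finite \<Rightarrow> nat. sum \<alpha> UNIV \<le> N}"
proof (rule finite_subset)
  show "{\<alpha> :: 'd \<Rightarrow> nat. sum \<alpha> UNIV \<le> N} \<subseteq> PiE UNIV (\<lambda>_. {..N})"
  proof
    fix \<alpha> :: "'d \<Rightarrow> nat" assume "\<alpha> \<in> {\<alpha>. sum \<alpha> UNIV \<le> N}"
    moreover have "\<alpha> i \<le> sum \<alpha> UNIV" for i by (rule member_le_sum) auto
    ultimately have "\<alpha> i \<le> N" for i using order_trans by blast
    then show "\<alpha> \<in> PiE UNIV (\<lambda>_. {..N})" by (simp add: PiE_iff)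
  qed
  show "finite (PiE (UNIV :: 'd set) (\<lambda>_. {..N}))" by (intro finite_PiE) auto
qed

abbreviation (input) monomial_fun :: "('d::finite \<Rightarrow> nat) \<Rightarrow> real^'d \<Rightarrow> real" where
  "monomial_fun \<alpha> x \<equiv> (\<Prod>i\<in>UNIV. (x $ i) ^ \<alpha> i)"

lemma poly_space_polynomial_function:
  fixes p :: "real^'d \<Rightarrow> 'b::euclidean_space"
  assumes "p \<in> poly_space N" shows "polynomial_function p"
proof -
  obtain c where c: "p = (\<lambda>x. \<Sum>\<alpha> | sum \<alpha> UNIV \<le> N. monomial_fun \<alpha> x *\<^sub>R c \<alpha>)"
    using assms by (auto simp: poly_space_def)
  have "real_polynomial_function (\<lambda>x::real^'d. x $ i)" for i
    unfolding real_polynomial_function_eq by (intro polynomial_function_bounded_linear bounded_linear_vec_nth)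
  then have "polynomial_function (\<lambda>x::real^'d. monomial_fun \<alpha> x)" for \<alpha>
    unfolding real_polynomial_function_eq[symmetric]
    by (intro real_polynomial_function_prod real_polynomial_function_power) auto
  then show ?thesis unfolding c
    by (intro polynomial_function_sum polynomial_function_mult polynomial_function_const finite_multi_indices)
qed

lemma poly_space_linear_image:
  fixes p :: "real^'d \<Rightarrow> 'b::euclidean_space"
  assumes "p \<in> poly_space N" and T: "linear T" shows "(\<lambda>x. T (p x)) \<in> poly_space N"
proof -
  obtain c where "\<forall>x. p x = (\<Sum>\<alpha> | sum \<alpha> UNIV \<le> N. monomial_fun \<alpha> x *\<^sub>R c \<alpha>)"
    using assms by (auto simp: poly_space_def)
  then have "T (p x) = (\<Sum>\<alpha> | sum \<alpha> UNIV \<le> N. monomial_fun \<alpha> x *\<^sub>R T (c \<alpha>))" for x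
    by (simp add: linear_sum[OF T] linear_cmul[OF T])
  then show ?thesis unfolding poly_space_def by (intro CollectI exI[of _ "\<lambda>\<alpha>. T (c \<alpha>)"] allI)
qed

lemma poly_space_add:
  assumes "p \<in> poly_space N" "q \<in> poly_space N" shows "(\<lambda>x. p x + q x) \<in> poly_space N"
proof -
  obtain c d where "\<forall>x. p x = (\<Sum>\<alpha> | sum \<alpha> UNIV \<le> N. monomial_fun \<alpha> x *\<^sub>R c \<alpha>)"
    "\<forall>x. q x = (\<Sum>\<alpha> | sum \<alpha> UNIV \<le> N. monomial_fun \<alpha> x *\<^sub>R d \<alpha>)"
    using assms by (auto simp: poly_space_def)
  then have "p x + q x = (\<Sum>\<alpha> | sum \<alpha> UNIV \<le> N. monomial_fun \<alpha> x *\<^sub>R (c \<alpha> + d \<alpha>))" for x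
    by (simp add: sum.distrib scaleR_add_right)
  then show ?thesis unfolding poly_space_def by (intro CollectI exI[of _ "\<lambda>\<alpha>. c \<alpha> + d \<alpha>"] allI)
qed

lemma poly_space_scaleR: "p \<in> poly_space N \<Longrightarrow> (\<lambda>x. a *\<^sub>R p x) \<in> poly_space N"
  by (rule poly_space_linear_image) (auto simp: linear_iff algebra_simps)

lemma poly_space_0: "(\<lambda>x. 0) \<in> poly_space N"
  by (auto simp: poly_space_def intro!: exI[of _ "\<lambda>_. 0"])

lemma poly_space_sum:
  "(\<And>j. j \<in> J \<Longrightarrow> p j \<in> poly_space N) \<Longrightarrow> (\<lambda>x. \<Sum>j\<in>J. p j x) \<in> poly_space N"
  by (induction J rule: infinite_finite_induct) (auto simp: poly_space_0 intro: poly_space_add)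

lemma poly_space_scalar_vec: "l \<in> poly_space N \<Longrightarrow> (\<lambda>x. l x *\<^sub>R w) \<in> poly_space N"
  by (rule poly_space_linear_image) (auto simp: linear_iff algebra_simps)

lemma poly_space_monomial:
  fixes \<alpha> :: "'d::finite \<Rightarrow> nat"
  assumes "sum \<alpha> UNIV \<le> N" shows "monomial_fun \<alpha> \<in> poly_space N"
proof -
  have "monomial_fun \<alpha> x = (\<Sum>\<beta> | sum \<beta> UNIV \<le> N. monomial_fun \<beta> x *\<^sub>R of_bool (\<beta> = \<alpha>))" for x
  proof -
    have "(\<Sum>\<beta> | sum \<beta> UNIV \<le> N. monomial_fun \<beta> x *\<^sub>R of_bool (\<beta> = \<alpha>)) =
        (\<Sum>\<beta> | sum \<beta> UNIV \<le> N. if \<beta> = \<alpha> then monomial_fun \<alpha> x else 0)"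
      by (intro sum.cong) auto
    also have "\<dots> = monomial_fun \<alpha> x"
      using assms by (subst sum.delta[OF finite_multi_indices]) simp
    finally show ?thesis by simp
  qed
  then show ?thesis unfolding poly_space_def by (intro CollectI exI allI)
qed

section \<open>Unisolvence, nodal bases and positive definite systems\<close>

text \<open>Restricted to the line from a point z of S to x, each component is a univariate
  polynomial with infinitely many zeros, hence zero; x is reached at parameter 1.\<close>

lemma polynomial_function_zero_on_open:
  fixes p :: "'a::euclidean_space \<Rightarrow> 'b::euclidean_space"
  assumes p: "polynomial_function p" and S: "open S" "S \<noteq> {}" and zero: "\<And>x. x \<in> S \<Longrightarrow> p x = 0"
  shows "p x = 0"
proof (rule euclidean_eqI)
  fix b :: 'b assume "b \<in> Basis"
  obtain z where "z \<in> S" using S(2) by blast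
  then obtain d where d: "d > 0" "ball z d \<subseteq> S" using S(1) open_contains_ball by blast
  define f where "f = (\<lambda>t::real. p (z + t *\<^sub>R (x - z)) \<bullet> b)"
  have "polynomial_function (\<lambda>t::real. z + t *\<^sub>R (x - z))" by (intro polynomial_function_add polynomial_function_mult) auto
  from polynomial_function_compose[OF this p] have "polynomial_function (\<lambda>t. p (z + t *\<^sub>R (x - z)))" by (simp add: o_def)
  then have "real_polynomial_function f" unfolding f_def real_polynomial_function_eq by (rule polynomial_function_inner)
  then obtain a n where f: "f = (\<lambda>t. \<Sum>i\<le>n. a i * t ^ i)" using real_polynomial_function_iff_sum by blast
  \<comment> \<open>For 0 < t < r the point stays in the ball about z; the added 1 avoids a division
    by zero when x = z.\<close>
  define r where "r = d / (norm (x - z) + 1)"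
  have r: "r > 0" using d(1) by (simp add: r_def add_nonneg_pos)
  have f0: "f t = 0" if "t \<in> {0<..<r}" for t
  proof -
    have "t * norm (x - z) \<le> t * (norm (x - z) + 1)" using that by (intro mult_left_mono) auto
    also have "\<dots> < r * (norm (x - z) + 1)" using that by (intro mult_strict_right_mono) (auto simp: add_nonneg_pos)
    also have "\<dots> = d" by (simp add: r_def add_nonneg_eq_0_iff)
    finally have "z + t *\<^sub>R (x - z) \<in> ball z d" using that by (simp add: dist_norm)
    then show ?thesis using d(2) zero by (auto simp: f_def)
  qed
  have "infinite {0<..<r}" using r by simp
  then have inf: "infinite {t. (\<Sum>i\<le>n. a i * t ^ i) = 0}"
    using f0 unfolding f by (metis (mono_tags, lifting) finite_subset mem_Collect_eq subsetI)
  have "\<forall>i\<le>n. a i = 0"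
  proof (rule ccontr)
    assume "\<not> ?thesis"
    then obtain i where "i \<le> n" "a i \<noteq> 0" by blast
    then show False using Transcendental.polyfun_finite_roots[of a n] inf by blast
  qed
  then have "f 1 = 0" by (simp add: f)
  then show "p x \<bullet> b = 0 \<bullet> b" by (simp add: f_def)
qed

text \<open>Induction on the generators. The residual r of b after interpolation at J vanishes on J.
  If it vanishes on S, it is zero and nothing is added; otherwise a point w of S with r w \<noteq> 0
  becomes a new node.\<close>

lemma exists_lagrange_basis:
  fixes V :: "('a \<Rightarrow> real) set"
  assumes V: "\<And>f g. f \<in> V \<Longrightarrow> g \<in> V \<Longrightarrow> (\<lambda>x. f x + g x) \<in> V" "\<And>f a. f \<in> V \<Longrightarrow> (\<lambda>x. a * f x) \<in> V"
    "(\<lambda>x. 0) \<in> V"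
    and det: "\<And>f x. f \<in> V \<Longrightarrow> (\<And>y. y \<in> S \<Longrightarrow> f y = 0) \<Longrightarrow> f x = 0"
    and "finite B" "B \<subseteq> V"
  shows "\<exists>J l. finite J \<and> J \<subseteq> S \<and> (\<forall>y\<in>J. l y \<in> V) \<and> (\<forall>y\<in>J. \<forall>z\<in>J. l y z = of_bool (y = z)) \<and>
     (\<forall>b\<in>B. \<forall>x. b x = (\<Sum>y\<in>J. b y * l y x))"
  using assms(5,6)
proof (induction B rule: finite_induct)
  case empty
  then show ?case by (intro exI[of _ "{}"]) auto
next
  case (insert b B)
  then have "\<exists>J l. finite J \<and> J \<subseteq> S \<and> (\<forall>y\<in>J. l y \<in> V) \<and> (\<forall>y\<in>J. \<forall>z\<in>J. l y z = of_bool (y = z)) \<and>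
     (\<forall>b\<in>B. \<forall>x. b x = (\<Sum>y\<in>J. b y * l y x))" by simp
  then obtain J l where J0: "finite J" "J \<subseteq> S" "\<forall>y\<in>J. l y \<in> V" "\<forall>y\<in>J. \<forall>z\<in>J. l y z = of_bool (y = z)"
    "\<forall>b\<in>B. \<forall>x. b x = (\<Sum>y\<in>J. b y * l y x)" by (elim exE conjE)
  note J = J0(1,2) J0(3)[rule_format] J0(4)[rule_format] J0(5)[rule_format]
  have Vsum: "(\<lambda>x. \<Sum>y\<in>J. f y x) \<in> V" if "\<And>y. y \<in> J \<Longrightarrow> f y \<in> V" for f
    using J(1) that by (induction J rule: finite_induct) (auto intro: V)
  have Vdiff: "(\<lambda>x. f x - g x) \<in> V" if "f \<in> V" "g \<in> V" for f g
    using V(1)[OF that(1) V(2)[OF that(2), of "-1"]] by simp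
  define r where "r x = b x - (\<Sum>y\<in>J. b y * l y x)" for x
  have rV: "r \<in> V" unfolding r_def[abs_def] using insert.prems by (intro Vdiff Vsum V J) auto
  show ?case
  proof (cases "\<forall>y\<in>S. r y = 0")
    case True
    then have r0: "r x = 0" for x using det[OF rV] by blast
    have "b x = (\<Sum>y\<in>J. b y * l y x)" for x
      using r0[of x] unfolding r_def by (rule iffD2[OF eq_iff_diff_eq_0])
    then have "\<forall>p\<in>insert b B. \<forall>x. p x = (\<Sum>y\<in>J. p y * l y x)" using J0(5) by blast
    then show ?thesis using J0(1-4) by blast
  next
    case False
    then obtain w where w: "w \<in> S" "r w \<noteq> 0" by blast
    have rJ: "r z = 0" if "z \<in> J" for z
    proof -
      have "(\<Sum>y\<in>J. b y * l y z) = (\<Sum>y\<in>J. if y = z then b y else 0)"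
        using that by (intro sum.cong) (auto simp: J(4))
      then show ?thesis using that J(1) by (simp add: r_def)
    qed
    then have wJ: "w \<notin> J" using w by auto
    \<comment> \<open>r / r w is the cardinal function of the new node, as r vanishes at the old
      ones; subtracting multiples of it makes the old cardinal functions vanish at w without
      changing them on J.\<close>
    define l' where "l' y x = (if y = w then r x / r w else l y x - l y w * (r x / r w))" for y x
    have l'w: "l' w = (\<lambda>x. r x / r w)" by (rule ext) (simp add: l'_def)
    have l'J: "l' y = (\<lambda>x. l y x - l y w * (r x / r w))" if "y \<in> J" for y
      using that wJ by (intro ext) (auto simp: l'_def)
    have rwV: "(\<lambda>x. r x / r w) \<in> V" using V(2)[OF rV, of "1 / r w"] by simp
    have sum': "(\<Sum>y\<in>insert w J. p y * l' y x) = p w * (r x / r w) + (\<Sum>y\<in>J. p y * l y x) - (\<Sum>y\<in>J. p y * l y w) * (r x / r w)" for p x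
    proof -
      have "(\<Sum>y\<in>insert w J. p y * l' y x) = p w * (r x / r w) + (\<Sum>y\<in>J. p y * (l y x - l y w * (r x / r w)))"
        using J(1) wJ by (simp add: l'w l'J)
      also have "(\<Sum>y\<in>J. p y * (l y x - l y w * (r x / r w))) =
          (\<Sum>y\<in>J. p y * l y x) - (\<Sum>y\<in>J. p y * l y w) * (r x / r w)"
        by (simp add: right_diff_distrib sum_subtractf sum_distrib_right sum_divide_distrib mult.assoc)
      finally show ?thesis by simp
    qed
    show ?thesis
    proof (intro exI[of _ "insert w J"] exI[of _ l'] conjI ballI allI)
      show "finite (insert w J)" "insert w J \<subseteq> S" using J w by auto
      fix y assume y: "y \<in> insert w J"
      show "l' y \<in> V"
      proof (cases "y = w")
        case False
        then have "y \<in> J" using y by simp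
        then show ?thesis using Vdiff[OF J(3) V(2)[OF rwV]] by (simp add: l'J)
      qed (simp add: l'w rwV)
      fix z assume z: "z \<in> insert w J"
      show "l' y z = of_bool (y = z)"
        using y z w wJ by (auto simp: l'w l'J rJ J(4))
    next
      fix p x assume "p \<in> insert b B"
      then consider "p = b" | "p \<in> B" by blast
      then show "p x = (\<Sum>y\<in>insert w J. p y * l' y x)"
      proof cases
        case 1
        have *: "(\<Sum>y\<in>J. b y * l y x) = b x - r x" "(\<Sum>y\<in>J. b y * l y w) = b w - r w" by (simp_all add: r_def)
        then show ?thesis unfolding sum' 1 * using w(2) by (simp add: field_simps)
      next
        case 2
        then show ?thesis unfolding sum' J(5)[OF 2, symmetric] by simp
      qed
    qed
  qed
qed

text \<open>The nodes are placed in S so that a polynomial can be recovered from its values on an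
  element. The cardinal functions are scalar and serve vector-valued polynomials as well.\<close>

lemma poly_space_lagrange_basis:
  fixes S :: "(real^'d) set"
  assumes S: "interior S \<noteq> {}"
  shows "\<exists>J l. finite J \<and> J \<subseteq> S \<and> (\<forall>y\<in>J. l y \<in> poly_space N) \<and>
    (\<forall>y\<in>J. \<forall>z\<in>J. l y z = of_bool (y = z)) \<and>
    (\<forall>p :: real^'d \<Rightarrow> 'b::euclidean_space. p \<in> poly_space N \<longrightarrow> (\<forall>x. p x = (\<Sum>y\<in>J. l y x *\<^sub>R p y)))"
proof -
  let ?V = "poly_space N :: (real^'d \<Rightarrow> real) set"
  let ?B = "monomial_fun ` {\<alpha> :: 'd \<Rightarrow> nat. sum \<alpha> UNIV \<le> N}"
  have "\<exists>J l. finite J \<and> J \<subseteq> S \<and> (\<forall>y\<in>J. l y \<in> ?V) \<and> (\<forall>y\<in>J. \<forall>z\<in>J. l y z = of_bool (y = z)) \<and>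
     (\<forall>b\<in>?B. \<forall>x. b x = (\<Sum>y\<in>J. b y * l y x))"
  proof (rule exists_lagrange_basis)
    show "f x = 0" if "f \<in> ?V" "\<And>y. y \<in> S \<Longrightarrow> f y = 0" for f x
      using polynomial_function_zero_on_open[OF poly_space_polynomial_function[OF that(1)] open_interior S] that(2) interior_subset
      by blast
    show "(\<lambda>x. a * f x) \<in> ?V" if "f \<in> ?V" for f a using poly_space_scaleR[OF that, of a] by simp
    show "finite ?B" by (rule finite_imageI[OF finite_multi_indices])
    show "?B \<subseteq> ?V" using poly_space_monomial by blast
  qed (auto intro: poly_space_add poly_space_0)
  then obtain J l where J0: "finite J" "J \<subseteq> S" "\<forall>y\<in>J. l y \<in> ?V" "\<forall>y\<in>J. \<forall>z\<in>J. l y z = of_bool (y = z)"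
    "\<forall>b\<in>?B. \<forall>x. b x = (\<Sum>y\<in>J. b y * l y x)" by (elim exE conjE)
  note J = J0(1,2) J0(3)[rule_format] J0(4)[rule_format] J0(5)[rule_format]
  have rep: "p x = (\<Sum>y\<in>J. l y x *\<^sub>R p y)" if p: "p \<in> poly_space N" for p :: "real^'d \<Rightarrow> 'b" and x
  proof -
    obtain c where c: "\<And>x. p x = (\<Sum>\<alpha> | sum \<alpha> UNIV \<le> N. monomial_fun \<alpha> x *\<^sub>R c \<alpha>)"
      using p by (auto simp: poly_space_def)
    have "p x = (\<Sum>\<alpha> | sum \<alpha> UNIV \<le> N. (\<Sum>y\<in>J. monomial_fun \<alpha> y * l y x) *\<^sub>R c \<alpha>)"
      unfolding c[of x] by (intro sum.cong refl arg_cong2[where f=scaleR] J(5)) auto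
    also have "\<dots> = (\<Sum>y\<in>J. \<Sum>\<alpha> | sum \<alpha> UNIV \<le> N. (monomial_fun \<alpha> y * l y x) *\<^sub>R c \<alpha>)"
      unfolding scaleR_sum_left by (rule sum.swap)
    also have "\<dots> = (\<Sum>y\<in>J. l y x *\<^sub>R p y)"
      unfolding c scaleR_sum_right by (intro sum.cong refl) (simp add: mult.commute)
    finally show ?thesis .
  qed
  then show ?thesis using J0(1-4) by blast
qed

text \<open>Elimination of one unknown at a time: the Schur complement \<open>G'\<close> is again
  positive definite, because its quadratic form at c is that of G at a suitable extension of c to
  k.\<close>

lemma positive_definite_system_solvable:
  fixes G :: "'i \<Rightarrow> 'i \<Rightarrow> real"
  assumes "finite S" "\<And>c. \<exists>i\<in>S. c i \<noteq> 0 \<Longrightarrow> (\<Sum>i\<in>S. \<Sum>j\<in>S. c i * c j * G i j) > 0"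
  shows "\<exists>c. \<forall>j\<in>S. (\<Sum>i\<in>S. c i * G i j) = r j"
  using assms
proof (induction S arbitrary: G r rule: finite_induct)
  case (insert k S)
  have split: "(\<Sum>i\<in>insert k S. \<Sum>j\<in>insert k S. c i * c j * G i j) =
      (\<Sum>i\<in>S. \<Sum>j\<in>S. c i * c j * G i j) + c k * (\<Sum>j\<in>S. c j * G k j) + c k * (\<Sum>i\<in>S. c i * G i k) + c k * c k * G k k" for c
    using insert.hyps by (simp add: sum.distrib sum_distrib_left algebra_simps)
  have pos: "G k k > 0"
  proof -
    define d where "d i = (of_bool (i = k) :: real)" for i
    have d: "d k = 1" "\<And>i. i \<in> S \<Longrightarrow> d i = 0" using insert.hyps(2) by (auto simp: d_def)
    have "(\<Sum>i\<in>insert k S. \<Sum>j\<in>insert k S. d i * d j * G i j) > 0"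
      by (rule insert.prems) (use d in auto)
    then show ?thesis unfolding split using d by (simp cong: sum.cong)
  qed
  define G' where "G' i j = G i j - G i k * G k j / G k k" for i j
  have "\<exists>c. \<forall>j\<in>S. (\<Sum>i\<in>S. c i * G' i j) = r j - r k * G k j / G k k"
  proof (rule insert.IH)
    fix c :: "'i \<Rightarrow> real" assume c: "\<exists>i\<in>S. c i \<noteq> 0"
    define a where "a = (\<Sum>i\<in>S. c i * G i k)"
    define b where "b = (\<Sum>j\<in>S. c j * G k j)"
    \<comment> \<open>With this value at k the terms d k a + (d k)^2 G k k cancel, and d k b
      supplies the Schur correction -a b / G k k.\<close>
    define d where "d = c(k := - a / G k k)"
    have dS: "d i = c i" if "i \<in> S" for i using that insert.hyps(2) by (auto simp: d_def)
    have "(\<Sum>i\<in>insert k S. \<Sum>j\<in>insert k S. d i * d j * G i j) > 0"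
      using c dS by (intro insert.prems) auto
    also have "(\<Sum>i\<in>insert k S. \<Sum>j\<in>insert k S. d i * d j * G i j) =
        (\<Sum>i\<in>S. \<Sum>j\<in>S. c i * c j * G i j) + d k * b + d k * a + d k * d k * G k k"
      unfolding split a_def b_def using dS by (simp cong: sum.cong)
    also have "\<dots> = (\<Sum>i\<in>S. \<Sum>j\<in>S. c i * c j * G i j) - a * b / G k k"
      using pos by (simp add: d_def field_simps)
    also have "a * b / G k k = (\<Sum>i\<in>S. \<Sum>j\<in>S. c i * c j * (G i k * G k j / G k k))"
      unfolding a_def b_def sum_product sum_divide_distrib by (intro sum.cong refl) simp
    finally show "(\<Sum>i\<in>S. \<Sum>j\<in>S. c i * c j * G' i j) > 0"
      by (simp add: G'_def right_diff_distrib sum_subtractf)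
  qed
  then obtain c where c: "\<And>j. j \<in> S \<Longrightarrow> (\<Sum>i\<in>S. c i * G' i j) = r j - r k * G k j / G k k" by blast
  define a where "a = (\<Sum>i\<in>S. c i * G i k)"
  \<comment> \<open>Back substitution: this is the value solving equation k once the other unknowns
    are fixed.\<close>
  define d where "d = c(k := (r k - a) / G k k)"
  have dS: "d i = c i" if "i \<in> S" for i using that insert.hyps(2) by (auto simp: d_def)
  have dsum: "(\<Sum>i\<in>insert k S. d i * G i j) = (r k - a) / G k k * G k j + (\<Sum>i\<in>S. c i * G i j)" for j
    using insert.hyps dS by (simp add: d_def[THEN fun_cong, of k] cong: sum.cong)
  show ?case
  proof (intro exI[of _ d] ballI)
    fix j assume "j \<in> insert k S"
    then consider "j = k" | "j \<in> S" by blast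
    then show "(\<Sum>i\<in>insert k S. d i * G i j) = r j"
    proof cases
      case 1
      then show ?thesis unfolding dsum using pos by (simp add: a_def)
    next
      case 2
      have "(\<Sum>i\<in>S. c i * G i j) = (\<Sum>i\<in>S. c i * G' i j) + (\<Sum>i\<in>S. c i * G i k) * G k j / G k k"
        unfolding sum_distrib_right sum_divide_distrib sum.distrib[symmetric]
        by (intro sum.cong refl) (simp add: G'_def algebra_simps)
      then show ?thesis unfolding dsum c[OF 2] a_def[symmetric] using pos by (simp add: field_simps)
    qed
  qed
qed simp


subsection \<open>Weight-adjusted operators and the energy\<close>

lemma poly_space_continuous: "p \<in> poly_space N \<Longrightarrow> continuous_on S p"
  by (rule continuous_on_polymonial_function) (rule poly_space_polynomial_function)

text \<open>An index is a node together with a coordinate vector, and the coefficient functional is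
  evaluation at the node followed by that coordinate. The last clause says that these functionals
  recover arbitrary coefficients, which is linear independence.\<close>

lemma poly_space_basis:
  fixes K :: "(real^'d) set"
  assumes "interior K \<noteq> {}"
  shows "\<exists>S e. finite S \<and> S \<subseteq> K \<times> (Basis :: 'b::euclidean_space set) \<and> (\<forall>i\<in>S. e i \<in> poly_space N) \<and>
    (\<forall>p\<in>poly_space N. \<forall>x. p x = (\<Sum>i\<in>S. (p (fst i) \<bullet> snd i) *\<^sub>R e i x)) \<and>
    (\<forall>c. \<forall>i\<in>S. (\<Sum>j\<in>S. c j *\<^sub>R e j (fst i)) \<bullet> snd i = c i)"
proof -
  obtain J l where J0: "finite J" "J \<subseteq> K" "\<forall>y\<in>J. l y \<in> poly_space N"
    "\<forall>y\<in>J. \<forall>z\<in>J. l y z = of_bool (y = z)"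
    "\<forall>p :: real^'d \<Rightarrow> 'b. p \<in> poly_space N \<longrightarrow> (\<forall>x. p x = (\<Sum>y\<in>J. l y x *\<^sub>R p y))"
    using poly_space_lagrange_basis[OF assms, where N = N and 'b = 'b] by (elim exE conjE)
  note J = J0(1,2) J0(3)[rule_format] J0(4)[rule_format] J0(5)[rule_format]
  define S where "S = J \<times> (Basis :: 'b set)"
  define e where "e i x = l (fst i) x *\<^sub>R snd i" for i :: "(real^'d) \<times> 'b" and x
  have 1: "finite S" "S \<subseteq> K \<times> Basis" using J(1,2) by (auto simp: S_def)
  have 2: "e i \<in> poly_space N" if "i \<in> S" for i
    unfolding e_def[abs_def] using that by (intro poly_space_scalar_vec J(3)) (auto simp: S_def)
  have 3: "p x = (\<Sum>i\<in>S. (p (fst i) \<bullet> snd i) *\<^sub>R e i x)" if p: "p \<in> poly_space N" for p :: "real^'d \<Rightarrow> 'b" and x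
  proof -
    have "(\<Sum>i\<in>S. (p (fst i) \<bullet> snd i) *\<^sub>R e i x) = (\<Sum>y\<in>J. \<Sum>b\<in>Basis. l y x *\<^sub>R ((p y \<bullet> b) *\<^sub>R b))"
      unfolding S_def sum.cartesian_product by (intro sum.cong refl) (auto simp: e_def mult.commute)
    also have "\<dots> = (\<Sum>y\<in>J. l y x *\<^sub>R p y)"
      by (simp add: scaleR_sum_right[symmetric] euclidean_representation del: scaleR_scaleR)
    finally show ?thesis by (rule trans[OF J(5)[OF p] sym])
  qed
  have 4: "(\<Sum>j\<in>S. c j *\<^sub>R e j (fst i)) \<bullet> snd i = c i" if i: "i \<in> S" for c i
  proof -
    have "(c j *\<^sub>R e j (fst i)) \<bullet> snd i = (if j = i then c i else 0)" if "j \<in> S" for j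
      using i that J(4)[of "fst j" "fst i"] by (cases i; cases j) (auto simp: S_def e_def inner_Basis)
    then show ?thesis using i 1(1) by (simp add: inner_sum_left cong: sum.cong)
  qed
  show ?thesis by (intro exI[of _ S] exI[of _ e] conjI ballI allI 1 2 3 4)
qed

text \<open>Additivity is asked for only on polynomials, where the weighted integrals are known to
  exist.\<close>

lemma poly_functional_sum:
  assumes add: "\<And>p q. p \<in> poly_space N \<Longrightarrow> q \<in> poly_space N \<Longrightarrow> \<Phi> (\<lambda>x. p x + q x) = \<Phi> p + \<Phi> q"
    and scale: "\<And>a p. p \<in> poly_space N \<Longrightarrow> \<Phi> (\<lambda>x. a *\<^sub>R p x) = a * (\<Phi> p :: real)"
    and u: "\<And>j. j \<in> J \<Longrightarrow> u j \<in> poly_space N"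
  shows "\<Phi> (\<lambda>x. \<Sum>j\<in>J. a j *\<^sub>R u j x) = (\<Sum>j\<in>J. a j * \<Phi> (u j))"
proof -
  have 0: "\<Phi> (\<lambda>x. 0) = 0" using scale[OF poly_space_0, of 0] by simp
  show ?thesis using u
  proof (induction J rule: infinite_finite_induct)
    case (insert k J)
    then have "\<Phi> (\<lambda>x. a k *\<^sub>R u k x + (\<Sum>j\<in>J. a j *\<^sub>R u j x)) = \<Phi> (\<lambda>x. a k *\<^sub>R u k x) + \<Phi> (\<lambda>x. \<Sum>j\<in>J. a j *\<^sub>R u j x)"
      by (intro add poly_space_scaleR poly_space_sum) auto
    then show ?case using insert by (simp add: scale)
  qed (simp_all add: 0)
qed

text \<open>Only the values on \<open>K\<close> are assumed differentiable in time; unisolvence of \<open>K\<close> makes every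
  coefficient, and hence the value at any point, differentiable.\<close>

lemma quadratic_form_time_derivative:
  fixes u :: "real \<Rightarrow> real^'d \<Rightarrow> 'b::euclidean_space" and E :: "(real^'d \<Rightarrow> 'b) \<Rightarrow> (real^'d \<Rightarrow> 'b) \<Rightarrow> real"
  assumes K: "interior K \<noteq> {}" and I: "at t within I \<noteq> bot" "t \<in> I"
    and u: "\<And>s. s \<in> I \<Longrightarrow> u s \<in> poly_space N"
    and diff: "\<And>x. x \<in> K \<Longrightarrow> (\<lambda>s. u s x) differentiable (at t within I)"
    and sym: "\<And>p q. p \<in> poly_space N \<Longrightarrow> q \<in> poly_space N \<Longrightarrow> E p q = E q p"
    and add: "\<And>p q r. p \<in> poly_space N \<Longrightarrow> q \<in> poly_space N \<Longrightarrow> r \<in> poly_space N \<Longrightarrow> E (\<lambda>x. p x + q x) r = E p r + E q r"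
    and scale: "\<And>a p r. p \<in> poly_space N \<Longrightarrow> r \<in> poly_space N \<Longrightarrow> E (\<lambda>x. a *\<^sub>R p x) r = a * E p r"
  defines "du \<equiv> \<lambda>x. vector_derivative (\<lambda>s. u s x) (at t within I)"
  shows "du \<in> poly_space N"
    and "((\<lambda>s. E (u s) (u s)) has_vector_derivative 2 * E du (u t)) (at t within I)"
proof -
  obtain S e where S0: "finite S" "S \<subseteq> K \<times> (Basis :: 'b set)" "\<forall>i\<in>S. e i \<in> poly_space N"
    "\<forall>p\<in>poly_space N. \<forall>x. p x = (\<Sum>i\<in>S. (p (fst i) \<bullet> snd i) *\<^sub>R e i x)"
    "\<forall>c. \<forall>i\<in>S. (\<Sum>j\<in>S. c j *\<^sub>R e j (fst i)) \<bullet> snd i = c i"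
    using poly_space_basis[OF K, where N = N and 'b = 'b] by (elim exE conjE)
  note S = S0(1,2) S0(3)[rule_format] S0(4)[rule_format] S0(5)[rule_format]
  define a where "a i s = u s (fst i) \<bullet> snd i" for i s
  define a' where "a' i = vector_derivative (\<lambda>s. u s (fst i)) (at t within I) \<bullet> snd i" for i
  have a: "((\<lambda>s. a i s) has_vector_derivative a' i) (at t within I)" if "i \<in> S" for i
  proof -
    have "((\<lambda>s. u s (fst i)) has_vector_derivative vector_derivative (\<lambda>s. u s (fst i)) (at t within I)) (at t within I)"
      using diff[of "fst i"] that S(2) by (subst vector_derivative_works[symmetric]) auto
    then show ?thesis unfolding a_def a'_def
      by (rule bounded_linear.has_vector_derivative[OF bounded_linear_inner_left])
  qed
  have rep: "u s x = (\<Sum>i\<in>S. a i s *\<^sub>R e i x)" if "s \<in> I" for s x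
    unfolding a_def by (rule S(4)[OF u[OF that]])
  have repf: "u s = (\<lambda>x. \<Sum>i\<in>S. a i s *\<^sub>R e i x)" if "s \<in> I" for s
    using rep[OF that] by (rule ext)
  have der_u: "((\<lambda>s. u s x) has_vector_derivative (\<Sum>i\<in>S. a' i *\<^sub>R e i x)) (at t within I)" for x
  proof -
    have "((\<lambda>s. a i s *\<^sub>R e i x) has_vector_derivative (a' i *\<^sub>R e i x)) (at t within I)" if "i \<in> S" for i
      using bounded_linear.has_vector_derivative[OF bounded_linear_scaleR_left a[OF that]] .
    then have "((\<lambda>s. \<Sum>i\<in>S. a i s *\<^sub>R e i x) has_vector_derivative (\<Sum>i\<in>S. a' i *\<^sub>R e i x)) (at t within I)"
      by (intro has_vector_derivative_sum)
    then show ?thesis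
      by (rule has_vector_derivative_transform[OF I(2), rotated]) (rule rep)
  qed
  have du: "du x = (\<Sum>i\<in>S. a' i *\<^sub>R e i x)" for x
    unfolding du_def by (rule vector_derivative_within[OF I(1) der_u])
  then have duf: "du = (\<lambda>x. \<Sum>i\<in>S. a' i *\<^sub>R e i x)" by (rule ext)
  show "du \<in> poly_space N" unfolding duf by (intro poly_space_sum poly_space_scaleR S(3))
  have ps: "(\<lambda>x. \<Sum>i\<in>S. c i *\<^sub>R e i x) \<in> poly_space N" for c
    by (intro poly_space_sum poly_space_scaleR S(3))
  have E1: "E (\<lambda>x. \<Sum>i\<in>S. c i *\<^sub>R e i x) r = (\<Sum>i\<in>S. c i * E (e i) r)" if "r \<in> poly_space N" for c r
    by (rule poly_functional_sum[where \<Phi> = "\<lambda>p. E p r"]) (use that add scale S(3) in auto)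
  \<comment> \<open>Linearity is given in the left argument only; symmetry transfers it to the right
    one and accounts for the order of the indices in \<open>E (e j) (e i)\<close>.\<close>
  have E2: "E (\<lambda>x. \<Sum>i\<in>S. c i *\<^sub>R e i x) (\<lambda>x. \<Sum>i\<in>S. d i *\<^sub>R e i x) = (\<Sum>i\<in>S. \<Sum>j\<in>S. c i * d j * E (e j) (e i))" for c d
  proof -
    have "E (e i) (\<lambda>x. \<Sum>i\<in>S. d i *\<^sub>R e i x) = (\<Sum>j\<in>S. d j * E (e j) (e i))" if "i \<in> S" for i
      using sym[OF S(3)[OF that] ps] E1[OF S(3)[OF that]] by simp
    then show ?thesis unfolding E1[OF ps] by (simp add: sum_distrib_left mult.assoc cong: sum.cong)
  qed
  have "((\<lambda>s. \<Sum>i\<in>S. \<Sum>j\<in>S. a i s * a j s * E (e j) (e i)) has_vector_derivative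
      (\<Sum>i\<in>S. \<Sum>j\<in>S. (a i t * a' j + a' i * a j t) * E (e j) (e i))) (at t within I)"
    by (intro has_vector_derivative_sum bounded_linear.has_vector_derivative[OF bounded_linear_mult_left]
        has_vector_derivative_mult a)
  also have "(\<Sum>i\<in>S. \<Sum>j\<in>S. (a i t * a' j + a' i * a j t) * E (e j) (e i)) = E (u t) du + E du (u t)"
    unfolding repf[OF I(2)] duf E2 by (simp add: sum.distrib distrib_right)
  also have "\<dots> = 2 * E du (u t)"
    using sym[OF u[OF I(2)] \<open>du \<in> poly_space N\<close>] by simp
  finally have "((\<lambda>s. \<Sum>i\<in>S. \<Sum>j\<in>S. a i s * a j s * E (e j) (e i)) has_vector_derivative 2 * E du (u t)) (at t within I)" .
  then show "((\<lambda>s. E (u s) (u s)) has_vector_derivative 2 * E du (u t)) (at t within I)"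
    by (rule has_vector_derivative_transform[OF I(2), rotated]) (simp add: repf E2)
qed

lemma L2_inner_commute: "L2_inner K f g = L2_inner K g f"
  by (simp add: L2_inner_def inner_commute)

lemma L2_inner_add_left:
  assumes "set_integrable lebesgue K (\<lambda>x. f x \<bullet> h x)" "set_integrable lebesgue K (\<lambda>x. g x \<bullet> h x)"
  shows "L2_inner K (\<lambda>x. f x + g x) h = L2_inner K f h + L2_inner K g h"
  unfolding L2_inner_def inner_add_left by (rule set_integral_add(2)[OF assms])

lemma L2_inner_scaleR_left: "L2_inner K (\<lambda>x. a *\<^sub>R f x) g = a * L2_inner K f g"
  unfolding L2_inner_def inner_scaleR_left by simp

text \<open>Coefficients are measurable and bounded only on \<open>\<Omega>\<close>; the part of a
  closed element outside it is a null set and does not affect integrability.\<close>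

lemma set_integrable_bounded_measurable:
  fixes g :: "'a::euclidean_space \<Rightarrow> real"
  assumes K: "compact K" and \<Omega>: "open \<Omega>" and neg: "negligible (K - \<Omega>)"
    and g: "g \<in> borel_measurable (lebesgue_on \<Omega>)" and bd: "\<And>x. x \<in> K \<inter> \<Omega> \<Longrightarrow> \<bar>g x\<bar> \<le> B"
  shows "set_integrable lebesgue K g"
proof (rule absolutely_integrable_spike_set)
  have [measurable]: "K \<in> sets lebesgue" "\<Omega> \<in> sets lebesgue" using K \<Omega> by (auto intro: lmeasurable_compact fmeasurableD)
  show "negligible {x \<in> K \<inter> \<Omega> - K. g x \<noteq> 0}" by (rule negligible_subset[OF negligible_empty]) auto
  show "negligible {x \<in> K - K \<inter> \<Omega>. g x \<noteq> 0}" by (rule negligible_subset[OF neg]) auto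
  have "(\<lambda>x. indicator \<Omega> x *\<^sub>R g x) \<in> borel_measurable lebesgue"
    using g by (rule iffD1[OF borel_measurable_restrict_space_iff, rotated]) auto
  then have m: "(\<lambda>x. indicator K x *\<^sub>R (indicator \<Omega> x *\<^sub>R g x)) \<in> borel_measurable lebesgue"
    by (rule borel_measurable_scaleR[rotated]) auto
  show "set_integrable lebesgue (K \<inter> \<Omega>) g"
    unfolding set_integrable_def
  proof (rule Bochner_Integration.integrable_bound[where f = "\<lambda>x. B * indicator K x"])
    show "integrable lebesgue (\<lambda>x. B * indicator K x)"
      using lmeasurable_compact[OF K] by (intro integrable_mult_right integrable_real_indicator) (auto simp: fmeasurable_def)
    show "(\<lambda>x. indicator (K \<inter> \<Omega>) x *\<^sub>R g x) \<in> borel_measurable lebesgue"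
      using m by (simp add: indicator_inter_arith mult.assoc)
    have "norm (indicator (K \<inter> \<Omega>) x *\<^sub>R g x) \<le> norm (B * indicator K x)" for x
      using bd[of x] by (auto simp: indicator_def)
    then show "AE x in lebesgue. norm (indicator (K \<inter> \<Omega>) x *\<^sub>R g x) \<le> norm (B * indicator K x)" by simp
  qed
qed

lemma set_integrable_continuous_compact:
  fixes g :: "'a::euclidean_space \<Rightarrow> real"
  assumes K: "compact K" and g: "continuous_on UNIV g"
  shows "set_integrable lebesgue K g"
proof -
  have "compact (g ` K)" using compact_continuous_image[OF continuous_on_subset[OF g] K] by simp
  then have "bounded (g ` K)" by (rule compact_imp_bounded)
  then obtain B where B: "\<And>x. x \<in> K \<Longrightarrow> norm (g x) \<le> B" unfolding bounded_iff by blast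
  show ?thesis
    by (rule set_integrable_bounded_measurable[OF K, of UNIV _ B])
       (use B continuous_imp_measurable_on_sets_lebesgue[OF g] in auto)
qed

text \<open>The interior points where g is positive form an open null set, which must be
  empty.\<close>

lemma continuous_integral_zero_imp_zero:
  fixes g :: "'a::euclidean_space \<Rightarrow> real"
  assumes K: "compact K" and g: "continuous_on UNIV g" "\<And>x. 0 \<le> g x" and zero: "(LINT x:K|lebesgue. g x) \<le> 0"
    and x: "x \<in> interior K"
  shows "g x = 0"
proof (rule ccontr)
  assume "g x \<noteq> 0"
  define U where "U = interior K \<inter> {x. 0 < g x}"
  have U: "open U" unfolding U_def by (intro open_Int open_interior open_Collect_less g continuous_intros)
  have "x \<in> U" using x g(2)[of x] \<open>g x \<noteq> 0\<close> by (simp add: U_def)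
  have int: "integrable lebesgue (\<lambda>x. indicator K x *\<^sub>R g x)"
    using set_integrable_continuous_compact[OF K g(1)] by (simp add: set_integrable_def)
  have "(LINT x|lebesgue. indicator K x *\<^sub>R g x) = 0"
    using zero g(2) unfolding set_lebesgue_integral_def by (intro antisym integral_nonneg_AE) auto
  then have "AE x in lebesgue. indicator K x *\<^sub>R g x = 0"
    using g(2) by (subst (asm) integral_nonneg_eq_0_iff_AE[OF int]) auto
  then have "AE x in lebesgue. x \<notin> U"
    by eventually_elim (use interior_subset in \<open>auto simp: U_def indicator_def split: if_splits\<close>)
  then have "negligible U" using U
    by (subst negligible_iff_null_sets) (auto simp: AE_iff_null_sets)
  then show False using open_not_negligible[OF U] \<open>x \<in> U\<close> by blast
qed

section \<open>Well-posedness and symmetry of the weight-adjusted operator\<close>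

text \<open>Common frame for the scalar weight and the matrix weight, given by their pointwise
  action. Symmetry and coercivity are almost everywhere statements because an element may contain
  boundary points of the domain, where the coefficients are unrestricted.\<close>

locale weighted_projection =
  fixes K :: "(real^'d) set" and N :: nat and W :: "real^'d \<Rightarrow> 'b::euclidean_space \<Rightarrow> 'b" and m :: real
  assumes K: "compact K" "interior K \<noteq> {}"
    and lin: "\<And>x. linear (W x)"
    and integrable: "\<And>p q. p \<in> poly_space N \<Longrightarrow> q \<in> poly_space N \<Longrightarrow> set_integrable lebesgue K (\<lambda>x. W x (p x) \<bullet> q x)"
    and m: "0 < m"
    and sym: "AE x in lebesgue. x \<in> K \<longrightarrow> (\<forall>a b. W x a \<bullet> b = W x b \<bullet> a)"
    and coercive: "AE x in lebesgue. x \<in> K \<longrightarrow> (\<forall>a. m * (a \<bullet> a) \<le> W x a \<bullet> a)"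
begin

abbreviation (input) P :: "(real^'d \<Rightarrow> 'b) set" where "P \<equiv> poly_space N"

definition form :: "(real^'d \<Rightarrow> 'b) \<Rightarrow> (real^'d \<Rightarrow> 'b) \<Rightarrow> real" where
  "form p q = L2_inner K (\<lambda>x. W x (p x)) q"

lemma P_integrable: "p \<in> P \<Longrightarrow> q \<in> P \<Longrightarrow> set_integrable lebesgue K (\<lambda>x. p x \<bullet> q x)"
  by (intro set_integrable_continuous_compact K continuous_on_inner poly_space_continuous)

lemma inner_add: "p \<in> P \<Longrightarrow> q \<in> P \<Longrightarrow> r \<in> P \<Longrightarrow> L2_inner K (\<lambda>x. p x + q x) r = L2_inner K p r + L2_inner K q r"
  by (intro L2_inner_add_left P_integrable)

lemma form_add: "p \<in> P \<Longrightarrow> q \<in> P \<Longrightarrow> r \<in> P \<Longrightarrow> form (\<lambda>x. p x + q x) r = form p r + form q r"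
  unfolding form_def linear_add[OF lin] by (intro L2_inner_add_left integrable)

lemma form_scale: "form (\<lambda>x. a *\<^sub>R p x) r = a * form p r"
  unfolding form_def linear_cmul[OF lin] by (rule L2_inner_scaleR_left)

lemma form_sym:
  assumes "p \<in> P" "q \<in> P" shows "form p q = form q p"
proof -
  have "(\<lambda>x. indicator K x *\<^sub>R (W x (p x) \<bullet> q x)) \<in> borel_measurable lebesgue" if "p \<in> P" "q \<in> P" for p q
    using integrable[OF that] by (auto simp: set_integrable_def dest: borel_measurable_integrable)
  then show ?thesis
    unfolding form_def L2_inner_def set_lebesgue_integral_def using assms
    by (intro integral_cong_AE) (use sym in \<open>auto simp: indicator_def elim: eventually_mono\<close>)
qed

text \<open>Coercivity bounds the integral of m \<bar>p\<bar>^2 by the form, so p vanishes on the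
  interior of K, and a polynomial vanishing on an open set is zero.\<close>

lemma form_nonpos_imp_zero:
  assumes p: "p \<in> P" and "form p p \<le> 0" shows "p x = 0"
proof -
  have 1: "integrable lebesgue (\<lambda>x. indicator K x *\<^sub>R (m * (p x \<bullet> p x)))"
    using P_integrable[OF p p] by (simp add: set_integrable_def mult.left_commute)
  have "(LINT x|lebesgue. indicator K x *\<^sub>R (m * (p x \<bullet> p x))) \<le> (LINT x|lebesgue. indicator K x *\<^sub>R (W x (p x) \<bullet> p x))"
    using integrable[OF p p] unfolding set_integrable_def
    by (intro integral_mono_AE 1) (use coercive in \<open>auto simp: indicator_def elim: eventually_mono\<close>)
  also have "\<dots> \<le> 0" using assms(2) by (simp add: form_def L2_inner_def set_lebesgue_integral_def)
  finally have "(LINT x:K|lebesgue. m * (p x \<bullet> p x)) \<le> 0" by (simp only: set_lebesgue_integral_def)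
  then have "m * (p x \<bullet> p x) = 0" if "x \<in> interior K" for x
    using that m by (intro continuous_integral_zero_imp_zero[OF K(1)]) (auto intro!: continuous_intros poly_space_continuous[OF p])
  then have "p x = 0" if "x \<in> interior K" for x using that m by auto
  then show ?thesis
    using polynomial_function_zero_on_open[OF poly_space_polynomial_function[OF p] open_interior K(2)] by blast
qed

text \<open>Gives meaning to the definite description in \<open>wadg_inv\<close>. In a nodal basis
  the equation is a linear system with the Gram matrix of the form; definiteness yields existence,
  and uniqueness follows by testing the difference with itself.\<close>

lemma ex1_projection:
  assumes u: "u \<in> P"
  shows "\<exists>!p. p \<in> P \<and> (\<forall>q\<in>P. form p q = L2_inner K u q)"
proof (rule ex_ex1I)
  obtain S e where S0: "finite S" "S \<subseteq> K \<times> (Basis :: 'b set)" "\<forall>i\<in>S. e i \<in> poly_space N"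
    "\<forall>p\<in>poly_space N. \<forall>x. p x = (\<Sum>i\<in>S. (p (fst i) \<bullet> snd i) *\<^sub>R e i x)"
    "\<forall>c. \<forall>i\<in>S. (\<Sum>j\<in>S. c j *\<^sub>R e j (fst i)) \<bullet> snd i = c i"
    using poly_space_basis[OF K(2), where N = N and 'b = 'b] by (elim exE conjE)
  note S = S0(1,2) S0(3)[rule_format] S0(4)[rule_format] S0(5)[rule_format]
  have ps: "(\<lambda>x. \<Sum>i\<in>S. c i *\<^sub>R e i x) \<in> P" for c by (intro poly_space_sum poly_space_scaleR S(3))
  have f1: "form (\<lambda>x. \<Sum>i\<in>S. c i *\<^sub>R e i x) r = (\<Sum>i\<in>S. c i * form (e i) r)" if "r \<in> P" for c r
    by (rule poly_functional_sum[where \<Phi> = "\<lambda>p. form p r"]) (use that form_add form_scale S(3) in auto)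
  have f2: "form r (\<lambda>x. \<Sum>i\<in>S. c i *\<^sub>R e i x) = (\<Sum>i\<in>S. c i * form r (e i))" if "r \<in> P" for c r
    using f1[OF that, of c] form_sym[OF that ps] form_sym[OF that S(3)] by simp
  have i2: "L2_inner K u (\<lambda>x. \<Sum>i\<in>S. c i *\<^sub>R e i x) = (\<Sum>i\<in>S. c i * L2_inner K u (e i))" for c
    unfolding L2_inner_commute[of K u]
    by (rule poly_functional_sum[where \<Phi> = "\<lambda>p. L2_inner K p u"]) (use u inner_add L2_inner_scaleR_left S(3) in auto)
  have "\<exists>c. \<forall>j\<in>S. (\<Sum>i\<in>S. c i * form (e i) (e j)) = L2_inner K u (e j)"
  proof (rule positive_definite_system_solvable[OF S(1)])
    fix c :: "(real^'d) \<times> 'b \<Rightarrow> real" assume "\<exists>i\<in>S. c i \<noteq> 0"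
    then obtain i where i: "i \<in> S" "c i \<noteq> 0" by blast
    let ?p = "\<lambda>x. \<Sum>i\<in>S. c i *\<^sub>R e i x"
    \<comment> \<open>The value at node i has i-th coordinate coefficient c i \<noteq> 0, so the
      combination is a nonzero polynomial.\<close>
    have "?p (fst i) \<noteq> 0" using S(5)[OF i(1), of c] i(2) by auto
    then have "0 < form ?p ?p" using form_nonpos_imp_zero[OF ps, of c "fst i"] by force
    also have "form ?p ?p = (\<Sum>i\<in>S. \<Sum>j\<in>S. c i * c j * form (e i) (e j))"
      unfolding f1[OF ps] by (simp add: f2 S(3) sum_distrib_left mult.assoc cong: sum.cong)
    finally show "0 < (\<Sum>i\<in>S. \<Sum>j\<in>S. c i * c j * form (e i) (e j))" .
  qed
  then obtain c where c: "\<And>j. j \<in> S \<Longrightarrow> (\<Sum>i\<in>S. c i * form (e i) (e j)) = L2_inner K u (e j)" by blast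
  have "form (\<lambda>x. \<Sum>i\<in>S. c i *\<^sub>R e i x) q = L2_inner K u q" if q: "q \<in> P" for q
  proof -
    have "q = (\<lambda>x. \<Sum>i\<in>S. (q (fst i) \<bullet> snd i) *\<^sub>R e i x)" using S(4)[OF q] by (rule ext)
    then obtain d where d: "q = (\<lambda>x. \<Sum>i\<in>S. d i *\<^sub>R e i x)" by (rule that)
    show ?thesis unfolding d f2[OF ps] i2 f1[OF S(3)] using c f1[OF S(3)] by (simp cong: sum.cong)
  qed
  then show "\<exists>p. p \<in> P \<and> (\<forall>q\<in>P. form p q = L2_inner K u q)" using ps by blast
next
  fix p p' assume p: "p \<in> P \<and> (\<forall>q\<in>P. form p q = L2_inner K u q)" and p': "p' \<in> P \<and> (\<forall>q\<in>P. form p' q = L2_inner K u q)"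
  define d where "d = (\<lambda>x. p x + (-1) *\<^sub>R p' x)"
  have d: "d \<in> P" unfolding d_def using p p' by (intro poly_space_add poly_space_scaleR) auto
  have "form d d = form p d + form (\<lambda>x. (-1) *\<^sub>R p' x) d"
    using p p' d by (subst (1) d_def, intro form_add poly_space_scaleR) auto
  also have "\<dots> = 0" unfolding form_scale using p p' d by simp
  finally have "d x = 0" for x using form_nonpos_imp_zero[OF d] by simp
  then show "p = p'" by (auto simp: d_def)
qed

abbreviation (input) T :: "(real^'d \<Rightarrow> 'b) \<Rightarrow> real^'d \<Rightarrow> 'b" where "T \<equiv> wadg_inv N K W"

lemma T:
  assumes "u \<in> P" shows "T u \<in> P" "\<And>q. q \<in> P \<Longrightarrow> form (T u) q = L2_inner K u q"
  using theI'[OF ex1_projection[OF assms]] unfolding wadg_inv_def form_def by auto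

lemma T_eqI:
  assumes "u \<in> P" "p \<in> P" "\<And>q. q \<in> P \<Longrightarrow> form p q = L2_inner K u q" shows "T u = p"
  using ex1_projection[OF assms(1)] T[OF assms(1)] assms(2,3) by blast

lemma T_add:
  assumes "u \<in> P" "w \<in> P" shows "T (\<lambda>x. u x + w x) = (\<lambda>x. T u x + T w x)"
  using assms by (intro T_eqI poly_space_add T) (auto simp: form_add T inner_add)

lemma T_scale:
  assumes "u \<in> P" shows "T (\<lambda>x. a *\<^sub>R u x) = (\<lambda>x. a *\<^sub>R T u x)"
  using assms by (intro T_eqI poly_space_scaleR T) (auto simp: form_scale T L2_inner_scaleR_left)

text \<open>Using T u as test function in the definition of T w gives (T u, w) = form (T w) (T u),
  so symmetry of the weight passes to its inverse operator.\<close>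

lemma energy_sym:
  assumes "u \<in> P" "w \<in> P" shows "L2_inner K (T u) w = L2_inner K (T w) u"
  using T[OF assms(1)] T[OF assms(2)] form_sym[of "T u" "T w"] L2_inner_commute by metis

lemma energy_add:
  assumes "u \<in> P" "w \<in> P" "r \<in> P"
  shows "L2_inner K (T (\<lambda>x. u x + w x)) r = L2_inner K (T u) r + L2_inner K (T w) r"
  unfolding T_add[OF assms(1,2)] using assms T by (intro inner_add)

lemma energy_scale:
  assumes "u \<in> P" shows "L2_inner K (T (\<lambda>x. a *\<^sub>R u x)) r = a * L2_inner K (T u) r"
  unfolding T_scale[OF assms] by (rule L2_inner_scaleR_left)

end

lemma L2_inner_vec:
  fixes f g :: "real^'d \<Rightarrow> real^'m"
  assumes "\<And>i. set_integrable lebesgue K (\<lambda>x. f x $ i * g x $ i)"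
  shows "L2_inner K f g = (\<Sum>i\<in>UNIV. L2_inner K (\<lambda>x. f x $ i) (\<lambda>x. g x $ i))"
  using assms unfolding L2_inner_def set_lebesgue_integral_def set_integrable_def inner_vec_def
  by (subst Bochner_Integration.integral_sum[symmetric]) (auto simp: sum_distrib_left)

lemma poly_space_component: "u \<in> poly_space N \<Longrightarrow> (\<lambda>x. u x $ i) \<in> poly_space N"
  by (rule poly_space_linear_image[where T = "\<lambda>y. y $ i"]) (auto simp: linear_iff)

section \<open>The scalar weight applied to vector fields componentwise\<close>

context
  fixes K :: "(real^'d) set" and N :: nat and w :: "real^'d \<Rightarrow> real" and m :: real
  assumes wp: "weighted_projection K N (\<lambda>y r. w y * r) m"
begin

interpretation weighted_projection K N "\<lambda>y r. w y * r" m by (rule wp)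

abbreviation (input) "Ts \<equiv> wadg_inv_scalar N K w :: (real^'d \<Rightarrow> real^'m) \<Rightarrow> real^'d \<Rightarrow> real^'m"

lemma wadg_inv_scalar_L2_inner:
  fixes u r :: "real^'d \<Rightarrow> real^'m"
  assumes "u \<in> poly_space N" "r \<in> poly_space N"
  shows "L2_inner K (Ts u) r = (\<Sum>i\<in>UNIV. L2_inner K (T (\<lambda>x. u x $ i)) (\<lambda>x. r x $ i))"
proof (subst L2_inner_vec)
  show "set_integrable lebesgue K (\<lambda>x. wadg_inv_scalar N K w u x $ i * r x $ i)" for i
    using P_integrable[OF T(1)[OF poly_space_component[OF assms(1)]] poly_space_component[OF assms(2)], of i i]
    by (simp add: wadg_inv_scalar_def)
qed (simp add: wadg_inv_scalar_def)

lemma wadg_inv_scalar_energy_sym: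
  fixes u r :: "real^'d \<Rightarrow> real^'m"
  assumes "u \<in> poly_space N" "r \<in> poly_space N"
  shows "L2_inner K (Ts u) r = L2_inner K (Ts r) u"
  unfolding wadg_inv_scalar_L2_inner[OF assms] wadg_inv_scalar_L2_inner[OF assms(2,1)]
  by (intro sum.cong refl energy_sym poly_space_component assms)

lemma wadg_inv_scalar_energy_add:
  fixes u r p :: "real^'d \<Rightarrow> real^'m"
  assumes "u \<in> poly_space N" "p \<in> poly_space N" "r \<in> poly_space N"
  shows "L2_inner K (Ts (\<lambda>x. u x + p x)) r = L2_inner K (Ts u) r + L2_inner K (Ts p) r"
  using assms by (simp add: wadg_inv_scalar_L2_inner poly_space_add energy_add poly_space_component sum.distrib)

lemma wadg_inv_scalar_energy_scale:
  fixes u r :: "real^'d \<Rightarrow> real^'m"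
  assumes "u \<in> poly_space N" "r \<in> poly_space N"
  shows "L2_inner K (Ts (\<lambda>x. a *\<^sub>R u x)) r = a * L2_inner K (Ts u) r"
  using assms energy_scale[of "\<lambda>x. u x $ i" a for i]
  by (simp add: wadg_inv_scalar_L2_inner poly_space_scaleR poly_space_component sum_distrib_left)

end


subsection \<open>Face integrals and Green's identity\<close>

text \<open>Points of the unit slab are within distance 1 of their projections, so the pulled-back
  integrand is bounded with support in a ball of radius R + 1.\<close>

lemma facet_integrable:
  fixes n :: "'a::euclidean_space" and f :: "'a \<Rightarrow> real"
  assumes n: "norm n = 1" and F: "compact F" and f: "continuous_on UNIV f"
  shows "set_integrable (hyperplane_measure n c) F f"
proof -
  have [measurable]: "f \<in> borel_measurable borel" "F \<in> sets borel"
    using f F by (auto intro: borel_measurable_continuous_onI borel_compact)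
  obtain R where R: "\<And>x. x \<in> F \<Longrightarrow> norm x \<le> R"
    using compact_imp_bounded[OF F] by (auto simp: bounded_iff)
  obtain B where B: "\<And>x. norm x \<le> R \<Longrightarrow> \<bar>f x\<bar> \<le> B"
    using continuous_bounded_on_cball[OF f] by blast
  have "integrable lborel (\<lambda>x. indicator {x. c \<le> n \<bullet> x \<and> n \<bullet> x \<le> c + 1} x *
      (indicator F (x - (n \<bullet> x - c) *\<^sub>R n) *\<^sub>R f (x - (n \<bullet> x - c) *\<^sub>R n)))"
  proof (rule integrable_lborel_bounded_support[where B = "\<bar>B\<bar>" and R = "R + 1"])
    fix x
    let ?P = "x - (n \<bullet> x - c) *\<^sub>R n"
    show "\<bar>indicator {x. c \<le> n \<bullet> x \<and> n \<bullet> x \<le> c + 1} x * (indicator F ?P *\<^sub>R f ?P)\<bar> \<le> \<bar>B\<bar>"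
      using R[of ?P] B[of ?P] by (auto simp: indicator_def intro: order_trans)
    assume x: "R + 1 < norm x"
    have False if "c \<le> n \<bullet> x" "n \<bullet> x \<le> c + 1" "?P \<in> F"
    proof -
      have "norm x \<le> norm ?P + norm ((n \<bullet> x - c) *\<^sub>R n)"
        using norm_triangle_ineq[of ?P "(n \<bullet> x - c) *\<^sub>R n"] by simp
      also have "norm ((n \<bullet> x - c) *\<^sub>R n) \<le> 1" using that n by simp
      finally show False using R[OF that(3)] x by linarith
    qed
    then show "indicator {x. c \<le> n \<bullet> x \<and> n \<bullet> x \<le> c + 1} x * (indicator F ?P *\<^sub>R f ?P) = 0"
      by (auto simp: indicator_def)
  qed measurable
  then show ?thesis
    unfolding set_integrable_def by (subst integrable_hyperplane_measure) simp_all
qed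

context
  fixes K F :: "'a::euclidean_space set"
  assumes K: "polytope K" "interior K \<noteq> {}" "F facet_of K"
begin

text \<open>A single pair (n, c) serves all integrands at once, so linearity of facet integrals
  reduces to that of the integral for one measure.\<close>

lemma facet_integral_obtain:
  obtains n c where "norm n = 1" "\<And>f. facet_integral F f = (LINT x:F|hyperplane_measure n c. f x)"
    "\<And>f :: 'a \<Rightarrow> real. continuous_on UNIV f \<Longrightarrow> set_integrable (hyperplane_measure n c) F f"
proof -
  obtain c where c: "norm (outward_normal K F) = 1" "affine hull F = {x. outward_normal K F \<bullet> x = c}"
    using facet_outward_normal_obtain[OF polytope_imp_polyhedron[OF K(1)] K(2,3)] by metis
  have F: "compact F"
    using facet_of_imp_face_of[OF K(3)] polytope_imp_compact[OF K(1)] polytope_imp_convex[OF K(1)]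
    by (metis face_of_imp_compact)
  then show ?thesis
    using facet_integral_eq[OF c] facet_integrable[OF c(1) F] by (intro that[OF c(1)])
qed

lemma facet_integral_add:
  assumes "continuous_on UNIV f" "continuous_on UNIV g"
  shows "facet_integral F (\<lambda>x. f x + g x) = facet_integral F f + facet_integral F g"
proof -
  obtain n c where nc: "norm n = 1" "\<And>f. facet_integral F f = (LINT x:F|hyperplane_measure n c. f x)"
    "\<And>f :: 'a \<Rightarrow> real. continuous_on UNIV f \<Longrightarrow> set_integrable (hyperplane_measure n c) F f"
    using facet_integral_obtain by blast
  show ?thesis unfolding nc(2) by (intro set_integral_add(2) nc(3) assms)
qed

lemma facet_integral_cmult: "facet_integral F (\<lambda>x. a * f x) = a * facet_integral F f"
proof -
  obtain n c where nc: "norm n = 1" "\<And>f. facet_integral F f = (LINT x:F|hyperplane_measure n c. f x)"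
    "\<And>f :: 'a \<Rightarrow> real. continuous_on UNIV f \<Longrightarrow> set_integrable (hyperplane_measure n c) F f"
    using facet_integral_obtain by blast
  show ?thesis unfolding nc(2) by simp
qed

lemma facet_integral_sum:
  assumes "\<And>i. i \<in> J \<Longrightarrow> continuous_on UNIV (f i)"
  shows "facet_integral F (\<lambda>x. \<Sum>i\<in>J. f i x) = (\<Sum>i\<in>J. facet_integral F (f i))"
  using assms
proof (induction J rule: infinite_finite_induct)
  case (insert j J)
  then show ?case by (simp add: facet_integral_add continuous_on_sum)
qed (use facet_integral_cmult[of 0 "\<lambda>x. 0"] in simp_all)

lemma facet_integral_nonneg:
  assumes "\<And>x. 0 \<le> f x" shows "0 \<le> facet_integral F f"
proof -
  obtain n c where nc: "norm n = 1" "\<And>f. facet_integral F f = (LINT x:F|hyperplane_measure n c. f x)"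
    "\<And>f :: 'a \<Rightarrow> real. continuous_on UNIV f \<Longrightarrow> set_integrable (hyperplane_measure n c) F f"
    using facet_integral_obtain by blast
  show ?thesis unfolding nc(2) set_lebesgue_integral_def
    using assms by (intro integral_nonneg_AE AE_I2) (auto simp: indicator_def)
qed

end

section \<open>Polynomial derivatives, the matrices A_n and integration by parts\<close>

lemma real_polynomial_function_has_derivative:
  fixes f :: "'a::euclidean_space \<Rightarrow> real"
  assumes "real_polynomial_function f"
  shows "\<exists>f'. (\<forall>x. (f has_derivative f' x) (at x)) \<and> (\<forall>e. continuous_on UNIV (\<lambda>x. f' x e))"
  using assms
proof (induction rule: real_polynomial_function.induct)
  case (linear f)
  then show ?case
    by (intro exI[of _ "\<lambda>x. f"]) (auto simp: bounded_linear_imp_has_derivative)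
next
  case (const c)
  then show ?case by (intro exI[of _ "\<lambda>x h. 0"]) auto
next
  case (add f g)
  then obtain f' g' where "\<forall>x. (f has_derivative f' x) (at x)" "\<forall>e. continuous_on UNIV (\<lambda>x. f' x e)"
    "\<forall>x. (g has_derivative g' x) (at x)" "\<forall>e. continuous_on UNIV (\<lambda>x. g' x e)" by blast
  then show ?case
    by (intro exI[of _ "\<lambda>x h. f' x h + g' x h"]) (auto intro!: has_derivative_add continuous_intros)
next
  case (mult f g)
  then obtain f' g' where *: "\<forall>x. (f has_derivative f' x) (at x)" "\<forall>e. continuous_on UNIV (\<lambda>x. f' x e)"
    "\<forall>x. (g has_derivative g' x) (at x)" "\<forall>e. continuous_on UNIV (\<lambda>x. g' x e)" by blast
  have "continuous_on UNIV f" "continuous_on UNIV g"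
    using *(1,3) by (meson has_derivative_continuous continuous_at_imp_continuous_on)+
  then show ?case using *
    by (intro exI[of _ "\<lambda>x h. f x * g' x h + f' x h * g x"]) (auto intro!: has_derivative_mult continuous_intros)
qed

lemma polynomial_function_has_derivative:
  fixes p :: "'a::euclidean_space \<Rightarrow> 'b::euclidean_space"
  assumes p: "polynomial_function p"
  shows "(p has_derivative frechet_derivative p (at x)) (at x)"
    and "continuous_on UNIV (\<lambda>x. frechet_derivative p (at x) e)"
proof -
  have "\<forall>b\<in>Basis. \<exists>f'. (\<forall>x. ((\<lambda>x. p x \<bullet> b) has_derivative f' x) (at x)) \<and> (\<forall>e. continuous_on UNIV (\<lambda>x. f' x e))"
    using p real_polynomial_function_has_derivative unfolding polynomial_function_iff_Basis_inner by blast
  then obtain f' where f': "\<And>b x. b \<in> Basis \<Longrightarrow> ((\<lambda>x. p x \<bullet> b) has_derivative f' b x) (at x)"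
    "\<And>b e. b \<in> Basis \<Longrightarrow> continuous_on UNIV (\<lambda>x. f' b x e)" by metis
  have der: "(p has_derivative (\<lambda>h. \<Sum>b\<in>Basis. f' b x h *\<^sub>R b)) (at x)" for x
    using f'(1) by (subst has_derivative_componentwise_within) (auto simp: inner_sum_left_Basis)
  have fr: "frechet_derivative p (at x) = (\<lambda>h. \<Sum>b\<in>Basis. f' b x h *\<^sub>R b)" for x
    using frechet_derivative_at[OF der] by simp
  show "(p has_derivative frechet_derivative p (at x)) (at x)" unfolding fr by (rule der)
  show "continuous_on UNIV (\<lambda>x. frechet_derivative p (at x) e)" unfolding fr
    by (intro continuous_intros f'(2))
qed

lemma partial_continuous: "p \<in> poly_space N \<Longrightarrow> continuous_on UNIV (partial i p)"
  unfolding partial_def by (intro polynomial_function_has_derivative poly_space_polynomial_function)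

text \<open>The index bounds keep the list lookups in range; what remains is a check of the finitely
  many entries in the two dimensions.\<close>

lemma voigt_rows_linear:
  assumes "d \<in> {2, 3}" "a < d * (d + 1) div 2" "i < d"
  shows "voigt_rows d (\<lambda>k. s * f k + g k) ! a ! i = s * (voigt_rows d f ! a ! i) + voigt_rows d g ! a ! i"
proof -
  have "a \<in> {0, 1, 2, 3, 4, 5}" "i \<in> {0, 1, 2}" using assms by auto
  with assms show ?thesis by (auto simp: voigt_rows_def)
qed

lemma linear_voigt_matrix:
  fixes \<iota> :: "'d::finite \<Rightarrow> nat" and \<kappa> :: "'m::finite \<Rightarrow> nat"
  assumes dim: "CARD('d) \<in> {2, 3}" "CARD('m) = CARD('d) * (CARD('d) + 1) div 2"
    and num: "bij_betw \<iota> UNIV {..<CARD('d)}" "bij_betw \<kappa> UNIV {..<CARD('m)}"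
  shows "linear (voigt_matrix \<iota> \<kappa>)"
proof -
  have bd: "\<iota> i < CARD('d)" "\<kappa> a < CARD('d) * (CARD('d) + 1) div 2" for i a
    using num dim(2) by (auto simp: bij_betw_def)
  have *: "voigt_matrix \<iota> \<kappa> (s *\<^sub>R x + y) = s *\<^sub>R voigt_matrix \<iota> \<kappa> x + voigt_matrix \<iota> \<kappa> y" for s x y
    using voigt_rows_linear[OF dim(1) bd(2) bd(1)] by (simp add: voigt_matrix_def vec_eq_iff)
  show ?thesis
  proof (rule linearI)
    fix x y :: "real^'d" and s :: real
    show "voigt_matrix \<iota> \<kappa> (x + y) = voigt_matrix \<iota> \<kappa> x + voigt_matrix \<iota> \<kappa> y"
      using *[of 1 x y] by simp
    have "voigt_matrix \<iota> \<kappa> 0 = 0" using *[of "-1" 0 0] by simp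
    then show "voigt_matrix \<iota> \<kappa> (s *\<^sub>R x) = s *\<^sub>R voigt_matrix \<iota> \<kappa> x"
      using *[of s x 0] by simp
  qed
qed

lemma inner_transpose_mult:
  fixes a :: "real^'d^'m"
  shows "(transpose a *v s) \<bullet> w = s \<bullet> (a *v w)"
  by (metis dot_lmul_matrix transpose_matrix_vector)

lemma bounded_linear_matrix_mult: "bounded_linear ((*v) (a :: real^'d^'m))"
  by (simp add: linear_conv_bounded_linear[symmetric] matrix_vector_mul_linear)

text \<open>The divergence theorem is applied to the scalar functions (A_i v) \<bullet> \<sigma> in
  direction i. The product rule yields both volume terms, since A_i may be moved across the inner
  product by transposition, and the facet terms add up to A_n by linearity.\<close>

lemma element_green_identity:
  fixes A :: "real^'d \<Rightarrow> real^'d^'m" and v :: "real^'d \<Rightarrow> real^'d" and \<sigma> :: "real^'d \<Rightarrow> real^'m"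
  assumes K: "polytope K" "interior K \<noteq> {}" and A: "linear A"
    and v: "v \<in> poly_space N" and \<sigma>: "\<sigma> \<in> poly_space N"
  shows "L2_inner K (\<lambda>x. \<Sum>i\<in>UNIV. transpose (A (axis i 1)) *v partial i \<sigma> x) v +
      L2_inner K (\<lambda>x. \<Sum>i\<in>UNIV. A (axis i 1) *v partial i v x) \<sigma> =
    (\<Sum>F | F facet_of K. facet_integral F (\<lambda>x. (A (outward_normal K F) *v v x) \<bullet> \<sigma> x))"
proof -
  have comp: "compact K" using K(1) by (rule polytope_imp_compact)
  have [measurable]: "K \<in> sets borel" using comp by (rule borel_compact)
  have vc: "continuous_on UNIV v" and \<sigma>c: "continuous_on UNIV \<sigma>" using v \<sigma> by (auto intro: poly_space_continuous)
  have Ac: "continuous_on UNIV (\<lambda>x. a *v f x)" if "continuous_on UNIV f" for a :: "real^'k^'l" and f :: "real^'d \<Rightarrow> real^'k"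
    using bounded_linear.continuous_on[OF bounded_linear_matrix_mult that] .
  define f where "f i x = (A (axis i 1) *v v x) \<bullet> \<sigma> x" for i x
  define f' where "f' i x h = (A (axis i 1) *v v x) \<bullet> frechet_derivative \<sigma> (at x) h +
      (A (axis i 1) *v frechet_derivative v (at x) h) \<bullet> \<sigma> x" for i x h
  have der: "(f i has_derivative f' i x) (at x)" for i x
    unfolding f_def[abs_def] f'_def[abs_def]
    by (intro has_derivative_inner bounded_linear.has_derivative[OF bounded_linear_matrix_mult]
        polynomial_function_has_derivative poly_space_polynomial_function[OF v] poly_space_polynomial_function[OF \<sigma>])
  have f'c: "continuous_on UNIV (\<lambda>x. f' i x e)" for i e
    unfolding f'_def
    by (intro continuous_on_add continuous_on_inner Ac vc \<sigma>c polynomial_function_has_derivative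
        poly_space_polynomial_function[OF v] poly_space_polynomial_function[OF \<sigma>])
  have fc: "continuous_on UNIV (f i)" for i
    unfolding f_def[abs_def] by (intro continuous_on_inner Ac vc \<sigma>c)
  have int: "set_integrable lebesgue K (\<lambda>x. f' i x (axis i 1))" for i
    by (rule set_integrable_continuous_compact[OF comp f'c])
  have c1: "continuous_on UNIV (\<lambda>x. (\<Sum>i\<in>UNIV. transpose (A (axis i 1)) *v partial i \<sigma> x) \<bullet> v x)"
    by (intro continuous_on_inner continuous_on_sum Ac vc partial_continuous[OF \<sigma>])
  have c2: "continuous_on UNIV (\<lambda>x. (\<Sum>i\<in>UNIV. A (axis i 1) *v partial i v x) \<bullet> \<sigma> x)"
    by (intro continuous_on_inner continuous_on_sum Ac \<sigma>c partial_continuous[OF v])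
  have "L2_inner K (\<lambda>x. \<Sum>i\<in>UNIV. transpose (A (axis i 1)) *v partial i \<sigma> x) v +
      L2_inner K (\<lambda>x. \<Sum>i\<in>UNIV. A (axis i 1) *v partial i v x) \<sigma> =
      (LINT x:K|lebesgue. (\<Sum>i\<in>UNIV. transpose (A (axis i 1)) *v partial i \<sigma> x) \<bullet> v x +
        (\<Sum>i\<in>UNIV. A (axis i 1) *v partial i v x) \<bullet> \<sigma> x)"
    unfolding L2_inner_def
    by (rule set_integral_add(2)[symmetric]; rule set_integrable_continuous_compact[OF comp]; fact c1 c2)
  also have "\<dots> = (LINT x:K|lebesgue. (\<Sum>i\<in>UNIV. f' i x (axis i 1)))"
    unfolding f'_def partial_def inner_sum_left inner_transpose_mult sum.distrib
    by (simp only: inner_commute[of "A _ *v v _"])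
  also have "\<dots> = (\<Sum>i\<in>UNIV. LINT x:K|lebesgue. f' i x (axis i 1))"
    unfolding set_lebesgue_integral_def scaleR_sum_right
    by (rule Bochner_Integration.integral_sum) (use int in \<open>simp add: set_integrable_def\<close>)
  also have "\<dots> = (\<Sum>i\<in>UNIV. \<Sum>F | F facet_of K. (outward_normal K F $ i) * facet_integral F (f i))"
  proof (rule sum.cong[OF refl])
    fix i
    have [measurable]: "(\<lambda>x. f' i x (axis i 1)) \<in> borel_measurable borel"
      by (rule borel_measurable_continuous_onI[OF f'c])
    have "(LINT x:K|lebesgue. f' i x (axis i 1)) = (LINT x|lborel. indicator K x * f' i x (axis i 1))"
      unfolding set_lebesgue_integral_def by (subst integral_completion) auto
    also have "\<dots> = (\<Sum>F | F facet_of K. (outward_normal K F $ i) * facet_integral F (f i))"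
      using divergence_theorem_polytope[OF K der f'c] by (simp add: inner_axis)
    finally show "(LINT x:K|lebesgue. f' i x (axis i 1)) = (\<Sum>F | F facet_of K. (outward_normal K F $ i) * facet_integral F (f i))" .
  qed
  also have "\<dots> = (\<Sum>F | F facet_of K. \<Sum>i\<in>UNIV. (outward_normal K F $ i) * facet_integral F (f i))"
    by (rule sum.swap)
  also have "\<dots> = (\<Sum>F | F facet_of K. facet_integral F (\<lambda>x. (A (outward_normal K F) *v v x) \<bullet> \<sigma> x))"
  proof (rule sum.cong[OF refl])
    fix F assume "F \<in> {F. F facet_of K}"
    then have F: "F facet_of K" by simp
    define n where "n = outward_normal K F"
    \<comment> \<open>The components of the normal reassemble A_n from the values of A at the unit
      vectors.\<close>
    have "A n = A (\<Sum>i\<in>UNIV. n $ i *\<^sub>R axis i 1)"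
      by (simp add: basis_expansion[of n, unfolded scalar_mult_eq_scaleR])
    then have An: "A n = (\<Sum>i\<in>UNIV. n $ i *\<^sub>R A (axis i 1))"
      by (simp add: linear_sum[OF A] linear_cmul[OF A])
    have An_v: "A n *v w = (\<Sum>i\<in>UNIV. n $ i *\<^sub>R (A (axis i 1) *v w))" for w
    proof -
      have lin: "linear (\<lambda>a. a *v w :: real^'m)"
        by (auto simp: linear_iff matrix_vector_mult_add_rdistrib scaleR_matrix_vector_assoc)
      show ?thesis unfolding An by (simp add: linear_sum[OF lin] linear_cmul[OF lin])
    qed
    have "(\<Sum>i\<in>UNIV. n $ i * facet_integral F (f i)) = (\<Sum>i\<in>UNIV. facet_integral F (\<lambda>x. n $ i * f i x))"
      by (simp add: facet_integral_cmult[OF K F])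
    also have "\<dots> = facet_integral F (\<lambda>x. \<Sum>i\<in>UNIV. n $ i * f i x)"
      by (rule facet_integral_sum[OF K F, symmetric]) (intro continuous_intros fc)
    also have "(\<lambda>x. \<Sum>i\<in>UNIV. n $ i * f i x) = (\<lambda>x. (A n *v v x) \<bullet> \<sigma> x)"
      by (rule ext) (simp add: An_v f_def inner_sum_left)
    finally show "(\<Sum>i\<in>UNIV. (outward_normal K F $ i) * facet_integral F (f i)) =
        facet_integral F (\<lambda>x. (A (outward_normal K F) *v v x) \<bullet> \<sigma> x)" by (simp add: n_def)
  qed
  finally show ?thesis .
qed


subsection \<open>Face fluxes and the energy estimate\<close>

text \<open>The interior of an element lies in the domain, so only points of the frontier of a
  convex set can be missing.\<close>

lemma element_minus_domain_negligible:
  fixes \<Omega> :: "'a::euclidean_space set"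
  assumes dom: "lipschitz_domain \<Omega>" and mesh: "simplicial_mesh \<Omega> M" and K: "K \<in> M"
  shows "negligible (K - \<Omega>)"
proof (rule negligible_subset)
  show "negligible (frontier K)" using mesh_element(3)[OF dom mesh K] by (rule negligible_convex_frontier)
  show "K - \<Omega> \<subseteq> frontier K"
    using mesh_element(7)[OF dom mesh K] closure_subset by (auto simp: frontier_def)
qed

lemma AE_element_in_domain:
  fixes \<Omega> :: "'a::euclidean_space set"
  assumes "lipschitz_domain \<Omega>" "simplicial_mesh \<Omega> M" "K \<in> M"
  shows "AE x in lebesgue. x \<in> K \<longrightarrow> x \<in> \<Omega>"
proof -
  have "K - \<Omega> \<in> null_sets lebesgue"
    using element_minus_domain_negligible[OF assms] by (simp add: negligible_iff_null_sets)
  then show ?thesis by (rule AE_mp[OF AE_not_in]) auto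
qed

lemma compact_bounded_above:
  fixes p :: "'a::euclidean_space \<Rightarrow> 'b::real_normed_vector"
  assumes "compact K" "continuous_on UNIV p"
  obtains B where "0 \<le> B" "\<And>x. x \<in> K \<Longrightarrow> norm (p x) \<le> B"
proof -
  have "compact (p ` K)" using compact_continuous_image[OF continuous_on_subset[OF assms(2)] assms(1)] by simp
  then have "bounded (p ` K)" by (rule compact_imp_bounded)
  then obtain B where B: "\<And>x. x \<in> K \<Longrightarrow> norm (p x) \<le> B" unfolding bounded_iff by blast
  show ?thesis by (rule that[of "max B 0"]) (use B in \<open>auto simp: max.coboundedI1\<close>)
qed

text \<open>The quadratic bounds extend from unit vectors by homogeneity. For the mixed term,
  polarization writes 4 (C u) \<bullet> w as a difference of two nonnegative values of the quadratic
  form; their sum is bounded by the parallelogram identity.\<close>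

lemma symmetric_form_bounds:
  fixes C :: "real^'m^'m"
  assumes sym: "transpose C = C"
    and bd: "\<And>u. norm u = 1 \<Longrightarrow> cmin \<le> u \<bullet> (C *v u) \<and> u \<bullet> (C *v u) \<le> cmax" and cmin: "0 < cmin"
  shows "(C *v u) \<bullet> w = (C *v w) \<bullet> u" and "cmin * (u \<bullet> u) \<le> (C *v u) \<bullet> u"
    and "\<bar>(C *v u) \<bullet> w\<bar> \<le> cmax * (u \<bullet> u + w \<bullet> w) / 2"
proof -
  have s: "(C *v u) \<bullet> w = (C *v w) \<bullet> u" for u w
    using inner_transpose_mult[of C u w] by (simp add: sym inner_commute del: transpose_matrix_vector)
  then show "(C *v u) \<bullet> w = (C *v w) \<bullet> u" .
  have q: "cmin * (u \<bullet> u) \<le> (C *v u) \<bullet> u \<and> (C *v u) \<bullet> u \<le> cmax * (u \<bullet> u)" for u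
  proof (cases "u = 0")
    case False
    define e where "e = u /\<^sub>R norm u"
    have u: "u = norm u *\<^sub>R e" using False by (simp add: e_def)
    have ne: "norm e = 1" using False by (simp add: e_def)
    have "(C *v u) \<bullet> u = (norm u)\<^sup>2 * (e \<bullet> (C *v e))"
      by (subst (1 2) u) (simp add: matrix_vector_mult_scaleR power2_eq_square inner_commute)
    moreover have "u \<bullet> u = (norm u)\<^sup>2" by (simp add: power2_norm_eq_inner)
    ultimately show ?thesis using bd[OF ne] by (simp add: mult.commute[of _ "(norm u)\<^sup>2"] mult_left_mono)
  qed simp
  then show "cmin * (u \<bullet> u) \<le> (C *v u) \<bullet> u" by blast
  have pos: "0 \<le> (C *v u) \<bullet> u" for u using q[of u] cmin by (meson inner_ge_zero mult_nonneg_nonneg less_imp_le order_trans)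
  have "4 * ((C *v u) \<bullet> w) = (C *v (u + w)) \<bullet> (u + w) - (C *v (u - w)) \<bullet> (u - w)"
    using s[of u w] by (simp add: matrix_vector_right_distrib matrix_vector_mult_diff_distrib inner_add_left inner_add_right inner_diff_left inner_diff_right)
  moreover have "(C *v (u + w)) \<bullet> (u + w) + (C *v (u - w)) \<bullet> (u - w) \<le> 2 * (cmax * (u \<bullet> u + w \<bullet> w))"
  proof -
    have "(C *v (u + w)) \<bullet> (u + w) + (C *v (u - w)) \<bullet> (u - w) \<le> cmax * ((u + w) \<bullet> (u + w) + (u - w) \<bullet> (u - w))"
      unfolding distrib_left using q by (intro add_mono) auto
    also have "(u + w) \<bullet> (u + w) + (u - w) \<bullet> (u - w) = 2 * (u \<bullet> u + w \<bullet> w)"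
      by (simp add: inner_add_left inner_add_right inner_diff_left inner_diff_right)
    finally show ?thesis by (simp add: algebra_simps)
  qed
  ultimately show "\<bar>(C *v u) \<bullet> w\<bar> \<le> cmax * (u \<bullet> u + w \<bullet> w) / 2"
    using pos[of "u + w"] pos[of "u - w"] unfolding abs_le_iff by linarith
qed

text \<open>The weight is the reciprocal of the density, so \<open>\<rho>max\<close> yields the
  coercivity constant while \<open>\<rho>min\<close> controls the size of the integrand.\<close>

lemma weighted_projection_density:
  fixes \<Omega> :: "(real^'d) set"
  assumes dom: "lipschitz_domain \<Omega>" and mesh: "simplicial_mesh \<Omega> M" and K: "K \<in> M"
    and rho: "\<rho> \<in> borel_measurable (lebesgue_on \<Omega>)" "0 < \<rho>min" "\<forall>x\<in>\<Omega>. \<rho>min \<le> \<rho> x \<and> \<rho> x \<le> \<rho>max"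
  shows "weighted_projection K N (\<lambda>x r :: real. (1 / \<rho> x) * r) (1 / \<rho>max)"
proof (rule weighted_projection.intro)
  note el = mesh_element[OF dom mesh K]
  have op: "open \<Omega>" and ne: "\<Omega> \<noteq> {}" using dom by (auto simp: lipschitz_domain_def)
  show comp: "compact K" and "interior K \<noteq> {}" using el polytope_imp_compact by auto
  \<comment> \<open>Positivity is read off at some point of the domain, which is nonempty.\<close>
  have rmax: "0 < \<rho>max" using ne rho(2,3) by force
  then show "0 < 1 / \<rho>max" by simp
  show "linear ((*) (1 / \<rho> x))" for x by (auto simp: linear_iff algebra_simps add_divide_distrib)
  show "AE x in lebesgue. x \<in> K \<longrightarrow> (\<forall>a b. (1 / \<rho> x * a) \<bullet> b = (1 / \<rho> x * b) \<bullet> a)" by simp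
  show "AE x in lebesgue. x \<in> K \<longrightarrow> (\<forall>a. 1 / \<rho>max * (a \<bullet> a) \<le> (1 / \<rho> x * a) \<bullet> a)"
    using AE_element_in_domain[OF dom mesh K]
  proof eventually_elim
    case (elim x)
    show ?case
    proof (intro impI allI)
      fix a :: real assume "x \<in> K"
      then have "\<rho>min \<le> \<rho> x" "\<rho> x \<le> \<rho>max" using elim rho(3) by auto
      then have "1 / \<rho>max \<le> 1 / \<rho> x" using rho(2) by (intro divide_left_mono) auto
      from mult_right_mono[OF this, of "a * a"] show "1 / \<rho>max * (a \<bullet> a) \<le> (1 / \<rho> x * a) \<bullet> a"
        by simp
    qed
  qed
  fix p q :: "real^'d \<Rightarrow> real" assume pq: "p \<in> poly_space N" "q \<in> poly_space N"
  then have c: "continuous_on UNIV p" "continuous_on UNIV q" by (auto intro: poly_space_continuous)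
  obtain P where P: "0 \<le> P" "\<And>x. x \<in> K \<Longrightarrow> norm (p x) \<le> P" using compact_bounded_above[OF comp c(1)] by blast
  obtain Q where Q: "0 \<le> Q" "\<And>x. x \<in> K \<Longrightarrow> norm (q x) \<le> Q" using compact_bounded_above[OF comp c(2)] by blast
  have [measurable]: "p \<in> borel_measurable (lebesgue_on \<Omega>)" "q \<in> borel_measurable (lebesgue_on \<Omega>)" "\<rho> \<in> borel_measurable (lebesgue_on \<Omega>)"
    using c rho(1) op by (auto intro!: continuous_imp_measurable_on_sets_lebesgue elim: continuous_on_subset)
  show "set_integrable lebesgue K (\<lambda>x. (1 / \<rho> x * p x) \<bullet> q x)"
  proof (rule set_integrable_bounded_measurable[OF comp op element_minus_domain_negligible[OF dom mesh K]])
    show "(\<lambda>x. (1 / \<rho> x * p x) \<bullet> q x) \<in> borel_measurable (lebesgue_on \<Omega>)" by measurable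
    fix x assume x: "x \<in> K \<inter> \<Omega>"
    have r: "\<rho>min \<le> \<rho> x" using x rho(3) by blast
    then have "\<bar>1 / \<rho> x\<bar> \<le> 1 / \<rho>min" using rho(2) by (auto intro!: divide_left_mono)
    then have "\<bar>1 / \<rho> x\<bar> * \<bar>p x\<bar> * \<bar>q x\<bar> \<le> 1 / \<rho>min * P * Q"
      using P Q x rho(2) by (intro mult_mono) auto
    then show "\<bar>(1 / \<rho> x * p x) \<bullet> q x\<bar> \<le> 1 / \<rho>min * P * Q" by (simp add: abs_mult)
  qed
qed

lemma weighted_projection_stiffness:
  fixes \<Omega> :: "(real^'d) set" and C :: "real^'d \<Rightarrow> real^'m^'m"
  assumes dom: "lipschitz_domain \<Omega>" and mesh: "simplicial_mesh \<Omega> M" and K: "K \<in> M"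
    and C: "C \<in> borel_measurable (lebesgue_on \<Omega>)" "0 < cmin" "\<forall>x\<in>\<Omega>. transpose (C x) = C x"
      "\<forall>x\<in>\<Omega>. \<forall>u. norm u = 1 \<longrightarrow> cmin \<le> u \<bullet> (C x *v u) \<and> u \<bullet> (C x *v u) \<le> cmax"
  shows "weighted_projection K N (\<lambda>x y. C x *v y) cmin"
proof (rule weighted_projection.intro)
  note el = mesh_element[OF dom mesh K]
  have op: "open \<Omega>" and ne: "\<Omega> \<noteq> {}" using dom by (auto simp: lipschitz_domain_def)
  show comp: "compact K" and "interior K \<noteq> {}" using el polytope_imp_compact by auto
  show "0 < cmin" by fact
  show "linear ((*v) (C x))" for x by (rule matrix_vector_mul_linear)
  have Cx: "\<And>u. norm u = 1 \<Longrightarrow> cmin \<le> u \<bullet> (C x *v u) \<and> u \<bullet> (C x *v u) \<le> cmax" "transpose (C x) = C x" if "x \<in> \<Omega>" for x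
    using C(3,4) that by auto
  show "AE x in lebesgue. x \<in> K \<longrightarrow> (\<forall>a b. (C x *v a) \<bullet> b = (C x *v b) \<bullet> a)"
    using AE_element_in_domain[OF dom mesh K]
    by eventually_elim (use symmetric_form_bounds(1)[OF Cx(2,1) C(2)] in blast)
  show "AE x in lebesgue. x \<in> K \<longrightarrow> (\<forall>a. cmin * (a \<bullet> a) \<le> (C x *v a) \<bullet> a)"
    using AE_element_in_domain[OF dom mesh K]
    by eventually_elim (use symmetric_form_bounds(2)[OF Cx(2,1) C(2)] in blast)
  fix p q :: "real^'d \<Rightarrow> real^'m" assume pq: "p \<in> poly_space N" "q \<in> poly_space N"
  then have c: "continuous_on UNIV p" "continuous_on UNIV q" by (auto intro: poly_space_continuous)
  obtain P where P: "0 \<le> P" "\<And>x. x \<in> K \<Longrightarrow> norm (p x) \<le> P" using compact_bounded_above[OF comp c(1)] by blast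
  obtain Q where Q: "0 \<le> Q" "\<And>x. x \<in> K \<Longrightarrow> norm (q x) \<le> Q" using compact_bounded_above[OF comp c(2)] by blast
  have pm[measurable]: "p \<in> borel_measurable (lebesgue_on \<Omega>)" "q \<in> borel_measurable (lebesgue_on \<Omega>)"
    using c op by (auto intro!: continuous_imp_measurable_on_sets_lebesgue elim: continuous_on_subset)
  show "set_integrable lebesgue K (\<lambda>x. (C x *v p x) \<bullet> q x)"
  proof (rule set_integrable_bounded_measurable[OF comp op element_minus_domain_negligible[OF dom mesh K]])
    have nth: "(\<lambda>x. f x \<bullet> b) \<in> borel_measurable (lebesgue_on \<Omega>)" if "f \<in> borel_measurable (lebesgue_on \<Omega>)"
      for f :: "real^'d \<Rightarrow> 'z::euclidean_space" and b
      using that by (intro borel_measurable_inner) auto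
    \<comment> \<open>Entry (i, j) is the inner product with the basis matrix
      \<open>axis i (axis j 1)\<close>, which reduces measurability to that of the matrix-valued
      function C.\<close>
    have "(C x *v p x) \<bullet> q x = (\<Sum>i\<in>UNIV. \<Sum>j\<in>UNIV. (C x \<bullet> axis i (axis j 1)) * (p x \<bullet> axis j 1) * (q x \<bullet> axis i 1))" for x
      unfolding inner_vec_def[of "C x *v p x"]
      by (simp add: matrix_vector_mult_def inner_axis sum_distrib_right)
    then show "(\<lambda>x. (C x *v p x) \<bullet> q x) \<in> borel_measurable (lebesgue_on \<Omega>)"
      by (simp only:) (intro borel_measurable_sum borel_measurable_times nth C(1) pm)
    fix x assume x: "x \<in> K \<inter> \<Omega>"
    then have "norm (p x) \<le> P" "norm (q x) \<le> Q" using P Q by auto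
    then have "p x \<bullet> p x \<le> P\<^sup>2" "q x \<bullet> q x \<le> Q\<^sup>2"
      by (simp_all add: power2_norm_eq_inner[symmetric] power_mono)
    \<comment> \<open>Any unit vector, tested at the given point of the domain, puts
      \<open>cmin\<close> below \<open>cmax\<close>.\<close>
    moreover have "0 \<le> cmax"
    proof -
      obtain u :: "real^'m" where "norm u = 1" using vector_choose_size[of 1] by auto
      then show ?thesis using Cx(1)[of x u] x C(2) by auto
    qed
    ultimately have "cmax * (p x \<bullet> p x + q x \<bullet> q x) / 2 \<le> cmax * (P\<^sup>2 + Q\<^sup>2) / 2"
      by (intro divide_right_mono mult_left_mono add_mono) auto
    then show "\<bar>(C x *v p x) \<bullet> q x\<bar> \<le> cmax * (P\<^sup>2 + Q\<^sup>2) / 2"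
      using symmetric_form_bounds(3)[OF Cx(2,1) C(2), of x "p x" "q x"] x by (meson IntD2 order_trans)
  qed
qed

section \<open>Pointwise algebra of the face fluxes\<close>

lemma element_flux_expand:
  fixes a :: "real^'d^'m"
  shows "(a *v v) \<bullet> s + (((1 / 2) *\<^sub>R tj + (\<tau>v / 2) *\<^sub>R ((transpose a ** a) *v vj)) \<bullet> v +
      ((1 / 2) *\<^sub>R (a *v vj) + (\<tau>\<sigma> / 2) *\<^sub>R (a *v tj)) \<bullet> s) =
    v \<bullet> (transpose a *v s) + tj \<bullet> v / 2 + vj \<bullet> (transpose a *v s) / 2 +
      \<tau>v / 2 * ((a *v vj) \<bullet> (a *v v)) + \<tau>\<sigma> / 2 * (tj \<bullet> (transpose a *v s))"
proof -
  have 1: "((transpose a ** a) *v vj) \<bullet> v = (a *v vj) \<bullet> (a *v v)"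
    by (simp only: matrix_vector_mul_assoc[symmetric] inner_transpose_mult)
  have 2: "(a *v w) \<bullet> s = w \<bullet> (transpose a *v s)" for w
    using inner_transpose_mult[of a s w] by (simp only: inner_commute)
  show ?thesis by (simp only: inner_add_left inner_scaleR_left 1 2)
qed

text \<open>Integrand on one facet after integration by parts: the Green term, two central flux
  terms and two penalties. The argument \<open>tj\<close> is the traction jump, not the stress jump,
  so that the same expression covers boundary faces, where only the traction jump is
  prescribed.\<close>

definition element_flux :: "real^'d^'m \<Rightarrow> real \<Rightarrow> real \<Rightarrow> real^'d \<Rightarrow> real^'m \<Rightarrow> real^'d \<Rightarrow> real^'d \<Rightarrow> real" where
  "element_flux a \<tau>v \<tau>\<sigma> v s vj tj =
    v \<bullet> (transpose a *v s) + tj \<bullet> v / 2 + vj \<bullet> (transpose a *v s) / 2 +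
      \<tau>v / 2 * ((a *v vj) \<bullet> (a *v v)) + \<tau>\<sigma> / 2 * (tj \<bullet> (transpose a *v s))"

lemma matrix_uminus_mult: "(- a) *v x = - (a *v x)" for a :: "real^'d^'m"
  by (simp add: vec_eq_iff matrix_vector_mult_def sum_negf)

lemma transpose_uminus: "transpose (- a) = - transpose a"
  by (simp add: transpose_def vec_eq_iff)

text \<open>With S and S' the tractions of s and s' under \<open>transpose a\<close>, the central
  part seen from one side is (v \<bullet> S' + v' \<bullet> S) / 2, which is symmetric in the two
  sides; the reversed normal makes the two copies cancel. The vectors a [[v]] and a^T [[\<sigma>]]
  are the same from both sides, so the penalties combine to negative squares.\<close>

lemma interior_flux_cancel:
  fixes a :: "real^'d^'m"
  shows "element_flux a \<tau>v \<tau>\<sigma> v s (v' - v) (transpose a *v (s' - s)) +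
      element_flux (- a) \<tau>v \<tau>\<sigma> v' s' (v - v') (transpose (- a) *v (s - s')) =
    - (\<tau>v / 2 * (norm (a *v (v' - v)))\<^sup>2 + \<tau>\<sigma> / 2 * (norm (transpose a *v (s' - s)))\<^sup>2)"
proof -
  define S S' V V' where "S = transpose a *v s" and "S' = transpose a *v s'" and "V = a *v v" and "V' = a *v v'"
  show ?thesis
    unfolding element_flux_def power2_norm_eq_inner transpose_uminus matrix_uminus_mult
      matrix_vector_mult_diff_distrib S_def[symmetric] S'_def[symmetric] V_def[symmetric] V'_def[symmetric]
    by (simp add: inner_diff_left inner_diff_right inner_commute field_simps)
qed

text \<open>Half of the doubled jump cancels the Green term, and the factor 2 turns the penalty
  weight \<tau>/2 into \<tau>.\<close>

lemma velocity_boundary_flux: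
  "element_flux a \<tau>v \<tau>\<sigma> v s ((- 2) *\<^sub>R v) 0 = - (\<tau>v * (norm (a *v v))\<^sup>2)"
proof -
  have "a *v ((- 2) *\<^sub>R v) = (- 2) *\<^sub>R (a *v v)" by (rule matrix_vector_mult_scaleR)
  then show ?thesis
    unfolding element_flux_def power2_norm_eq_inner by (simp add: inner_commute del: transpose_matrix_vector)
qed

lemma traction_boundary_flux:
  "element_flux a \<tau>v \<tau>\<sigma> v s 0 ((- 2) *\<^sub>R (transpose a *v s)) = - (\<tau>\<sigma> * (norm (transpose a *v s))\<^sup>2)"
  by (simp add: element_flux_def power2_norm_eq_inner inner_commute del: transpose_matrix_vector)

text \<open>Each of the two central terms cancels half of the Green term; the jumps are not doubled,
  so both penalties keep the weight \<tau>/2.\<close>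

lemma absorbing_boundary_flux:
  "element_flux a \<tau>v \<tau>\<sigma> v s (- v) (- (transpose a *v s)) =
    - (\<tau>v / 2 * (norm (a *v v))\<^sup>2 + \<tau>\<sigma> / 2 * (norm (transpose a *v s))\<^sup>2)"
proof -
  have "a *v (- v) = - (a *v v)" using matrix_vector_mult_scaleR[of a "-1" v] by simp
  then show ?thesis
    by (simp add: element_flux_def power2_norm_eq_inner inner_commute del: transpose_matrix_vector)
qed

section \<open>Summation of the fluxes over the faces of the mesh\<close>

context
  fixes \<Omega> :: "(real^'d) set" and M :: "(real^'d) set set" and N :: nat
    and A :: "real^'d \<Rightarrow> real^'d^'m"
    and \<Gamma>v \<Gamma>\<sigma> \<Gamma>abc :: "(real^'d) set set" and \<tau>v \<tau>\<sigma> :: "(real^'d) set \<Rightarrow> real"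
    and v :: "(real^'d) set \<Rightarrow> real^'d \<Rightarrow> real^'d" and \<sigma> :: "(real^'d) set \<Rightarrow> real^'d \<Rightarrow> real^'m"
  assumes dom: "lipschitz_domain \<Omega>" and mesh: "simplicial_mesh \<Omega> M" and A: "linear A"
    and bdry: "\<Gamma>v \<union> \<Gamma>\<sigma> \<union> \<Gamma>abc = boundary_faces \<Omega> M"
      "\<Gamma>v \<inter> \<Gamma>\<sigma> = {}" "\<Gamma>v \<inter> \<Gamma>abc = {}" "\<Gamma>\<sigma> \<inter> \<Gamma>abc = {}"
    and v: "\<And>K. K \<in> M \<Longrightarrow> v K \<in> poly_space N" and \<sigma>: "\<And>K. K \<in> M \<Longrightarrow> \<sigma> K \<in> poly_space N"
begin

abbreviation (input) "vj \<equiv> velocity_jump M \<Gamma>v \<Gamma>\<sigma> \<Gamma>abc v"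
abbreviation (input) "tj \<equiv> traction_jump A M \<Gamma>v \<Gamma>\<sigma> \<Gamma>abc \<sigma>"

definition flux :: "(real^'d) set \<Rightarrow> (real^'d) set \<Rightarrow> real^'d \<Rightarrow> real" where
  "flux K F x = element_flux (A (outward_normal K F)) (\<tau>v F) (\<tau>\<sigma> F) (v K x) (\<sigma> K x) (vj K F x) (tj K F x)"

lemma face_cases:
  assumes "F \<in> mesh_faces M"
  shows "F \<in> interior_faces \<Omega> M \<or> F \<in> \<Gamma>v \<or> F \<in> \<Gamma>\<sigma> \<or> F \<in> \<Gamma>abc"
  using assms bdry(1) by (auto simp: interior_faces_def)

lemma interior_face_not_boundary:
  assumes "F \<in> interior_faces \<Omega> M" shows "F \<notin> \<Gamma>v" "F \<notin> \<Gamma>\<sigma>" "F \<notin> \<Gamma>abc"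
  using assms bdry(1) by (auto simp: interior_faces_def)

lemma matrix_mult_continuous:
  fixes a :: "real^'k^'l" and f :: "real^'d \<Rightarrow> real^'k"
  shows "continuous_on S f \<Longrightarrow> continuous_on S (\<lambda>x. a *v f x)"
  by (rule bounded_linear.continuous_on[OF bounded_linear_matrix_mult])

text \<open>Continuity gives integrability of the fluxes on facets, which additivity of facet
  integrals requires. Disjointness of the boundary parts decides which branch of the jump
  definitions applies.\<close>

lemma jumps_continuous:
  assumes K: "K \<in> M" and F: "F facet_of K"
  shows "continuous_on UNIV (vj K F)" "continuous_on UNIV (tj K F)"
proof -
  have c: "continuous_on UNIV (v K')" "continuous_on UNIV (\<sigma> K')" if "K' \<in> M" for K'
    using v[OF that] \<sigma>[OF that] by (auto intro: poly_space_continuous)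
  have Fm: "F \<in> mesh_faces M" using K F by (auto simp: mesh_faces_def)
  consider "F \<in> \<Gamma>v" | "F \<in> \<Gamma>\<sigma>" | "F \<in> \<Gamma>abc" | "F \<in> interior_faces \<Omega> M" using face_cases[OF Fm] by blast
  moreover have ex: "F \<in> \<Gamma>\<sigma> \<Longrightarrow> F \<notin> \<Gamma>v" "F \<in> \<Gamma>abc \<Longrightarrow> F \<notin> \<Gamma>v" "F \<in> \<Gamma>abc \<Longrightarrow> F \<notin> \<Gamma>\<sigma>"
    using bdry(2-4) by blast+
  ultimately have "continuous_on UNIV (vj K F) \<and> continuous_on UNIV (tj K F)"
  proof cases
    case 4
    then show ?thesis
      using interior_face_not_boundary[OF 4] interior_face_neighbor(1)[OF dom mesh 4 K F] K
      unfolding velocity_jump_def[abs_def] traction_jump_def[abs_def] jump_def Let_def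
      by (auto simp del: transpose_matrix_vector intro!: continuous_intros matrix_mult_continuous c)
  qed (use ex K in \<open>auto simp: velocity_jump_def[abs_def] traction_jump_def[abs_def] Let_def simp del: transpose_matrix_vector
        intro!: continuous_intros matrix_mult_continuous c\<close>)
  then show "continuous_on UNIV (vj K F)" "continuous_on UNIV (tj K F)" by auto
qed

lemma flux_continuous:
  assumes K: "K \<in> M" and F: "F facet_of K"
  shows "continuous_on UNIV (flux K F)"
  using jumps_continuous[OF assms] poly_space_continuous[OF v[OF K]] poly_space_continuous[OF \<sigma>[OF K]]
  unfolding flux_def[abs_def] element_flux_def
  by (auto intro!: continuous_intros matrix_mult_continuous simp del: transpose_matrix_vector)

text \<open>The right-hand sides of the two equations, each tested with its own unknown: Green's
  identity replaces the volume terms, leaving facet integrals only.\<close>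

lemma element_balance:
  assumes K: "K \<in> M"
  shows "L2_inner K (\<lambda>x. \<Sum>i\<in>UNIV. transpose (A (axis i 1)) *v partial i (\<sigma> K) x) (v K) +
      boundary_inner K (\<lambda>F x. (1 / 2) *\<^sub>R tj K F x +
         (\<tau>v F / 2) *\<^sub>R ((transpose (A (outward_normal K F)) ** A (outward_normal K F)) *v vj K F x)) (v K) +
      (L2_inner K (\<lambda>x. \<Sum>i\<in>UNIV. A (axis i 1) *v partial i (v K) x) (\<sigma> K) +
      boundary_inner K (\<lambda>F x. (1 / 2) *\<^sub>R (A (outward_normal K F) *v vj K F x) +
         (\<tau>\<sigma> F / 2) *\<^sub>R (A (outward_normal K F) *v tj K F x)) (\<sigma> K)) =
    (\<Sum>F | F facet_of K. facet_integral F (flux K F))"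
proof -
  note el = mesh_element(1,2)[OF dom mesh K]
  have c: "continuous_on UNIV (v K)" "continuous_on UNIV (\<sigma> K)"
    using v[OF K] \<sigma>[OF K] by (auto intro: poly_space_continuous)
  let ?g = "\<lambda>F x. (A (outward_normal K F) *v v K x) \<bullet> \<sigma> K x"
  let ?f = "\<lambda>F x. ((1 / 2) *\<^sub>R tj K F x +
         (\<tau>v F / 2) *\<^sub>R ((transpose (A (outward_normal K F)) ** A (outward_normal K F)) *v vj K F x)) \<bullet> v K x"
  let ?h = "\<lambda>F x. ((1 / 2) *\<^sub>R (A (outward_normal K F) *v vj K F x) +
         (\<tau>\<sigma> F / 2) *\<^sub>R (A (outward_normal K F) *v tj K F x)) \<bullet> \<sigma> K x"
  have "facet_integral F (flux K F) = facet_integral F (?g F) + (facet_integral F (?f F) + facet_integral F (?h F))"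
    if F: "F facet_of K" for F
  proof -
    note jc = jumps_continuous[OF K F]
    have cg: "continuous_on UNIV (?g F)" and cf: "continuous_on UNIV (?f F)" and ch: "continuous_on UNIV (?h F)"
      by (intro continuous_on_inner continuous_on_add continuous_on_scaleR continuous_on_const matrix_mult_continuous c jc)+
    have "flux K F = (\<lambda>x. ?g F x + (?f F x + ?h F x))"
      by (rule ext) (simp only: flux_def element_flux_def inner_add_left[symmetric] element_flux_expand)
    then show ?thesis
      using facet_integral_add[OF el F cg continuous_on_add[OF cf ch]] facet_integral_add[OF el F cf ch] by simp
  qed
  then have "(\<Sum>F | F facet_of K. facet_integral F (flux K F)) =
      (\<Sum>F | F facet_of K. facet_integral F (?g F)) +
      ((\<Sum>F | F facet_of K. facet_integral F (?f F)) + (\<Sum>F | F facet_of K. facet_integral F (?h F)))"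
    by (simp add: sum.distrib)
  then show ?thesis
    using element_green_identity[OF el A v[OF K] \<sigma>[OF K]] by (simp add: boundary_inner_def)
qed

text \<open>Exactly two elements contain the face, the minus side and its neighbor, so the sum
  consists of two fluxes that can be added under one integral.\<close>

lemma interior_face_balance:
  assumes F: "F \<in> interior_faces \<Omega> M"
  shows "(\<Sum>K | K \<in> M \<and> F facet_of K. facet_integral F (flux K F)) =
    - facet_integral F (\<lambda>x. \<tau>v F / 2 * (norm (A (face_normal M F) *v vj (minus_side M F) F x))\<^sup>2 +
        \<tau>\<sigma> F / 2 * (norm (tj (minus_side M F) F x))\<^sup>2)"
proof -
  have Fm: "F \<in> mesh_faces M" using F by (simp add: interior_faces_def)
  define K where "K = minus_side M F"
  have K: "K \<in> M" "F facet_of K" using minus_side_element[OF dom mesh Fm] by (auto simp: K_def)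
  define K' where "K' = neighbor M K F"
  note nb = interior_face_neighbor[OF dom mesh F K, folded K'_def]
  note nB = interior_face_not_boundary[OF F]
  let ?a = "A (outward_normal K F)"
  have a': "A (outward_normal K' F) = - ?a" using nb(4) linear_neg[OF A] by simp
  have vjK: "vj K F x = v K' x - v K x" "vj K' F x = v K x - v K' x" for x
    using nB nb(6) by (simp_all add: velocity_jump_def jump_def K'_def)
  have tjK: "tj K F x = transpose ?a *v (\<sigma> K' x - \<sigma> K x)" "tj K' F x = transpose (- ?a) *v (\<sigma> K x - \<sigma> K' x)" for x
    using nB nb(6) a' by (simp_all add: traction_jump_def jump_def K'_def del: transpose_matrix_vector)
  have "(\<Sum>K | K \<in> M \<and> F facet_of K. facet_integral F (flux K F)) = facet_integral F (flux K F) + facet_integral F (flux K' F)"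
    unfolding nb(5) using nb(2) by simp
  also have "\<dots> = facet_integral F (\<lambda>x. flux K F x + flux K' F x)"
    using facet_integral_add[OF mesh_element(1,2)[OF dom mesh K(1)] K(2) flux_continuous[OF K] flux_continuous[OF nb(1,3)]] by simp
  also have "(\<lambda>x. flux K F x + flux K' F x) = (\<lambda>x. (- 1) * (\<tau>v F / 2 * (norm (?a *v vj K F x))\<^sup>2 + \<tau>\<sigma> F / 2 * (norm (tj K F x))\<^sup>2))"
    by (rule ext) (simp only: flux_def a' vjK tjK interior_flux_cancel mult_minus1)
  also have "facet_integral F \<dots> = - facet_integral F (\<lambda>x. \<tau>v F / 2 * (norm (?a *v vj K F x))\<^sup>2 + \<tau>\<sigma> F / 2 * (norm (tj K F x))\<^sup>2)"
    by (subst facet_integral_cmult[OF mesh_element(1,2)[OF dom mesh K(1)] K(2)]) simp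
  finally show ?thesis by (simp add: K_def face_normal_def)
qed

lemma boundary_face_balance:
  assumes F: "F \<in> boundary_faces \<Omega> M"
    and eq: "\<And>x. flux (minus_side M F) F x = - g x"
  shows "(\<Sum>K | K \<in> M \<and> F facet_of K. facet_integral F (flux K F)) = - facet_integral F g"
proof -
  have Fm: "F \<in> mesh_faces M" using F by (simp add: boundary_faces_def)
  define K where "K = minus_side M F"
  have K: "K \<in> M" "F facet_of K" using minus_side_element[OF dom mesh Fm] by (auto simp: K_def)
  have "(\<Sum>K | K \<in> M \<and> F facet_of K. facet_integral F (flux K F)) = facet_integral F (flux K F)"
    unfolding boundary_face_elements[OF dom mesh F K] by simp
  also have "flux K F = (\<lambda>x. (- 1) * g x)" using eq by (auto simp: K_def)
  also have "facet_integral F \<dots> = - facet_integral F g"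
    by (subst facet_integral_cmult[OF mesh_element(1,2)[OF dom mesh K(1)] K(2)]) simp
  finally show ?thesis .
qed

lemma velocity_face_balance:
  assumes F: "F \<in> \<Gamma>v"
  shows "(\<Sum>K | K \<in> M \<and> F facet_of K. facet_integral F (flux K F)) =
    - facet_integral F (\<lambda>x. \<tau>v F * (norm (A (face_normal M F) *v v (minus_side M F) x))\<^sup>2)"
proof (rule boundary_face_balance)
  show "F \<in> boundary_faces \<Omega> M" using F bdry(1) by blast
  have "vj K F x = (- 2) *\<^sub>R v K x" "tj K F x = 0" for K x
    using F by (simp_all add: velocity_jump_def traction_jump_def)
  then show "flux (minus_side M F) F x = - (\<tau>v F * (norm (A (face_normal M F) *v v (minus_side M F) x))\<^sup>2)" for x
    by (simp only: flux_def velocity_boundary_flux face_normal_def)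
qed

lemma traction_face_balance:
  assumes F: "F \<in> \<Gamma>\<sigma>"
  shows "(\<Sum>K | K \<in> M \<and> F facet_of K. facet_integral F (flux K F)) =
    - facet_integral F (\<lambda>x. \<tau>\<sigma> F * (norm (transpose (A (face_normal M F)) *v \<sigma> (minus_side M F) x))\<^sup>2)"
proof (rule boundary_face_balance)
  show "F \<in> boundary_faces \<Omega> M" using F bdry(1) by blast
  have "F \<notin> \<Gamma>v" using F bdry(2) by blast
  then have "vj K F x = 0" "tj K F x = (- 2) *\<^sub>R (transpose (A (outward_normal K F)) *v \<sigma> K x)" for K x
    using F by (simp_all add: velocity_jump_def traction_jump_def del: transpose_matrix_vector)
  then show "flux (minus_side M F) F x = - (\<tau>\<sigma> F * (norm (transpose (A (face_normal M F)) *v \<sigma> (minus_side M F) x))\<^sup>2)" for x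
    by (simp only: flux_def traction_boundary_flux face_normal_def)
qed

lemma absorbing_face_balance:
  assumes F: "F \<in> \<Gamma>abc"
  shows "(\<Sum>K | K \<in> M \<and> F facet_of K. facet_integral F (flux K F)) =
    - facet_integral F (\<lambda>x. \<tau>v F / 2 * (norm (A (face_normal M F) *v v (minus_side M F) x))\<^sup>2 +
        \<tau>\<sigma> F / 2 * (norm (transpose (A (face_normal M F)) *v \<sigma> (minus_side M F) x))\<^sup>2)"
proof (rule boundary_face_balance)
  show "F \<in> boundary_faces \<Omega> M" using F bdry(1) by blast
  have "F \<notin> \<Gamma>v" "F \<notin> \<Gamma>\<sigma>" using F bdry(3,4) by blast+
  then have "vj K F x = - v K x" "tj K F x = - (transpose (A (outward_normal K F)) *v \<sigma> K x)" for K x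
    using F by (simp_all add: velocity_jump_def traction_jump_def del: transpose_matrix_vector)
  then show "flux (minus_side M F) F x = - (\<tau>v F / 2 * (norm (A (face_normal M F) *v v (minus_side M F) x))\<^sup>2 +
        \<tau>\<sigma> F / 2 * (norm (transpose (A (face_normal M F)) *v \<sigma> (minus_side M F) x))\<^sup>2)" for x
    by (simp only: flux_def absorbing_boundary_flux face_normal_def)
qed

text \<open>Double counting of incident pairs: the sum over elements and their facets is the sum
  over faces and their adjacent elements, and each kind of face has its own balance.\<close>

lemma total_flux_balance:
  "(\<Sum>K\<in>M. \<Sum>F | F facet_of K. facet_integral F (flux K F)) =
    - (\<Sum>F\<in>interior_faces \<Omega> M. facet_integral F (\<lambda>x.
         \<tau>v F / 2 * (norm (A (face_normal M F) *v vj (minus_side M F) F x))\<^sup>2 +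
         \<tau>\<sigma> F / 2 * (norm (tj (minus_side M F) F x))\<^sup>2))
    - (\<Sum>F\<in>\<Gamma>v. facet_integral F (\<lambda>x. \<tau>v F * (norm (A (face_normal M F) *v v (minus_side M F) x))\<^sup>2))
    - (\<Sum>F\<in>\<Gamma>\<sigma>. facet_integral F (\<lambda>x. \<tau>\<sigma> F * (norm (transpose (A (face_normal M F)) *v \<sigma> (minus_side M F) x))\<^sup>2))
    - (\<Sum>F\<in>\<Gamma>abc. facet_integral F (\<lambda>x. \<tau>v F / 2 * (norm (A (face_normal M F) *v v (minus_side M F) x))\<^sup>2 +
         \<tau>\<sigma> F / 2 * (norm (transpose (A (face_normal M F)) *v \<sigma> (minus_side M F) x))\<^sup>2))"
proof -
  let ?s = "\<lambda>F. \<Sum>K | K \<in> M \<and> F facet_of K. facet_integral F (flux K F)"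
  have fin: "finite (mesh_faces M)" by (rule mesh_faces_finite[OF dom mesh])
  have faces: "mesh_faces M = interior_faces \<Omega> M \<union> (\<Gamma>v \<union> (\<Gamma>\<sigma> \<union> \<Gamma>abc))"
    using bdry(1) by (auto simp: interior_faces_def boundary_faces_def)
  then have fins: "finite (interior_faces \<Omega> M)" "finite \<Gamma>v" "finite \<Gamma>\<sigma>" "finite \<Gamma>abc"
    using fin by auto
  have dis: "interior_faces \<Omega> M \<inter> (\<Gamma>v \<union> (\<Gamma>\<sigma> \<union> \<Gamma>abc)) = {}" "\<Gamma>v \<inter> (\<Gamma>\<sigma> \<union> \<Gamma>abc) = {}" "\<Gamma>\<sigma> \<inter> \<Gamma>abc = {}"
    using bdry interior_face_not_boundary by blast+
  \<comment> \<open>Facets are written as a restriction of one finite set common to all elements, so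
    that the two sums can be exchanged.\<close>
  have "(\<Sum>K\<in>M. \<Sum>F | F facet_of K. facet_integral F (flux K F)) =
      (\<Sum>K\<in>M. \<Sum>F | F \<in> mesh_faces M \<and> F facet_of K. facet_integral F (flux K F))"
  proof (rule sum.cong[OF refl])
    fix K assume "K \<in> M"
    then have "{F. F facet_of K} = {F \<in> mesh_faces M. F facet_of K}" by (auto simp: mesh_faces_def)
    then show "(\<Sum>F | F facet_of K. facet_integral F (flux K F)) =
      (\<Sum>F | F \<in> mesh_faces M \<and> F facet_of K. facet_integral F (flux K F))" by simp
  qed
  also have "\<dots> = (\<Sum>F\<in>mesh_faces M. ?s F)"
    by (rule sum.swap_restrict[OF mesh_finite[OF dom mesh] fin])
  also have "\<dots> = (\<Sum>F\<in>interior_faces \<Omega> M. ?s F) + ((\<Sum>F\<in>\<Gamma>v. ?s F) + ((\<Sum>F\<in>\<Gamma>\<sigma>. ?s F) + (\<Sum>F\<in>\<Gamma>abc. ?s F)))"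
    unfolding faces using fins dis by (simp add: sum.union_disjoint)
  finally show ?thesis
    by (simp add: interior_face_balance velocity_face_balance traction_face_balance absorbing_face_balance sum_negf
        del: transpose_matrix_vector)
qed

end

section \<open>Assembly of the energy estimate\<close>

lemma mesh_facet_integral_nonneg:
  assumes "lipschitz_domain \<Omega>" "simplicial_mesh \<Omega> M" "F \<in> mesh_faces M" "\<And>x. 0 \<le> f x"
  shows "0 \<le> facet_integral F f"
  using assms(3) facet_integral_nonneg[OF mesh_element(1,2)[OF assms(1,2)] _ assms(4)]
  by (auto simp: mesh_faces_def)

theorem mainTheorem4:
  fixes \<Omega> :: "(real^('d::finite)) set" and M :: "(real^'d) set set" and N :: nat
    and \<iota> :: "'d \<Rightarrow> nat" and \<kappa> :: "('m::finite) \<Rightarrow> nat" and A :: "real^'d \<Rightarrow> real^'d^'m"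
    and \<rho> :: "real^'d \<Rightarrow> real" and \<rho>min \<rho>max :: real
    and C :: "real^'d \<Rightarrow> real^'m^'m" and cmin cmax ctmin ctmax :: real
    and \<Gamma>v \<Gamma>\<sigma> \<Gamma>abc :: "(real^'d) set set"
    and \<tau>v \<tau>\<sigma> :: "(real^'d) set \<Rightarrow> real"
    and I :: "real set"
    and v :: "real \<Rightarrow> (real^'d) set \<Rightarrow> real^'d \<Rightarrow> real^'d"
    and \<sigma> :: "real \<Rightarrow> (real^'d) set \<Rightarrow> real^'d \<Rightarrow> real^'m"
  assumes dim: "CARD('d) \<in> {2, 3}" "CARD('m) = CARD('d) * (CARD('d) + 1) div 2"
    and numbering: "bij_betw \<iota> UNIV {..<CARD('d)}" "bij_betw \<kappa> UNIV {..<CARD('m)}"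
    and A: "A = voigt_matrix \<iota> \<kappa>"
    and domain: "lipschitz_domain \<Omega>"
    and mesh: "simplicial_mesh \<Omega> M"
    and rho: "\<rho> \<in> borel_measurable (lebesgue_on \<Omega>)" "0 < \<rho>min"
      "\<forall>x\<in>\<Omega>. \<rho>min \<le> \<rho> x \<and> \<rho> x \<le> \<rho>max"
    and C: "C \<in> borel_measurable (lebesgue_on \<Omega>)" "0 < cmin" "0 < ctmin"
      "\<forall>x\<in>\<Omega>. transpose (C x) = C x"
      "\<forall>x\<in>\<Omega>. \<forall>u. norm u = 1 \<longrightarrow> cmin \<le> u \<bullet> (C x *v u) \<and> u \<bullet> (C x *v u) \<le> cmax"
      "\<forall>x\<in>\<Omega>. \<forall>u. norm u = 1 \<longrightarrow>
         ctmin \<le> u \<bullet> (matrix_inv (C x) *v u) \<and> u \<bullet> (matrix_inv (C x) *v u) \<le> ctmax"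
    and bdry: "\<Gamma>v \<union> \<Gamma>\<sigma> \<union> \<Gamma>abc = boundary_faces \<Omega> M"
      "\<Gamma>v \<inter> \<Gamma>\<sigma> = {}" "\<Gamma>v \<inter> \<Gamma>abc = {}" "\<Gamma>\<sigma> \<inter> \<Gamma>abc = {}"
    and tau: "\<forall>F\<in>mesh_faces M. 0 \<le> \<tau>v F \<and> 0 \<le> \<tau>\<sigma> F"
    and time: "is_interval I" "interior I \<noteq> {}"
    and space: "\<forall>t\<in>I. \<forall>K\<in>M. v t K \<in> poly_space N \<and> \<sigma> t K \<in> poly_space N"
    and diff: "\<forall>t\<in>I. \<forall>K\<in>M. \<forall>x\<in>K.
         (\<lambda>s. v s K x) differentiable (at t within I) \<and>
         (\<lambda>s. \<sigma> s K x) differentiable (at t within I)"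
    and velocity_eq: "\<forall>t\<in>I. \<forall>K\<in>M. \<forall>w\<in>poly_space N.
         L2_inner K (wadg_inv_scalar N K (\<lambda>x. 1 / \<rho> x) (time_deriv I v t K)) w =
           L2_inner K (\<lambda>x. \<Sum>i\<in>UNIV. transpose (A (axis i 1)) *v partial i (\<sigma> t K) x) w +
           boundary_inner K
             (\<lambda>F x. (1 / 2) *\<^sub>R traction_jump A M \<Gamma>v \<Gamma>\<sigma> \<Gamma>abc (\<sigma> t) K F x +
                (\<tau>v F / 2) *\<^sub>R ((transpose (A (outward_normal K F)) ** A (outward_normal K F)) *v
                   velocity_jump M \<Gamma>v \<Gamma>\<sigma> \<Gamma>abc (v t) K F x)) w"
    and stress_eq: "\<forall>t\<in>I. \<forall>K\<in>M. \<forall>q\<in>poly_space N.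
         L2_inner K (wadg_inv_matrix N K C (time_deriv I \<sigma> t K)) q =
           L2_inner K (\<lambda>x. \<Sum>i\<in>UNIV. A (axis i 1) *v partial i (v t K) x) q +
           boundary_inner K
             (\<lambda>F x. (1 / 2) *\<^sub>R (A (outward_normal K F) *v
                   velocity_jump M \<Gamma>v \<Gamma>\<sigma> \<Gamma>abc (v t) K F x) +
                (\<tau>\<sigma> F / 2) *\<^sub>R (A (outward_normal K F) *v
                   traction_jump A M \<Gamma>v \<Gamma>\<sigma> \<Gamma>abc (\<sigma> t) K F x)) q"
  defines "energy \<equiv> \<lambda>K s.
         L2_inner K (wadg_inv_scalar N K (\<lambda>x. 1 / \<rho> x) (v s K)) (v s K) +
         L2_inner K (wadg_inv_matrix N K C (\<sigma> s K)) (\<sigma> s K)"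
    and "dissipation \<equiv> \<lambda>t.
         - (\<Sum>F\<in>interior_faces \<Omega> M. facet_integral F (\<lambda>x.
              \<tau>v F / 2 * (norm (A (face_normal M F) *v
                 velocity_jump M \<Gamma>v \<Gamma>\<sigma> \<Gamma>abc (v t) (minus_side M F) F x))\<^sup>2 +
              \<tau>\<sigma> F / 2 * (norm
                 (traction_jump A M \<Gamma>v \<Gamma>\<sigma> \<Gamma>abc (\<sigma> t) (minus_side M F) F x))\<^sup>2))
         - (\<Sum>F\<in>\<Gamma>v. facet_integral F (\<lambda>x.
              \<tau>v F * (norm (A (face_normal M F) *v v t (minus_side M F) x))\<^sup>2))
         - (\<Sum>F\<in>\<Gamma>\<sigma>. facet_integral F (\<lambda>x.
              \<tau>\<sigma> F * (norm (transpose (A (face_normal M F)) *v \<sigma> t (minus_side M F) x))\<^sup>2))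
         - (\<Sum>F\<in>\<Gamma>abc. facet_integral F (\<lambda>x.
              \<tau>v F / 2 * (norm (A (face_normal M F) *v v t (minus_side M F) x))\<^sup>2 +
              \<tau>\<sigma> F / 2 * (norm (transpose (A (face_normal M F)) *v \<sigma> t (minus_side M F) x))\<^sup>2))"
  shows "\<forall>t\<in>I.
         (\<forall>K\<in>M. energy K differentiable (at t within I)) \<and>
         (\<Sum>K\<in>M. 1 / 2 * vector_derivative (energy K) (at t within I)) \<le> dissipation t \<and>
         dissipation t \<le> 0"
proof (intro ballI)
  fix t assume t: "t \<in> I"
  have linA: "linear A" unfolding A by (rule linear_voigt_matrix[OF dim numbering])
  have vt: "v t K \<in> poly_space N" and \<sigma>t: "\<sigma> t K \<in> poly_space N" if "K \<in> M" for K
    using space t that by blast+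
  \<comment> \<open>An interval with nonempty interior has no isolated points, endpoints included;
    this makes the one-sided or two-sided time derivative unique.\<close>
  have at: "at t within I \<noteq> bot"
  proof -
    have "connected I" using time(1) by (simp add: is_interval_connected)
    moreover have "\<nexists>a. I = {a}" using time(2) by auto
    ultimately have "t islimpt I" using t connected_imp_perfect by blast
    then show ?thesis by (simp add: trivial_limit_within)
  qed
  \<comment> \<open>The factor 2 is that of the derivative of a symmetric quadratic form; it cancels
    the 1/2 in the estimate.\<close>
  have en: "(energy K has_vector_derivative 2 * (\<Sum>F | F facet_of K. facet_integral F (flux M A \<Gamma>v \<Gamma>\<sigma> \<Gamma>abc \<tau>v \<tau>\<sigma> (v t) (\<sigma> t) K F))) (at t within I)"
    if K: "K \<in> M" for K
  proof -
    have int: "interior K \<noteq> {}" using mesh_element(2)[OF domain mesh K] .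
    note wv = weighted_projection_density[OF domain mesh K rho, where N = N]
    interpret s: weighted_projection K N "\<lambda>x y. C x *v y" cmin
      by (rule weighted_projection_stiffness[OF domain mesh K C(1,2,4,5)])
    have 1: "((\<lambda>s. L2_inner K (wadg_inv_scalar N K (\<lambda>x. 1 / \<rho> x) (v s K)) (v s K)) has_vector_derivative
        2 * L2_inner K (wadg_inv_scalar N K (\<lambda>x. 1 / \<rho> x) (time_deriv I v t K)) (v t K)) (at t within I)"
      unfolding time_deriv_def[abs_def]
      by (rule quadratic_form_time_derivative(2)[where u = "\<lambda>s. v s K" and
            E = "\<lambda>p q. L2_inner K (wadg_inv_scalar N K (\<lambda>x. 1 / \<rho> x) p) q", OF int at t])
         (use space diff K t wadg_inv_scalar_energy_sym[OF wv] wadg_inv_scalar_energy_add[OF wv] wadg_inv_scalar_energy_scale[OF wv] in auto)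
    have 2: "((\<lambda>s. L2_inner K (wadg_inv_matrix N K C (\<sigma> s K)) (\<sigma> s K)) has_vector_derivative
        2 * L2_inner K (wadg_inv_matrix N K C (time_deriv I \<sigma> t K)) (\<sigma> t K)) (at t within I)"
      unfolding time_deriv_def[abs_def] wadg_inv_matrix_def
      by (rule quadratic_form_time_derivative(2)[where u = "\<lambda>s. \<sigma> s K" and
            E = "\<lambda>p q. L2_inner K (wadg_inv N K (\<lambda>x y. C x *v y) p) q", OF int at t])
         (use space diff K t s.energy_sym s.energy_add s.energy_scale in auto)
    have "L2_inner K (wadg_inv_scalar N K (\<lambda>x. 1 / \<rho> x) (time_deriv I v t K)) (v t K) +
        L2_inner K (wadg_inv_matrix N K C (time_deriv I \<sigma> t K)) (\<sigma> t K) =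
        (\<Sum>F | F facet_of K. facet_integral F (flux M A \<Gamma>v \<Gamma>\<sigma> \<Gamma>abc \<tau>v \<tau>\<sigma> (v t) (\<sigma> t) K F))"
      unfolding velocity_eq[rule_format, OF t K vt[OF K]] stress_eq[rule_format, OF t K \<sigma>t[OF K]]
      by (rule element_balance[OF domain mesh linA bdry vt \<sigma>t K])
    then show ?thesis
      using has_vector_derivative_add[OF 1 2] unfolding energy_def by (simp only: distrib_left[symmetric])
  qed
  have "(\<Sum>K\<in>M. 1 / 2 * vector_derivative (energy K) (at t within I)) =
      (\<Sum>K\<in>M. \<Sum>F | F facet_of K. facet_integral F (flux M A \<Gamma>v \<Gamma>\<sigma> \<Gamma>abc \<tau>v \<tau>\<sigma> (v t) (\<sigma> t) K F))"
    using vector_derivative_within[OF at en] by (intro sum.cong refl) simp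
  also have "\<dots> = dissipation t"
    unfolding dissipation_def by (rule total_flux_balance[OF domain mesh linA bdry vt \<sigma>t])
  finally have "(\<Sum>K\<in>M. 1 / 2 * vector_derivative (energy K) (at t within I)) = dissipation t" .
  moreover have "dissipation t \<le> 0"
  proof -
    have faces: "F \<in> mesh_faces M" if "F \<in> interior_faces \<Omega> M \<or> F \<in> \<Gamma>v \<or> F \<in> \<Gamma>\<sigma> \<or> F \<in> \<Gamma>abc" for F
      using that bdry(1) by (auto simp: interior_faces_def boundary_faces_def)
    have neg: "- a - b - c - d \<le> 0" if "0 \<le> a" "0 \<le> b" "0 \<le> c" "0 \<le> d" for a b c d :: real
      using that by linarith
    show ?thesis
      unfolding dissipation_def
      by (rule neg; rule sum_nonneg; rule mesh_facet_integral_nonneg[OF domain mesh faces])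
         (use tau faces in \<open>auto simp del: transpose_matrix_vector\<close>)
  qed
  moreover have "energy K differentiable at t within I" if "K \<in> M" for K
    using en[OF that] by (rule differentiableI_vector)
  ultimately show "(\<forall>K\<in>M. energy K differentiable at t within I) \<and>
      (\<Sum>K\<in>M. 1 / 2 * vector_derivative (energy K) (at t within I)) \<le> dissipation t \<and> dissipation t \<le> 0"
    by simp
qed

end
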